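(* Let $N_D(T)$ denote the number of zeros of $D$, counted with multiplicity, that satisfy $-\tfrac14\le\operatorname{Re}(s)\le\sigma_0$ and $0<\operatorname{Im}(s)\le T$. Then, as $T\to\infty$, $$N_D(T)=\frac{T}{2\pi}\log\frac{T}{2\pi}-\frac{T}{2\pi}+O(\log T).$$
   Context: Here $\zeta$ is the Riemann zeta function. $D$ is the function given by $D(s)=\sum_{n\ge1}\zeta(2n)\,n^{-s}$ for $\operatorname{Re}(s)>1$, continued meromorphically to $\mathbb{C}$ by $D(s)=\zeta(s)+E(s)$, where $E(s)=\sum_{n\ge1}(\zeta(2n)-1)n^{-s}$ converges absolutely for all $s\in\mathbb{C}$ and is entire; the only singularity of $D$ is a simple pole at $s=1$. The constant $\sigma_0=1.500127440\cdots$ is the unique real root $\sigma>1$ of $\sum_{n\ge2}\zeta(2n)n^{-\sigma}=\zeta(2)$. *)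

theory Defs
  imports "HOL-Complex_Analysis.Complex_Analysis" "HOL-Library.Landau_Symbols"
begin

(* nicely_meromorphic_on fixes the value 0 at poles and the limit value elsewhere, so the
   meromorphic continuation is unique as a total function (with riemann_zeta 1 = 0). *)
definition riemann_zeta :: "complex \<Rightarrow> complex" where
  "riemann_zeta = (THE f. f nicely_meromorphic_on UNIV \<and>
     (\<forall>s. Re s > 1 \<longrightarrow> (\<lambda>n. of_nat (Suc n) powr (- s)) sums f s))"

(* All series over n >= 1 are reindexed to start at 0 via Suc n. *)
definition E_fun :: "complex \<Rightarrow> complex" where
  "E_fun s = (\<Sum>n. (riemann_zeta (of_nat (2 * Suc n)) - 1) * of_nat (Suc n) powr (- s))"

(* The continuation of the Dirichlet series with coefficients zeta(2n). Only its value at the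
   pole s = 1 is a matter of convention. *)
definition D_fun :: "complex \<Rightarrow> complex" where
  "D_fun s = riemann_zeta s + E_fun s"

(* The series over n >= 2 is reindexed to start at 0; numerically sigma0 = 1.500127440... *)
definition sigma0 :: real where
  "sigma0 = (THE \<sigma>. \<sigma> > 1 \<and>
     (\<lambda>n. riemann_zeta (of_nat (2 * (n + 2))) * of_nat (n + 2) powr (- of_real \<sigma>))
       sums riemann_zeta 2)"

definition D_zeros :: "real \<Rightarrow> complex set" where
  "D_zeros T = {s. D_fun s = 0 \<and> - (1/4) \<le> Re s \<and> Re s \<le> sigma0 \<and> 0 < Im s \<and> Im s \<le> T}"

(* At a zero of D_fun in the upper half plane, where D_fun is holomorphic, zorder is the
   (positive) multiplicity. *)
definition N_D :: "real \<Rightarrow> int" where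
  "N_D T = (\<Sum>s\<in>D_zeros T. zorder D_fun s)"

end

(* The argument principle on the rectangle with vertical sides Re s = -1/4 and Re s = b > sigma0
   reduces the count to the variation of arg D along the sides. On Re s = b the real part of D is
   bounded below, so the right side contributes O(1). On a horizontal side the variation is at most
   a constant times the number of sign changes of Re D(x + iT), plus one; these are zeros of the
   holomorphic function (D(z + iT) + cnj (D(cnj z + iT))) / 2, of which Jensen's bound and the
   polynomial growth of D allow only O(log T). On Re s = -1/4 the function E is bounded while zeta
   grows like a power of t, so arg D differs from arg zeta by O(1), and the functional equation
   together with psi(z) = log z + O(1/|Im z|) turns arg zeta into the main term; the factor
   zeta(5/4 - it) has bounded argument because a finite Euler product moves it close to 1.

   The functional equation is first proved for real -1 < s < 0, where every integrand is
   nonnegative and Tonelli applies: zeta(s) = s(s+1)/2 * int_0^oo {u}(1-{u}) u^(-s-2) du, the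
   Fourier series of {u}(1-{u}) is integrated termwise, and int_0^oo (1 - cos v) v^(-s-2) dv is a
   quotient of Gamma values. The identity theorem extends it to the strip. *)
theory Submission
  imports Defs "HOL-Real_Asymp.Real_Asymp"
begin

section \<open>Continuation of the zeta function to the half plane Re s > -1\<close>

text \<open>Everything takes place in Re s > -1: a single trapezoid correction already continues
  zeta that far, and the coefficients zeta(2n) - 1, of size 4^(-n), keep E bounded there. With the
  left edge at -1/4, the point 1 - s runs on the line Re = 5/4, which is where Gamma and the zeta
  series are studied.

  Two substitutes stand in for Stirling's formula. The argument of Gamma comes from integrating Re
  psi along the line; its error 9/t integrates to 9 log t, cruder than Stirling but within the
  allowed O(log T). The modulus comes from the reflection formula on Re = 1 and monotonicity in the
  real part.

  The edge estimates hold only at large height, so the rectangle starts at a fixed ordinate t0 and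
  the zeros below it enter as a constant. The argument principle also excludes every T that is the
  ordinate of a zero. Since \<open>N_D\<close> is constant on some interval to the right of each T,
  these values are recovered by letting admissible heights decrease to T.\<close>

lemma holomorphic_suminf:
  fixes f :: "nat \<Rightarrow> complex \<Rightarrow> complex"
  assumes "open S" "\<And>n. f n holomorphic_on S"
    and "\<And>x. x \<in> S \<Longrightarrow> \<exists>d M. d > 0 \<and> cball x d \<subseteq> S \<and> summable M \<and> (\<forall>n. \<forall>y\<in>cball x d. norm (f n y) \<le> M n)"
  shows "(\<lambda>z. \<Sum>n. f n z) holomorphic_on S"
proof (rule holomorphic_uniform_sequence[OF assms(1)])
  show "(\<lambda>z. \<Sum>i<n. f i z) holomorphic_on S" for n
    by (intro holomorphic_intros assms)
  fix x assume "x \<in> S"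
  from assms(3)[OF this]
  obtain d M where dM: "d > 0" "cball x d \<subseteq> S" "summable M" "\<forall>n. \<forall>y\<in>cball x d. norm (f n y) \<le> M n"
    by (elim exE conjE)
  hence "uniform_limit (cball x d) (\<lambda>n z. \<Sum>i<n. f i z) (\<lambda>z. \<Sum>n. f n z) sequentially"
    by (intro Weierstrass_m_test) auto
  thus "\<exists>d>0. cball x d \<subseteq> S \<and> uniform_limit (cball x d) (\<lambda>n z. \<Sum>i<n. f i z) (\<lambda>z. \<Sum>n. f n z) sequentially"
    using dM by blast
qed

lemma norm_of_nat_powr: "norm (of_nat n powr (s::complex)) = real n powr Re s"
  by (subst norm_powr_real_powr) auto

definition zeta_series :: "complex \<Rightarrow> complex" where
  "zeta_series s = (\<Sum>n. of_nat (Suc n) powr (- s))"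

lemma summable_Suc_powr: "a > 1 \<Longrightarrow> summable (\<lambda>n. real (Suc n) powr (- a))"
  by (subst summable_Suc_iff) (simp add: summable_real_powr_iff)

lemma summable_norm_zeta_series: "Re s > 1 \<Longrightarrow> summable (\<lambda>n. norm (of_nat (Suc n) powr (- s)))"
  unfolding norm_of_nat_powr by (simp add: summable_Suc_powr del: of_nat_Suc)

lemma zeta_series_sums: "Re s > 1 \<Longrightarrow> (\<lambda>n. of_nat (Suc n) powr (- s)) sums zeta_series s"
  unfolding zeta_series_def by (intro summable_sums summable_norm_cancel[OF summable_norm_zeta_series])

lemma Re_cball: "y \<in> cball x d \<Longrightarrow> Re x - d \<le> Re y"
  using abs_Re_le_cmod[of "x - y"] by (simp add: dist_norm)

lemma holomorphic_zeta_series: "zeta_series holomorphic_on {s. Re s > 1}"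
  unfolding zeta_series_def[abs_def]
proof (rule holomorphic_suminf)
  show "open {s. 1 < Re s}" by (rule open_halfspace_Re_gt)
  show "(\<lambda>s. of_nat (Suc n) powr (- s)) holomorphic_on {s. 1 < Re s}" for n
    by (intro holomorphic_intros)
  fix x assume "x \<in> {s. 1 < Re s}"
  hence x: "Re x > 1" by simp
  define d where "d = (Re x - 1) / 2"
  have "norm (of_nat (Suc n) powr (- y)) \<le> real (Suc n) powr (- (1 + d))" if "y \<in> cball x d" for n y
    unfolding norm_of_nat_powr using Re_cball[OF that] by (intro powr_mono) (auto simp: d_def field_simps)
  moreover have "cball x d \<subseteq> {s. 1 < Re s}"
  proof
    fix y assume "y \<in> cball x d"
    from Re_cball[OF this] show "y \<in> {s. 1 < Re s}" using x by (simp add: d_def field_simps)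
  qed
  moreover have "summable (\<lambda>n. real (Suc n) powr (- (1 + d)))" using x by (intro summable_Suc_powr) (auto simp: d_def)
  ultimately show "\<exists>d M. d > 0 \<and> cball x d \<subseteq> {s. 1 < Re s} \<and> summable M \<and> (\<forall>n. \<forall>y\<in>cball x d. norm (of_nat (Suc n) powr (- y)) \<le> M n)"
    using x by (intro exI[of _ d] exI[of _ "\<lambda>n. real (Suc n) powr (- (1 + d))"]) (auto simp: d_def)
qed

text \<open>Euler--Maclaurin: these are $(s-1)$ times the trapezoid rule errors of $u^{-s}$ on $[n+1,n+2]$.\<close>
definition zeta_term :: "nat \<Rightarrow> complex \<Rightarrow> complex" where
  "zeta_term n s = (s - 1) * (of_nat (Suc n) powr (- s) + of_nat (Suc (Suc n)) powr (- s)) / 2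
     - of_nat (Suc n) powr (1 - s) + of_nat (Suc (Suc n)) powr (1 - s)"

text \<open>This is (s - 1) zeta(s). After multiplication by s - 1, the integral of u^(-s) over u >=
  1 contributes 1 and half of the term n = 1 contributes (s - 1)/2, so nothing is singular at s =
  1.\<close>

definition pole_free_zeta :: "complex \<Rightarrow> complex" where
  "pole_free_zeta s = 1 + (s - 1) / 2 + (\<Sum>n. zeta_term n s)"

text \<open>Peano kernel of the trapezoid rule: two integrations by parts against the parabola,
  which vanishes at both ends of the interval, leave only the endpoint values; \<open>Q\<close>
  collects the antiderivative. The kernel has size n^(-Re s - 2), which moves convergence from Re s
  > 1 to Re s > -1.\<close>

lemma has_integral_zeta_term:
  "((\<lambda>u. (s - 1) * s * (s + 1) / 2 * of_real ((u - real (Suc n)) * (real (Suc n) + 1 - u)) * of_real u powr (- s - 2))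
     has_integral zeta_term n s) {real (Suc n)..real (Suc n) + 1}"
proof -
  define N where "N = complex_of_nat (Suc n)"
  have N: "of_real (real (Suc n)) = N" "of_real (real (Suc n) + 1) = N + 1" by (auto simp: N_def)
  define Q where "Q = (\<lambda>u. - ((u - N) * (N + 1 - u) * (s * (s - 1) / 2) * u powr (- s - 1))
     - (s - 1) / 2 * (2 * N + 1 - 2 * u) * u powr (- s) + u powr (1 - s))"
  have "((\<lambda>u. (s - 1) * s * (s + 1) / 2 * of_real ((u - real (Suc n)) * (real (Suc n) + 1 - u)) * of_real u powr (- s - 2))
     has_integral (Q (of_real (real (Suc n) + 1)) - Q (of_real (real (Suc n))))) {real (Suc n)..real (Suc n) + 1}"
  proof (rule fundamental_theorem_of_calculus)
    fix x assume x: "x \<in> {real (Suc n)..real (Suc n) + 1}"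
    define u where "u = complex_of_real x"
    have u: "u \<notin> \<real>\<^sub>\<le>\<^sub>0" using x by (auto simp: u_def)
    hence u0: "u \<noteq> 0" by auto
    define w where "w = u powr (- s - 2)"
    have c: "u powr (k + 1) = u * u powr k" for k using u0 by (simp add: powr_add)
    have e: "u powr (- s - 1) = u * w" "u powr (- s) = u * (u * w)" "u powr (- s - 1 - 1) = w" "u powr (- s - 2) = w"
      "u powr (1 - s - 1) = u * (u * w)"
    proof -
      have a: "- s - 2 + 1 = - s - 1" "- s - 1 + 1 = - s" "- s - 1 - 1 = - s - 2" "1 - s - 1 = - s" by simp_all
      have b: "u powr (- s - 1) = u * w" using c[of "- s - 2"] unfolding a w_def .
      moreover have "u powr (- s) = u * (u * w)" using c[of "- s - 1"] unfolding a b .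
      ultimately show "u powr (- s - 1) = u * w" "u powr (- s) = u * (u * w)" "u powr (- s - 1 - 1) = w" "u powr (- s - 2) = w"
        "u powr (1 - s - 1) = u * (u * w)" unfolding a w_def by simp_all
    qed
    have P: "((\<lambda>u. u powr k) has_field_derivative k * u powr (k - 1)) (at u)" for k
      using u by (rule has_field_derivative_powr)
    have "(Q has_field_derivative (s - 1) * s * (s + 1) / 2 * ((u - N) * (N + 1 - u)) * w) (at u)"
      unfolding Q_def
      by (rule DERIV_cong, (rule P DERIV_const DERIV_ident DERIV_mult DERIV_add DERIV_diff DERIV_minus)+)
         (simp add: e algebra_simps diff_divide_distrib add_divide_distrib)
    hence "((\<lambda>x. Q (of_real x)) has_vector_derivative (s - 1) * s * (s + 1) / 2 * ((u - N) * (N + 1 - u)) * w) (at x within {real (Suc n)..real (Suc n) + 1})"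
      unfolding u_def by (rule has_vector_derivative_real_field)
    thus "((\<lambda>x. Q (of_real x)) has_vector_derivative (s - 1) * s * (s + 1) / 2 * of_real ((x - real (Suc n)) * (real (Suc n) + 1 - x)) * of_real x powr (- s - 2)) (at x within {real (Suc n)..real (Suc n) + 1})"
      by (simp add: w_def u_def N_def)
  qed simp
  also have "Q (of_real (real (Suc n) + 1)) - Q (of_real (real (Suc n))) = zeta_term n s"
  proof -
    have a: "complex_of_nat (Suc n) = N" "complex_of_nat (Suc (Suc n)) = N + 1" by (simp_all add: N_def)
    show ?thesis unfolding N Q_def zeta_term_def a
      by (simp add: algebra_simps diff_divide_distrib add_divide_distrib)
  qed
  finally show ?thesis .
qed

text \<open>The hypothesis makes the exponent of u in the kernel nonpositive, so the power is
  largest at the left end of the interval.\<close>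

lemma norm_zeta_term_le:
  assumes "Re s \<ge> -2"
  shows "norm (zeta_term n s) \<le> norm (s - 1) * norm s * norm (s + 1) * real (Suc n) powr (- Re s - 2)"
proof -
  let ?f = "\<lambda>u. (s - 1) * s * (s + 1) / 2 * of_real ((u - real (Suc n)) * (real (Suc n) + 1 - u)) * of_real u powr (- s - 2)"
  define B where "B = norm (s - 1) * norm s * norm (s + 1) * real (Suc n) powr (- Re s - 2)"
  have "norm (zeta_term n s) \<le> B * measure lborel (cbox (real (Suc n)) (real (Suc n) + 1))"
  proof (rule has_integral_bound)
    show "(?f
     has_integral zeta_term n s) (cbox (real (Suc n)) (real (Suc n) + 1))"
      using has_integral_zeta_term[of s n] by simp
    fix u assume "u \<in> cbox (real (Suc n)) (real (Suc n) + 1)"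
    hence u: "real (Suc n) \<le> u" "u \<le> real (Suc n) + 1" by auto
    have 1: "\<bar>(u - real (Suc n)) * (real (Suc n) + 1 - u)\<bar> \<le> 1 * 1"
      unfolding abs_mult using u by (intro mult_mono) auto
    have 2: "norm (complex_of_real u powr (- s - 2)) \<le> real (Suc n) powr (- Re s - 2)"
    proof -
      have "norm (complex_of_real u powr (- s - 2)) = u powr (- Re s - 2)"
        using u by (subst norm_powr_real_powr) auto
      also have "\<dots> \<le> real (Suc n) powr (- Re s - 2)"
        using u assms by (intro powr_mono2') auto
      finally show ?thesis .
    qed
    have "norm (?f u)
      = (norm (s - 1) * norm s * norm (s + 1)) / 2 * \<bar>(u - real (Suc n)) * (real (Suc n) + 1 - u)\<bar> * norm (of_real u powr (- s - 2))"
      by (simp only: norm_mult norm_divide norm_of_real) simp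
    also have "\<dots> \<le> (norm (s - 1) * norm s * norm (s + 1)) / 2 * 1 * real (Suc n) powr (- Re s - 2)"
      using 1 2 by (intro mult_mono order.refl) auto
    also have "\<dots> \<le> B" unfolding B_def by simp
    finally show "norm (?f u) \<le> B" .
  qed (auto simp: B_def)
  thus ?thesis by (simp add: B_def)
qed

lemma holomorphic_zeta_term [holomorphic_intros]: "zeta_term n holomorphic_on A"
  unfolding zeta_term_def[abs_def] by (intro holomorphic_intros) auto

lemma holomorphic_pole_free_zeta: "pole_free_zeta holomorphic_on {s. Re s > -1}"
proof -
  have "(\<lambda>s. \<Sum>n. zeta_term n s) holomorphic_on {s. Re s > -1}"
  proof (rule holomorphic_suminf)
    show "open {s. Re s > -1}" by (rule open_halfspace_Re_gt)
    fix x assume "x \<in> {s. Re s > -1}"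
    hence x: "Re x > -1" by simp
    define d where "d = (Re x + 1) / 2"
    define K where "K = norm x + d + 1"
    have d: "d > 0" using x by (simp add: d_def)
    have "norm (zeta_term n y) \<le> K * K * K * real (Suc n) powr (- (1 + d))" if y: "y \<in> cball x d" for n y
    proof -
      have Re: "Re y \<ge> -1 + d" using Re_cball[OF y] by (simp add: d_def field_simps)
      have ny: "norm y \<le> norm x + d"
        using y norm_triangle_sub[of y x] by (simp add: dist_norm norm_minus_commute)
      have n1: "norm (y - 1) \<le> K" using norm_triangle_ineq4[of y 1] ny by (simp add: K_def)
      have n2: "norm (y + 1) \<le> K" using norm_triangle_ineq[of y 1] ny by (simp add: K_def)
      have "norm (zeta_term n y) \<le> norm (y - 1) * norm y * norm (y + 1) * real (Suc n) powr (- Re y - 2)"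
        using Re d by (intro norm_zeta_term_le) auto
      also have "\<dots> \<le> K * K * K * real (Suc n) powr (- (1 + d))"
        using n1 n2 ny Re d by (intro mult_mono powr_mono) (auto simp: K_def)
      finally show ?thesis .
    qed
    moreover have "cball x d \<subseteq> {s. Re s > -1}"
  proof
    fix y assume "y \<in> cball x d"
    from Re_cball[OF this] show "y \<in> {s. Re s > -1}" using x by (simp add: d_def field_simps)
  qed
    moreover have "summable (\<lambda>n. K * K * K * real (Suc n) powr (- (1 + d)))"
      using d by (intro summable_mult summable_Suc_powr) auto
    ultimately show "\<exists>d M. d > 0 \<and> cball x d \<subseteq> {s. Re s > -1} \<and> summable M \<and> (\<forall>n. \<forall>y\<in>cball x d. norm (zeta_term n y) \<le> M n)"
      using d by blast
  qed (intro holomorphic_intros)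
  thus ?thesis unfolding pole_free_zeta_def[abs_def] by (intro holomorphic_intros) auto
qed

text \<open>The cube comes from the factor (s - 1) s (s + 1) of the kernel. Staying at Re s >= -1/2
  bounds the remaining series by the sum of n^(-3/2), uniformly in s. Jensen's bound later takes a
  logarithm, so the degree is immaterial.\<close>

lemma norm_pole_free_zeta_le:
  obtains C where "C > 0" "\<And>s. Re s \<ge> -1/2 \<Longrightarrow> norm (pole_free_zeta s) \<le> C * (1 + norm s) ^ 3"
proof
  define S where "S = (\<Sum>n. real (Suc n) powr (- (3/2)))"
  have S: "summable (\<lambda>n. real (Suc n) powr (- (3/2)))" by (rule summable_Suc_powr) simp
  have S0: "S \<ge> 0" unfolding S_def using S by (intro suminf_nonneg) auto
  show "2 + S > 0" using S0 by simp
  fix s assume s: "Re s \<ge> -1/2"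
  have n1: "norm (s - 1) \<le> 1 + norm s" using norm_triangle_ineq4[of s 1] by simp
  have n2: "norm (s + 1) \<le> 1 + norm s" using norm_triangle_ineq[of s 1] by simp
  have b: "norm (zeta_term n s) \<le> (1 + norm s) ^ 3 * real (Suc n) powr (- (3/2))" for n
  proof -
    have "norm (zeta_term n s) \<le> norm (s - 1) * norm s * norm (s + 1) * real (Suc n) powr (- Re s - 2)"
      using s by (intro norm_zeta_term_le) auto
    also have "\<dots> \<le> (1 + norm s) * (1 + norm s) * (1 + norm s) * real (Suc n) powr (- (3/2))"
    proof -
      have "- Re s - 2 \<le> - (3/2)" using s by argo
      thus ?thesis using n1 n2 by (intro mult_mono powr_mono) auto
    qed
    finally show ?thesis by (simp add: power3_eq_cube)
  qed
  have "norm (\<Sum>n. zeta_term n s) \<le> (1 + norm s) ^ 3 * S"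
    unfolding S_def suminf_mult[OF S, symmetric] by (rule norm_suminf_le[OF b summable_mult[OF S]])
  moreover have "norm (1 + (s - 1) / 2) \<le> 1 + norm (s - 1) / 2"
    using norm_triangle_ineq[of 1 "(s - 1) / 2"] by (simp add: norm_divide)
  moreover have "1 + norm (s - 1) / 2 \<le> 2 * (1 + norm s)" using n1 norm_ge_zero[of s] by argo
  moreover have "2 * (1 + norm s) \<le> 2 * (1 + norm s) ^ 3" using power_increasing[of 1 3 "1 + norm s"] by simp
  ultimately have "norm (pole_free_zeta s) \<le> 2 * (1 + norm s) ^ 3 + (1 + norm s) ^ 3 * S"
    unfolding pole_free_zeta_def using norm_triangle_ineq[of "1 + (s - 1) / 2" "\<Sum>n. zeta_term n s"] by linarith
  thus "norm (pole_free_zeta s) \<le> (2 + S) * (1 + norm s) ^ 3" by (simp add: algebra_simps)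
qed

lemma pole_free_zeta_eq_series:
  assumes s: "Re s > 1"
  shows "pole_free_zeta s = (s - 1) * zeta_series s"
proof -
  \<comment> \<open>The powers with exponent 1 - s telescope and the averaged terms recombine; what
    remains at \<open>Suc m\<close> tends to 0 exactly because Re s > 1.\<close>
  have part: "(\<Sum>n<m. zeta_term n s) = (s - 1) * ((\<Sum>n<m. of_nat (Suc n) powr (- s)) - 1/2 + of_nat (Suc m) powr (- s) / 2) - 1 + of_nat (Suc m) powr (1 - s)" for m
  proof (induction m)
    case (Suc m)
    show ?case unfolding sum.lessThan_Suc Suc.IH unfolding zeta_term_def
      by (simp add: algebra_simps add_divide_distrib diff_divide_distrib del: of_nat_Suc)
  qed (simp add: algebra_simps)
  have lim: "(\<lambda>m. complex_of_nat (Suc m) powr (- z)) \<longlonglongrightarrow> 0" if "Re z > 0" for z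
  proof (rule tendsto_norm_zero_cancel)
    have "(\<lambda>m. real (Suc m) powr (- Re z)) \<longlonglongrightarrow> 0" using that by real_asymp
    thus "(\<lambda>m. norm (complex_of_nat (Suc m) powr (- z))) \<longlonglongrightarrow> 0" by (simp add: norm_of_nat_powr del: of_nat_Suc)
  qed
  have "(\<lambda>m. \<Sum>n<m. zeta_term n s) \<longlonglongrightarrow> (s - 1) * (zeta_series s - 1/2 + 0 / 2) - 1 + 0"
    unfolding part
  proof (intro tendsto_intros)
    show "(\<lambda>m. \<Sum>n<m. of_nat (Suc n) powr (- s)) \<longlonglongrightarrow> zeta_series s"
      using zeta_series_sums[OF s] by (simp add: sums_def)
    show "(\<lambda>m. of_nat (Suc m) powr (- s)) \<longlonglongrightarrow> 0" by (rule lim) (use s in simp)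
    show "(\<lambda>m. of_nat (Suc m) powr (1 - s)) \<longlonglongrightarrow> 0" using lim[of "s - 1"] s by simp
  qed auto
  hence "(\<lambda>n. zeta_term n s) sums ((s - 1) * (zeta_series s - 1/2) - 1)" by (simp add: sums_def)
  thus ?thesis unfolding pole_free_zeta_def by (simp add: sums_iff algebra_simps diff_divide_distrib add_divide_distrib)
qed

lemma pole_free_zeta_1: "pole_free_zeta 1 = 1"
proof -
  have "zeta_term n 1 = 0" for n by (simp add: zeta_term_def del: of_nat_Suc)
  thus ?thesis by (simp add: pole_free_zeta_def)
qed

section \<open>A Fourier series\<close>

text \<open>Half-angle form: \<open>1 - cis t\<close> is the positive number 2 sin(t/2) times the
  unit vector of angle (t - pi)/2, and that angle already lies in the principal range.\<close>

lemma Ln_one_minus_cis: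
  assumes "0 < t" "t < 2 * pi"
  shows "Im (Ln (1 - cis t)) = (t - pi) / 2"
proof -
  have s: "sin (t/2) > 0" using assms by (intro sin_gt_zero) auto
  have "1 - cis t = of_real (2 * sin (t/2)) * exp (\<i> * of_real ((t - pi)/2))"
  proof -
    have a: "exp (\<i> * of_real ((t - pi)/2)) = cis ((t-pi)/2)" by (simp add: cis_conv_exp)
    have c: "cos t = 1 - 2 * (sin (t/2))^2" using cos_double_sin[of "t/2"] by simp
    have d: "sin t = 2 * sin (t/2) * cos (t/2)" using sin_double[of "t/2"] by simp
    have e: "cos ((t-pi)/2) = sin (t/2)" "sin ((t-pi)/2) = - cos (t/2)"
      by (simp_all add: diff_divide_distrib cos_diff sin_diff)
    show ?thesis unfolding a by (rule complex_eqI) (simp_all add: c d e power2_eq_square)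
  qed
  also have "Ln \<dots> = of_real (ln (2 * sin (t/2))) + Ln (exp (\<i> * of_real ((t - pi)/2)))"
    using s Ln_of_real[of "2 * sin (t/2)"] by (subst Ln_times_of_real) auto
  also have "Ln (exp (\<i> * of_real ((t - pi)/2))) = \<i> * of_real ((t - pi)/2)"
    using assms by (intro Ln_exp) auto
  finally show ?thesis by simp
qed

lemma summable_inverse_squares: "summable (\<lambda>n. 1 / (real (Suc n))\<^sup>2)"
  using inverse_power_summable[of 2, where 'a=real] 
  by (subst summable_Suc_iff) (simp add: field_simps)

lemma Ln_series_cis:
  assumes "0 \<le> r" "r < 1"
  shows "(\<lambda>n. r ^ Suc n * sin (real (Suc n) * t) / real (Suc n)) sums (- Im (Ln (1 - of_real r * cis t)))"
proof -
  have n: "cmod (of_real r * cis t) < 1" using assms by (simp add: norm_mult)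
  have "(\<lambda>n. - ((of_real r * cis t)^n) / of_nat n) sums ln (1 + (- (of_real r * cis t)))"
    using Ln_series'[of "- (of_real r * cis t)"] n by simp
  hence "(\<lambda>n. - ((of_real r * cis t)^(Suc n)) / of_nat (Suc n)) sums ln (1 - of_real r * cis t)"
    by (subst sums_Suc_iff) simp
  hence "(\<lambda>n. - Im (- ((of_real r * cis t)^(Suc n)) / of_nat (Suc n))) sums - Im (ln (1 - of_real r * cis t))"
    by (intro sums_minus sums_Im)
  moreover have "- Im (- ((of_real r * cis t)^(Suc n)) / of_nat (Suc n)) = r ^ Suc n * sin (real (Suc n) * t) / real (Suc n)" for n
  proof -
    have "(of_real r * cis t)^(Suc n) = of_real (r ^ Suc n) * cis (real (Suc n) * t)"
      by (simp only: power_mult_distrib Complex.DeMoivre of_real_power)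
    hence "- ((of_real r * cis t)^(Suc n)) / of_nat (Suc n) = of_real (- (r ^ Suc n) / real (Suc n)) * cis (real (Suc n) * t)"
      by simp
    thus ?thesis by (simp del: of_nat_Suc power_Suc)
  qed
  ultimately show ?thesis by simp
qed

text \<open>The factor r^n makes the differentiated sine series uniformly convergent, so it may be
  integrated term by term; at r = 1 the sine series converges only conditionally.\<close>

lemma abel_cos_series:
  assumes r: "0 \<le> r" "r < 1" and t: "0 \<le> t"
  shows "((\<lambda>x. - Im (Ln (1 - of_real r * cis x))) has_integral
          (\<Sum>n. r ^ Suc n * (1 - cos (real (Suc n) * t)) / (real (Suc n))\<^sup>2)) {0..t}"
proof -
  define f where "f = (\<lambda>n x. r ^ Suc n * (1 - cos (real (Suc n) * x)) / (real (Suc n))\<^sup>2)"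
  define f' where "f' = (\<lambda>n x. r ^ Suc n * sin (real (Suc n) * x) / real (Suc n))"
  have d: "(f n has_field_derivative f' n x) (at x within UNIV)" for n x
    unfolding f_def f'_def
    by (rule derivative_eq_intros refl | simp del: of_nat_Suc power_Suc)+
       (simp add: power2_eq_square power4_eq_xxxx field_simps del: of_nat_Suc power_Suc)
  have u: "uniformly_convergent_on UNIV (\<lambda>n x. \<Sum>i<n. f' i x)"
  proof (rule Weierstrass_m_test')
    show "summable (\<lambda>n. r ^ Suc n)" using r by (subst summable_Suc_iff) (simp add: summable_geometric)
    fix n x
    have "\<bar>f' n x\<bar> \<le> r ^ Suc n * 1 / 1" unfolding f'_def abs_mult abs_divide
      using r by (intro frac_le mult_mono) (auto simp del: power_Suc)
    thus "norm (f' n x) \<le> r ^ Suc n" by simp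
  qed
  have D: "((\<lambda>x. \<Sum>n. f n x) has_field_derivative (\<Sum>n. f' n x)) (at x)" for x
    by (rule has_field_derivative_series'(2)[OF _ _ u, of f 0]) (use d in \<open>auto simp: f_def\<close>)
  have E: "(\<Sum>n. f' n x) = - Im (Ln (1 - of_real r * cis x))" for x
    using Ln_series_cis[OF r, of x] unfolding f'_def by (simp add: sums_iff)
  have "((\<lambda>x. - Im (Ln (1 - of_real r * cis x))) has_integral ((\<Sum>n. f n t) - (\<Sum>n. f n 0))) {0..t}"
    using t D E by (intro fundamental_theorem_of_calculus) 
      (auto simp: has_real_derivative_iff_has_vector_derivative[symmetric] intro: has_field_derivative_at_within)
  thus ?thesis by (simp add: f_def)
qed

text \<open>Abel summation: r tends to 1 on both sides of the previous identity. The integrals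
  converge by domination, because a principal argument is at most pi in modulus, and the series by
  Tannery's theorem with majorant 2/n^2.\<close>

lemma cos_series_aux:
  assumes t: "0 \<le> t" "t \<le> 2 * pi"
  shows "(\<Sum>n. (1 - cos (real (Suc n) * t)) / (real (Suc n))\<^sup>2) = pi * t / 2 - t\<^sup>2 / 4"
proof -
  let ?a = "\<lambda>r n. r ^ Suc n * (1 - cos (real (Suc n) * t)) / (real (Suc n))\<^sup>2"
  define r where "r = (\<lambda>k::nat. 1 - 1 / (real k + 2))"
  have r: "0 \<le> r k" "r k < 1" for k by (auto simp: r_def field_simps)
  have rl: "r \<longlonglongrightarrow> 1" unfolding r_def by real_asymp
  define g where "g = (\<lambda>x. - Im (Ln (1 - cis x)))"
  define f where "f = (\<lambda>k x. - Im (Ln (1 - of_real (r k) * cis x)))"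
  note I = abel_cos_series[OF r t(1)]
  \<comment> \<open>At the multiples of 2 pi the argument of 1 - r is 0 for every r < 1, so the
    pointwise limit there is 0 and not the sawtooth value. These two points form a null set and are
    spiked away below.\<close>
  have lim1: "(\<lambda>k. integral {0..t} (f k)) \<longlonglongrightarrow> integral {0..t} (\<lambda>x. if x = 0 \<or> x = 2 * pi then 0 else g x)"
  proof (rule dominated_convergence(2)[where h = "\<lambda>_. pi"])
    have R: "Re (1 - of_real (r k) * cis x) > 0" for k x
    proof -
      have "\<bar>r k * cos x\<bar> \<le> r k * 1" unfolding abs_mult using r[of k] by (intro mult_mono) auto
      thus ?thesis using r[of k] by simp
    qed
    show "f k integrable_on {0..t}" for k using I[of k] unfolding f_def by blast
    show "(\<lambda>_. pi) integrable_on {0..t}" by (rule integrable_const_ivl)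
    show "norm (f k x) \<le> pi" for k x
      using mpi_less_Im_Ln[of "1 - of_real (r k) * cis x"] Im_Ln_le_pi[of "1 - of_real (r k) * cis x"] R[of k x]
      by (auto simp: f_def abs_le_iff complex_eq_iff)
    fix x assume x: "x \<in> {0..t}"
    show "(\<lambda>k. f k x) \<longlonglongrightarrow> (if x = 0 \<or> x = 2 * pi then 0 else g x)"
    proof (cases "x = 0 \<or> x = 2 * pi")
      case True
      hence [simp]: "cis x = 1" by auto
      have "f k x = 0" for k
      proof -
        have "1 - of_real (r k) * cis x = complex_of_real (1 - r k)" by simp
        thus ?thesis using r(2)[of k] unfolding f_def by (simp only: Im_Ln_of_real)
      qed
      thus ?thesis using True by simp
    next
      case False
      hence x': "0 < x" "x < 2 * pi" using x t by auto
      have "Re (1 - cis x) > 0"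
      proof -
        have "cos x \<noteq> 1"
          using x' sin_gt_zero[of "x/2"] cos_double_sin[of "x/2"] by auto
        thus ?thesis using cos_le_one[of x] by (simp add: less_le)
      qed
      hence "1 - of_real 1 * cis x \<notin> \<real>\<^sub>\<le>\<^sub>0" by (auto simp: complex_nonpos_Reals_iff)
      hence "(\<lambda>k. - Im (Ln (1 - of_real (r k) * cis x))) \<longlonglongrightarrow> - Im (Ln (1 - of_real 1 * cis x))"
        by (intro tendsto_intros rl) auto
      thus ?thesis using False unfolding f_def g_def by simp
    qed
  qed
  have "((\<lambda>x. pi * x / 2 - x\<^sup>2 / 4) has_vector_derivative ((pi - x) / 2)) (at x within {0..t})" for x
    unfolding has_real_derivative_iff_has_vector_derivative[symmetric]
    by (auto intro!: derivative_eq_intros simp: field_simps)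
  hence "((\<lambda>x. (pi - x) / 2) has_integral ((pi * t / 2 - t\<^sup>2 / 4) - (pi * 0 / 2 - 0\<^sup>2 / 4))) {0..t}"
    using t by (intro fundamental_theorem_of_calculus) auto
  hence F: "((\<lambda>x. (pi - x) / 2) has_integral (pi * t / 2 - t\<^sup>2 / 4)) {0..t}" by simp
  have "((\<lambda>x. if x = 0 \<or> x = 2 * pi then 0 else g x) has_integral (pi * t / 2 - t\<^sup>2 / 4)) {0..t}"
  proof (rule has_integral_spike[OF _ _ F, of "{0, 2 * pi}"])
    fix x assume x: "x \<in> {0..t} - {0, 2 * pi}"
    hence "0 < x" "x < 2 * pi" using t by auto
    from Ln_one_minus_cis[OF this] have "g x = (pi - x) / 2"
      unfolding g_def by (simp add: field_simps)
    thus "(if x = 0 \<or> x = 2 * pi then 0 else g x) = (pi - x) / 2"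
      using \<open>0 < x\<close> \<open>x < 2 * pi\<close> by simp
  qed auto
  hence I2: "integral {0..t} (\<lambda>x. if x = 0 \<or> x = 2 * pi then 0 else g x) = pi * t / 2 - t\<^sup>2 / 4"
    by (rule integral_unique)
  have lim2: "(\<lambda>k. \<Sum>n. ?a (r k) n) \<longlonglongrightarrow>
           (\<Sum>n. ?a 1 n)"
  proof (rule tannerys_theorem[THEN conjunct2, THEN conjunct2])
    show "summable (\<lambda>n. 2 * (1 / (real (Suc n))\<^sup>2))"
      by (rule summable_mult[OF summable_inverse_squares])
    show "(\<lambda>k. ?a (r k) n) \<longlonglongrightarrow>
       ?a 1 n" for n
      by (intro tendsto_intros rl) auto
    show "\<forall>\<^sub>F (n, k) in sequentially \<times>\<^sub>F sequentially.
       norm (?a (r k) n) \<le> 2 * (1 / (real (Suc n))\<^sup>2)"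
    proof (rule always_eventually, safe)
      fix n k
      have a: "\<bar>r k ^ Suc n\<bar> \<le> 1" using r[of k] by (auto intro!: power_le_one simp del: power_Suc)
      have b: "\<bar>1 - cos (real (Suc n) * t)\<bar> \<le> 2" using abs_cos_le_one[of "real (Suc n) * t"] by linarith
      have "\<bar>?a (r k) n\<bar> \<le> 1 * 2 / (real (Suc n))\<^sup>2"
        unfolding abs_mult abs_divide using a b by (intro frac_le mult_mono) (auto simp del: of_nat_Suc power_Suc)
      thus "norm (?a (r k) n) \<le> 2 * (1 / (real (Suc n))\<^sup>2)" by simp
    qed
  qed simp
  have "integral {0..t} (f k) = (\<Sum>n. ?a (r k) n)" for k
    unfolding f_def by (rule integral_unique[OF I])
  with lim1 lim2 I2 show ?thesis by (simp add: LIMSEQ_unique del: of_nat_Suc power_Suc)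
qed

lemma frac_parabola_series:
  "(\<lambda>n. (1 - cos (2 * pi * real (Suc n) * u)) / (pi * real (Suc n))\<^sup>2) sums (frac u * (1 - frac u))"
proof -
  define t where "t = 2 * pi * frac u"
  have t: "0 \<le> t" "t \<le> 2 * pi"
    using frac_ge_0[of u] frac_lt_1[of u] by (auto simp: t_def)
  have s: "summable (\<lambda>n. (1 - cos (real (Suc n) * t)) / (real (Suc n))\<^sup>2)"
  proof (rule summable_comparison_test')
    show "summable (\<lambda>n. 2 * (1 / (real (Suc n))\<^sup>2))"
      by (rule summable_mult[OF summable_inverse_squares])
    fix n
    have b: "\<bar>1 - cos (real (Suc n) * t)\<bar> \<le> 2" using abs_cos_le_one[of "real (Suc n) * t"] by linarith
    show "norm ((1 - cos (real (Suc n) * t)) / (real (Suc n))\<^sup>2) \<le> 2 * (1 / (real (Suc n))\<^sup>2)"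
      using b by (simp add: divide_right_mono del: of_nat_Suc)
  qed
  hence "(\<lambda>n. (1 - cos (real (Suc n) * t)) / (real (Suc n))\<^sup>2) sums (pi * t / 2 - t\<^sup>2 / 4)"
    using cos_series_aux[OF t] by (simp add: sums_iff)
  hence "(\<lambda>n. (1 - cos (real (Suc n) * t)) / (real (Suc n))\<^sup>2 / pi\<^sup>2) sums ((pi * t / 2 - t\<^sup>2 / 4) / pi\<^sup>2)"
    by (rule sums_divide)
  moreover have "(pi * t / 2 - t\<^sup>2 / 4) / pi\<^sup>2 = frac u * (1 - frac u)"
    by (simp add: t_def power2_eq_square field_simps)
  moreover have "cos (real (Suc n) * t) = cos (2 * pi * real (Suc n) * u)" for n
  proof -
    have "real (Suc n) * t = 2 * pi * real (Suc n) * u - 2 * pi * of_int (int (Suc n) * \<lfloor>u\<rfloor>)"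
      by (simp add: t_def frac_def algebra_simps)
    thus ?thesis by (simp only: cos_diff cos_int_2pin sin_int_2pin)
  qed
  ultimately show ?thesis by (simp add: power_mult_distrib mult.commute del: of_nat_Suc)
qed

section \<open>Mellin transforms\<close>

text \<open>Substitution t = c x^k in the Gamma integral. Both k = 1 (exponential) and k = 2
  (Gaussian) occur below. The extended nonnegative integral is the form in which Tonelli can be
  applied directly.\<close>

lemma nn_integral_Gamma_powr:
  fixes a c k :: real
  assumes a: "a > 0" and c: "c > 0" and k: "k > 0"
  shows "(\<integral>\<^sup>+x. ennreal (indicator {0<..} x * (x powr (k * a - 1) * exp (- c * x powr k))) \<partial>lborel)
           = ennreal (Gamma a / (k * c powr a))"
proof -
  define f where "f = (\<lambda>t::real. t powr (a - 1) / exp t)"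
  define g where "g = (\<lambda>x::real. c * x powr k)"
  define g' where "g' = (\<lambda>x::real. c * (k * x powr (k - 1)))"
  have I: "(f has_integral Gamma a) {0<..}"
  proof -
    have "((\<lambda>t. if t \<in> {0<..} then f t else 0) has_integral Gamma a) {0..}"
      by (rule has_integral_spike [of "{0}", OF _ _ Gamma_integral_real[OF a]]) (auto simp: f_def)
    also have "?this = ?thesis"
      by (subst has_integral_restrict) auto
    finally show ?thesis .
  qed
  have fa: "f absolutely_integrable_on {0<..}"
    by (rule nonnegative_absolutely_integrable_1) (use I in \<open>auto simp: f_def\<close>)
  have im: "g ` {0<..} = {0<..}"
  proof safe
    fix y :: real assume "y > 0"
    hence "y = g ((y / c) powr (1 / k))" using c k by (simp add: g_def powr_powr)
    moreover have "(y / c) powr (1 / k) \<in> {0<..}" using \<open>y > 0\<close> c by simp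
    ultimately show "y \<in> g ` {0<..}" by blast
  qed (use c in \<open>auto simp: g_def\<close>)
  have "(\<lambda>x. \<bar>g' x\<bar> * f(g x)) absolutely_integrable_on {0<..} \<and>
           integral {0<..} (\<lambda>x. \<bar>g' x\<bar> * f (g x)) = Gamma a
     \<longleftrightarrow> f absolutely_integrable_on (g ` {0<..}) \<and> integral (g ` {0<..}) f = Gamma a"
  proof (rule has_absolute_integral_change_of_variables_1')
    show "inj_on g {0<..}"
    proof (rule inj_onI)
      fix x y assume xy: "x \<in> {0<..}" "y \<in> {0<..}" "g x = g y"
      hence "(x powr k) powr (1 / k) = (y powr k) powr (1 / k)" using c by (simp add: g_def)
      thus "x = y" using xy k by (simp add: powr_powr)
    qed
    show "(g has_field_derivative g' x) (at x within {0<..})" if "x \<in> {0<..}" for x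
      using that unfolding g_def g'_def by (auto intro!: derivative_eq_intros)
  qed auto
  hence J: "((\<lambda>x. \<bar>g' x\<bar> * f(g x)) has_integral Gamma a) {0<..}"
    using fa I unfolding im by (metis integral_unique set_lebesgue_integral_eq_integral(1) has_integral_integral)
  have "((\<lambda>x. x powr (k * a - 1) * exp (- c * x powr k)) has_integral (1 / (k * c powr a)) * Gamma a) {0<..}"
  proof (rule has_integral_eq[OF _ has_integral_mult_right[OF J]])
    fix x :: real assume "x \<in> {0<..}"
    hence x: "x > 0" by simp
    have "c powr a = c * c powr (a - 1)" using c by (simp add: powr_diff)
    moreover have "x powr (k * a - 1) = x powr (k - 1) * (x powr k) powr (a - 1)"
      using x by (simp add: powr_powr powr_add[symmetric] algebra_simps)
    ultimately show "1 / (k * c powr a) * (\<bar>g' x\<bar> * f (g x)) = x powr (k * a - 1) * exp (- c * x powr k)"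
      using c k x by (simp add: g'_def f_def g_def powr_mult exp_minus field_simps)
  qed
  from nn_integral_has_integral_lebesgue[OF _ this] show ?thesis by simp
qed

lemma nn_integral_one_minus_cos_exp:
  fixes x :: real assumes x: "x > 0"
  shows "(\<integral>\<^sup>+v. ennreal (indicator {0<..} v * ((1 - cos v) * exp (- x * v))) \<partial>lborel) = ennreal (1 / (x * (x\<^sup>2 + 1)))"
proof -
  let ?g = "\<lambda>v. (1 - cos v) * exp (- x * v)"
  have nz: "x\<^sup>2 + 1 \<noteq> 0" by (metis add_nonneg_eq_0_iff zero_le_one zero_le_power2 zero_neq_one)
  \<comment> \<open>The antiderivative that vanishes at infinity. Integrating 1 and cos separately
    against the exponential gives \<open>- F 0\<close> = 1/x - x/(x^2 + 1).\<close>
  define F where "F = (\<lambda>v. - exp (- x * v) / x + exp (- x * v) * (x * cos v - sin v) / (x\<^sup>2 + 1))"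
  have "(\<integral>\<^sup>+v. ennreal (?g v) * indicator {0..} v \<partial>lborel) = ennreal (0 - F 0)"
  proof (rule nn_integral_FTC_atLeast)
    fix v :: real
    have "DERIV F v :> exp (- x * v) + ((- x * exp (- x * v)) * (x * cos v - sin v) + exp (- x * v) * (- x * sin v - cos v)) / (x\<^sup>2 + 1)"
      unfolding F_def using x nz by (auto intro!: derivative_eq_intros)
    also have "((- x * exp (- x * v)) * (x * cos v - sin v) + exp (- x * v) * (- x * sin v - cos v)) = - (x\<^sup>2 + 1) * (exp (- x * v) * cos v)"
      by (simp add: algebra_simps power2_eq_square)
    also have "exp (- x * v) + - (x\<^sup>2 + 1) * (exp (- x * v) * cos v) / (x\<^sup>2 + 1) = ?g v"
      using nz by (simp add: field_simps)
    finally show "DERIV F v :> ?g v" .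
    show "0 \<le> ?g v" by simp
  next
    have e: "((\<lambda>v. exp (- x * v)) \<longlongrightarrow> 0) at_top" using x by real_asymp
    have b: "((\<lambda>v. exp (- x * v) * (x * cos v - sin v)) \<longlongrightarrow> 0) at_top"
    proof (rule Lim_null_comparison)
      have "((\<lambda>v. exp (- x * v) * (x + 1)) \<longlongrightarrow> 0 * (x + 1)) at_top" by (intro tendsto_intros e)
      thus "((\<lambda>v. exp (- x * v) * (x + 1)) \<longlongrightarrow> 0) at_top" by simp
      show "\<forall>\<^sub>F v in at_top. norm (exp (- x * v) * (x * cos v - sin v)) \<le> exp (- x * v) * (x + 1)"
      proof (rule always_eventually, safe)
        fix v
        have "\<bar>x * cos v\<bar> \<le> x * 1" unfolding abs_mult using x by (intro mult_mono) auto
        hence "\<bar>x * cos v - sin v\<bar> \<le> x + 1" using abs_sin_le_one[of v] by linarith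
        thus "norm (exp (- x * v) * (x * cos v - sin v)) \<le> exp (- x * v) * (x + 1)"
          by (simp add: abs_mult)
      qed
    qed
    have "(F \<longlongrightarrow> - 0 / x + 0 / (x\<^sup>2 + 1)) at_top" unfolding F_def
      by (intro tendsto_intros e b) (use x nz in auto)
    thus "(F \<longlongrightarrow> 0) at_top" by simp
  qed auto
  also have "0 - F 0 = 1 / (x * (x\<^sup>2 + 1))"
    using x nz by (simp add: F_def field_simps power2_eq_square)
  also have "(\<integral>\<^sup>+v. ennreal (?g v) * indicator {0..} v \<partial>lborel) = 
      (\<integral>\<^sup>+v. ennreal (indicator {0<..} v * (?g v)) \<partial>lborel)"
    by (intro nn_integral_cong) (auto simp: indicator_def)
  finally show ?thesis .
qed

text \<open>Writing 1/(x^2 + 1) as the integral of exp(-y (x^2 + 1)) over y > 0 and exchanging the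
  order leaves a Gaussian moment in x and then a Gamma integral in y.\<close>

lemma nn_integral_powr_over_square_plus_one:
  fixes p :: real assumes p: "0 < p" "p < 1"
  shows "(\<integral>\<^sup>+x. ennreal (indicator {0<..} x * (x powr (-p) / (x\<^sup>2 + 1))) \<partial>lborel)
           = ennreal (Gamma ((1 - p) / 2) * Gamma ((1 + p) / 2) / 2)"
proof -
  let ?G = "Gamma ((1 - p) / 2)"
  let ?g = "\<lambda>y::real. ennreal (indicator {0<..} y * (y powr (1 * ((1+p)/2) - 1) * exp (- 1 * y powr 1)))"
  define h where "h = (\<lambda>x y. indicator {0<..} x * (indicator {0<..} y * (x powr (-p) * exp (- y) * exp (- y * x\<^sup>2))) :: real)"
  have h_meas: "(\<lambda>(x, y). ennreal (h x y)) \<in> borel_measurable (lborel \<Otimes>\<^sub>M lborel)"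
    unfolding h_def by measurable
  have "(\<integral>\<^sup>+x. ennreal (indicator {0<..} x * (x powr (-p) / (x\<^sup>2 + 1))) \<partial>lborel) = (\<integral>\<^sup>+x. \<integral>\<^sup>+y. ennreal (h x y) \<partial>lborel \<partial>lborel)"
  proof (rule nn_integral_cong)
    fix x :: real
    show "ennreal (indicator {0<..} x * (x powr (-p) / (x\<^sup>2 + 1))) = (\<integral>\<^sup>+y. ennreal (h x y) \<partial>lborel)"
    proof (cases "x > 0")
      case True
      have pos: "x\<^sup>2 + 1 > 0" by (smt (verit) zero_le_power2)
      have "(\<integral>\<^sup>+y. ennreal (h x y) \<partial>lborel) = (\<integral>\<^sup>+y. ennreal (x powr (-p)) * ennreal (indicator {0<..} y * (y powr (1 * 1 - 1) * exp (- (x\<^sup>2 + 1) * y powr 1))) \<partial>lborel)"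
        using True by (intro nn_integral_cong) 
          (auto simp: h_def indicator_def ennreal_mult'[symmetric] exp_add[symmetric] algebra_simps)
      also have "\<dots> = ennreal (x powr (-p)) * ennreal (Gamma 1 / (1 * (x\<^sup>2 + 1) powr 1))"
        using pos by (subst nn_integral_cmult, simp) (subst nn_integral_Gamma_powr, auto)
      finally show ?thesis using True pos by (simp add: ennreal_mult'[symmetric])
    qed (simp add: h_def)
  qed
  also have "\<dots> = (\<integral>\<^sup>+y. \<integral>\<^sup>+x. ennreal (h x y) \<partial>lborel \<partial>lborel)"
    by (rule lborel_pair.Fubini'[symmetric]) (use h_meas in simp)
  also have "\<dots> = (\<integral>\<^sup>+y. ennreal (?G / 2) * ?g y \<partial>lborel)"
  proof (rule nn_integral_cong)
    fix y :: real
    show "(\<integral>\<^sup>+x. ennreal (h x y) \<partial>lborel) = ennreal (?G / 2) * ?g y"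
    proof (cases "y > 0")
      case True
      have "(\<integral>\<^sup>+x. ennreal (h x y) \<partial>lborel) = (\<integral>\<^sup>+x. ennreal (exp (- y)) * ennreal (indicator {0<..} x * (x powr (2 * ((1 - p) / 2) - 1) * exp (- y * x powr 2))) \<partial>lborel)"
        using True by (intro nn_integral_cong) 
          (auto simp: h_def indicator_def ennreal_mult'[symmetric] diff_divide_distrib)
      also have "\<dots> = ennreal (exp (- y)) * ennreal (?G / (2 * y powr ((1 - p) / 2)))"
        using True p by (subst nn_integral_cmult, simp) (subst nn_integral_Gamma_powr, auto)
      also have "\<dots> = ennreal (?G / 2 * (y powr (- ((1 - p) / 2)) * exp (- y)))"
        using True by (simp add: ennreal_mult'[symmetric] powr_minus field_simps)
      also have "- ((1 - p) / 2) = 1 * ((1+p)/2) - 1" by (simp add: field_simps)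
      finally show ?thesis using True p by (simp add: ennreal_mult'[symmetric] Gamma_real_pos)
    qed (simp add: h_def)
  qed
  also have "\<dots> = ennreal (?G / 2) * ennreal (Gamma ((1 + p) / 2) / (1 * 1 powr ((1 + p) / 2)))"
    using p by (subst nn_integral_cmult, simp) (subst nn_integral_Gamma_powr, auto)
  also have "\<dots> = ennreal (?G * Gamma ((1 + p) / 2) / 2)"
    using p Gamma_real_pos[of "(1-p)/2"] by (simp add: ennreal_mult'[symmetric])
  finally show ?thesis .
qed

section \<open>The Mellin transform of 1 - cos\<close>

definition cos_mellin :: "real \<Rightarrow> real" where
  "cos_mellin p = Gamma ((1 - p) / 2) * Gamma ((1 + p) / 2) / (2 * Gamma (2 - p))"

text \<open>Up to the constant Gamma(2 - p), the power v^(p-2) is the integral of x^(1-p) exp(-x v)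
  over x > 0. After exchanging the order, the inner integral is the Laplace transform of 1 - cos.
  For 0 < p < 1 the integral converges at both ends.\<close>

lemma nn_integral_cos_mellin:
  fixes p :: real assumes p: "0 < p" "p < 1"
  shows "(\<integral>\<^sup>+v. ennreal (indicator {0<..} v * ((1 - cos v) * v powr (p - 2))) \<partial>lborel) = ennreal (cos_mellin p)"
proof -
  let ?g = "\<lambda>v. indicator {0<..} v * ((1 - cos v) * v powr (p - 2))"
  have G: "Gamma (2 - p) > 0" using p by (intro Gamma_real_pos) auto
  define h where "h = (\<lambda>x v. indicator {0<..} x * (indicator {0<..} v * ((1 - cos v) * x powr (1 - p) * exp (- x * v))) :: real)"
  have h_meas: "(\<lambda>(x, y). ennreal (h x y)) \<in> borel_measurable (lborel \<Otimes>\<^sub>M lborel)"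
    unfolding h_def by measurable
  have "ennreal (Gamma (2 - p)) * (\<integral>\<^sup>+v. ennreal (?g v) \<partial>lborel) =
        (\<integral>\<^sup>+v. ennreal (Gamma (2 - p)) * ennreal (?g v) \<partial>lborel)"
    by (rule nn_integral_cmult[symmetric]) measurable
  also have "\<dots> = (\<integral>\<^sup>+v. \<integral>\<^sup>+x. ennreal (h x v) \<partial>lborel \<partial>lborel)"
  proof (rule nn_integral_cong)
    fix v :: real
    show "ennreal (Gamma (2 - p)) * ennreal (?g v) = (\<integral>\<^sup>+x. ennreal (h x v) \<partial>lborel)"
    proof (cases "v > 0")
      case True
      have "(\<integral>\<^sup>+x. ennreal (h x v) \<partial>lborel) = (\<integral>\<^sup>+x. ennreal (1 - cos v) * ennreal (indicator {0<..} x * (x powr (1 * (2 - p) - 1) * exp (- v * x powr 1))) \<partial>lborel)"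
        using True by (intro nn_integral_cong) 
          (auto simp: h_def indicator_def ennreal_mult'[symmetric] algebra_simps)
      also have "\<dots> = ennreal (1 - cos v) * ennreal (Gamma (2 - p) / (1 * v powr (2 - p)))"
        using True p by (subst nn_integral_cmult, simp) (subst nn_integral_Gamma_powr, auto)
      also have "\<dots> = ennreal (Gamma (2 - p) * ((1 - cos v) * v powr (- (2 - p))))"
        using True by (subst powr_minus) (simp add: ennreal_mult'[symmetric] field_simps)
      finally show ?thesis using True G by (simp add: ennreal_mult'[symmetric])
    qed (simp add: h_def)
  qed
  also have "\<dots> = (\<integral>\<^sup>+x. \<integral>\<^sup>+v. ennreal (h x v) \<partial>lborel \<partial>lborel)"
    by (rule lborel_pair.Fubini') (use h_meas in simp)
  also have "\<dots> = (\<integral>\<^sup>+x. ennreal (indicator {0<..} x * (x powr (-p) / (x\<^sup>2 + 1))) \<partial>lborel)"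
  proof (rule nn_integral_cong)
    fix x :: real
    show "(\<integral>\<^sup>+v. ennreal (h x v) \<partial>lborel) = ennreal (indicator {0<..} x * (x powr (-p) / (x\<^sup>2 + 1)))"
    proof (cases "x > 0")
      case True
      have pos: "x\<^sup>2 + 1 > 0" by (smt (verit) zero_le_power2)
      have "(\<integral>\<^sup>+v. ennreal (h x v) \<partial>lborel) = (\<integral>\<^sup>+v. ennreal (x powr (1 - p)) * ennreal (indicator {0<..} v * ((1 - cos v) * exp (- x * v))) \<partial>lborel)"
        using True by (intro nn_integral_cong) (auto simp: h_def indicator_def ennreal_mult'[symmetric] algebra_simps)
      also have "\<dots> = ennreal (x powr (1 - p)) * ennreal (1 / (x * (x\<^sup>2 + 1)))"
        using True by (subst nn_integral_cmult, simp) (subst nn_integral_one_minus_cos_exp, auto)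
      also have "\<dots> = ennreal (x powr (-p) / (x\<^sup>2 + 1))"
        using True pos by (simp add: ennreal_mult'[symmetric] powr_diff powr_minus divide_inverse)
      finally show ?thesis using True by simp
    qed (simp add: h_def)
  qed
  also have "\<dots> = ennreal (Gamma (2 - p) * cos_mellin p)"
    using G by (subst nn_integral_powr_over_square_plus_one[OF p]) (simp add: cos_mellin_def)
  also have "\<dots> = ennreal (Gamma (2 - p)) * ennreal (cos_mellin p)"
    using G by (simp add: ennreal_mult')
  finally show ?thesis using G by (subst (asm) ennreal_mult_cancel_left) auto
qed

text \<open>The trapezoid rule for $u^p$ on $[n,n+1]$ minus the integral; the case \<open>n = 0\<close> is covered because
  \<open>0 powr p = 0\<close>.\<close>
definition trapezoid :: "real \<Rightarrow> nat \<Rightarrow> real" where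
  "trapezoid p n = (real n powr p + real (Suc n) powr p) / 2
     - (real (Suc n) powr (1 + p) - real n powr (1 + p)) / (1 + p)"

lemma has_integral_trapezoid:
  fixes p :: real assumes p: "0 < p" "p < 1"
  shows "((\<lambda>u. p * (1 - p) / 2 * ((u - real n) * (real n + 1 - u)) * u powr (p - 2)) has_integral (- trapezoid p n)) {real n..real n + 1}"
proof -
  \<comment> \<open>The product (u - n) u^(p-1) is expanded as u^p - n u^(p-1). For n = 0 the second
    term carries the factor 0, so \<open>Q\<close> is continuous at the endpoint u = 0, where the
    integrand itself is singular; differentiability is needed only in the interior.\<close>
  define Q where "Q = (\<lambda>u. - (p / 2 * (real n + 1 - u) * (u powr p - real n * u powr (p - 1))
     - (2 * real n + 1 - 2 * u) * u powr p / 2 - u powr (1 + p) / (1 + p)))"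
  have "((\<lambda>u. p * (1 - p) / 2 * ((u - real n) * (real n + 1 - u)) * u powr (p - 2)) has_integral (Q (real n + 1) - Q (real n))) {real n..real n + 1}"
  proof (rule fundamental_theorem_of_calculus_interior)
    show "continuous_on {real n..real n + 1} Q"
    proof (cases "n = 0")
      case True
      show ?thesis unfolding Q_def True using p
        by (auto intro!: continuous_intros continuous_on_powr')
    next
      case False
      thus ?thesis unfolding Q_def using p
        by (auto intro!: continuous_intros)
    qed
    fix u assume "u \<in> {real n<..<real n + 1}"
    hence u: "u > 0" by auto
    define w where "w = u powr (p - 2)"
    have e: "u powr (p - 1) = u * w" "u powr p = u * (u * w)" "u powr (p - 1 - 1) = w" "u powr (p - 2) = w"
      using u by (simp_all add: w_def powr_diff power2_eq_square)
    have P: "((\<lambda>u. u powr k) has_real_derivative k * u powr (k - 1)) (at u)" for k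
      by (rule has_real_derivative_powr[OF u])
    have P1: "((\<lambda>u. u powr (1 + p) / (1 + p)) has_real_derivative u powr p) (at u)"
      using DERIV_cdivide[OF P[of "1 + p"], of "1 + p"] p by simp
    have P2: "((\<lambda>u. (2 * real n + 1 - 2 * u) * u powr p / 2) has_real_derivative
               (- 2 * u powr p + (2 * real n + 1 - 2 * u) * (p * u powr (p - 1))) / 2) (at u)"
      by (rule DERIV_cong, (rule P DERIV_const DERIV_ident DERIV_mult DERIV_add DERIV_diff DERIV_cdivide)+) simp
    have "(Q has_real_derivative p * (1 - p) / 2 * ((u - real n) * (real n + 1 - u)) * w) (at u)"
      unfolding Q_def
      by (rule DERIV_cong, (rule P1 P2 P DERIV_const DERIV_ident DERIV_mult DERIV_add DERIV_diff DERIV_minus)+)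
         (simp add: e algebra_simps diff_divide_distrib add_divide_distrib)
    thus "(Q has_vector_derivative p * (1 - p) / 2 * ((u - real n) * (real n + 1 - u)) * u powr (p - 2)) (at u)"
      by (simp add: has_real_derivative_iff_has_vector_derivative w_def)
  qed simp
  also have "Q (real n + 1) - Q (real n) = - trapezoid p n"
  proof -
    have "real n powr p = real n * real n powr (p - 1)"
      using p by (cases "n = 0") (simp_all add: powr_diff)
    thus ?thesis by (simp add: Q_def trapezoid_def algebra_simps diff_divide_distrib add_divide_distrib)
  qed
  finally show ?thesis .
qed

lemma trapezoid_nonpos: "0 < p \<Longrightarrow> p < 1 \<Longrightarrow> trapezoid p n \<le> 0"
  using has_integral_nonneg[OF has_integral_trapezoid[of p n]] by auto

section \<open>One integral over the periodic parabola, evaluated in two ways\<close>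

definition frac_parabola :: "real \<Rightarrow> real" where
  "frac_parabola u = frac u * (1 - frac u)"

lemma frac_parabola_measurable [measurable]: "frac_parabola \<in> borel_measurable borel"
  unfolding frac_parabola_def frac_def by measurable

lemma nn_integral_frac_parabola_1:
  fixes p :: real assumes p: "0 < p" "p < 1"
  shows "(\<integral>\<^sup>+u. ennreal (indicator {0<..} u * (p * (1 - p) / 2 * frac_parabola u * u powr (p - 2))) \<partial>lborel)
           = (\<Sum>n. ennreal (- trapezoid p n))"
proof -
  let ?g = "\<lambda>u. p * (1 - p) / 2 * frac_parabola u * u powr (p - 2)"
  define f where "f = (\<lambda>n u. p * (1 - p) / 2 * ((u - real n) * (real n + 1 - u)) * u powr (p - 2))"
  have I: "(\<integral>\<^sup>+u. ennreal (indicator {real n..real n + 1} u * f n u) \<partial>lborel) = ennreal (- trapezoid p n)" for n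
  proof (rule nn_integral_has_integral_lebesgue)
    show "(f n has_integral - trapezoid p n) {real n..real n + 1}"
      using has_integral_trapezoid[OF p] by (simp only: f_def)
  qed (use p in \<open>auto simp: f_def intro!: mult_nonneg_nonneg\<close>)
  have "(\<integral>\<^sup>+u. ennreal (indicator {0<..} u * ?g u) \<partial>lborel)
     = (\<integral>\<^sup>+u. (\<Sum>n. ennreal (indicator {real n..real n + 1} u * f n u)) \<partial>lborel)"
  proof (rule nn_integral_cong)
    fix u :: real
    show "ennreal (indicator {0<..} u * ?g u) = (\<Sum>n. ennreal (indicator {real n..real n + 1} u * f n u))"
    proof (cases "u > 0")
      case True
      define m where "m = nat \<lfloor>u\<rfloor>"
      have m: "real m = of_int \<lfloor>u\<rfloor>" using True by (simp add: m_def)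
      have m1: "real m \<le> u" "u < real m + 1" unfolding m by linarith+
      \<comment> \<open>Neighbouring closed intervals share an integer endpoint, but the parabola
        vanishes there, so at most one term of the sum is nonzero.\<close>
      have z: "indicator {real n..real n + 1} u * f n u = 0" if "n \<noteq> m" for n
      proof (cases "n < m")
        case True
        hence "real n + 1 \<le> real m" by linarith
        thus ?thesis using m1 by (cases "u = real n + 1") (auto simp: f_def indicator_def)
      next
        case False
        hence "real m + 1 \<le> real n" using that by linarith
        thus ?thesis using m1 by (auto simp: f_def indicator_def)
      qed
      have "(\<Sum>n. ennreal (indicator {real n..real n + 1} u * f n u)) = (\<Sum>n\<in>{m}. ennreal (indicator {real n..real n + 1} u * f n u))"
      proof (rule suminf_finite)
        fix n assume "n \<notin> {m}"
        hence "n \<noteq> m" by simp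
        from z[OF this] show "ennreal (indicator {real n..real n + 1} u * f n u) = 0" by (simp only: ennreal_0)
      qed simp
      also have "\<dots> = ennreal (f m u)" using m1 by simp
      also have "f m u = ?g u"
        unfolding f_def frac_parabola_def frac_def m by (simp add: algebra_simps)
      finally show ?thesis using True by simp
    next
      case False
      have "indicator {real n..real n + 1} u * f n u = 0" for n
        using False by (auto simp: f_def indicator_def)
      hence "(\<lambda>n. ennreal (indicator {real n..real n + 1} u * f n u)) = (\<lambda>n. 0)"
        by (simp only: ennreal_0)
      thus ?thesis using False by (simp only:) simp
    qed
  qed
  also have "\<dots> = (\<Sum>n. \<integral>\<^sup>+u. ennreal (indicator {real n..real n + 1} u * f n u) \<partial>lborel)"
    unfolding f_def by (rule nn_integral_suminf) measurable
  finally show ?thesis unfolding I .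
qed

lemma nn_integral_cos_mellin_scaled:
  fixes p c :: real assumes p: "0 < p" "p < 1" and c: "c > 0"
  shows "(\<integral>\<^sup>+u. ennreal (indicator {0<..} u * ((1 - cos (c * u)) * u powr (p - 2))) \<partial>lborel) = ennreal (c powr (1 - p) * cos_mellin p)"
proof -
  let ?I = "\<integral>\<^sup>+u. ennreal (indicator {0<..} u * ((1 - cos (c * u)) * u powr (p - 2))) \<partial>lborel"
  have "ennreal (cos_mellin p) = (\<integral>\<^sup>+v. ennreal (indicator {0<..} v * ((1 - cos v) * v powr (p - 2))) \<partial>lborel)"
    by (rule nn_integral_cos_mellin[OF p, symmetric])
  also have "\<dots> = ennreal \<bar>c\<bar> * (\<integral>\<^sup>+u. ennreal (indicator {0<..} (0 + c * u) * ((1 - cos (0 + c * u)) * (0 + c * u) powr (p - 2))) \<partial>lborel)"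
    by (rule nn_integral_real_affine) (use c in \<open>measurable, auto\<close>)
  also have "\<dots> = ennreal c * (\<integral>\<^sup>+u. ennreal (c powr (p - 2)) * ennreal (indicator {0<..} u * ((1 - cos (c * u)) * u powr (p - 2))) \<partial>lborel)"
    using c by (intro arg_cong2[where f = "(*)"] nn_integral_cong) 
      (auto simp: indicator_def ennreal_mult'[symmetric] powr_mult zero_less_mult_iff mult_ac)
  also have "\<dots> = ennreal (c powr (p - 1)) * ?I"
  proof -
    have "c powr (p - 1) = c * c powr (p - 2)" using c by (simp add: powr_diff power2_eq_square)
    thus ?thesis using c by (subst nn_integral_cmult) (simp_all add: ennreal_mult' mult.assoc)
  qed
  finally have "ennreal (c powr (1 - p)) * ennreal (cos_mellin p) = (ennreal (c powr (1 - p)) * ennreal (c powr (p - 1))) * ?I"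
    by (simp add: mult.assoc)
  also have "ennreal (c powr (1 - p)) * ennreal (c powr (p - 1)) = 1"
    using c by (simp add: ennreal_mult'[symmetric] powr_add[symmetric])
  finally show ?thesis by (simp add: ennreal_mult')
qed

lemma cos_mellin_pos: "0 < p \<Longrightarrow> p < 1 \<Longrightarrow> cos_mellin p > 0"
  unfolding cos_mellin_def by (intro divide_pos_pos mult_pos_pos Gamma_real_pos) auto

lemma summable_powr_gt_one: "p > 0 \<Longrightarrow> summable (\<lambda>n. real (Suc n) powr (-1 - p))"
  by (subst summable_Suc_iff) (simp add: summable_real_powr_iff)

text \<open>The Fourier series of the parabola is taken in the form with 1 - cos, all of whose terms
  are nonnegative, so sum and integral may be exchanged. Scaling by 2 pi n turns each term into a
  multiple of n^(-1-p), and the sum over n becomes zeta(1 + p).\<close>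

lemma nn_integral_frac_parabola_2:
  fixes p :: real assumes p: "0 < p" "p < 1"
  shows "(\<integral>\<^sup>+u. ennreal (indicator {0<..} u * (p * (1 - p) / 2 * frac_parabola u * u powr (p - 2))) \<partial>lborel)
           = ennreal (p * (1 - p) / 2 * cos_mellin p * (2 * pi) powr (1 - p) / pi\<^sup>2 * (\<Sum>n. real (Suc n) powr (-1 - p)))"
proof -
  let ?g = "\<lambda>u. p * (1 - p) / 2 * frac_parabola u * u powr (p - 2)"
  let ?z = "\<lambda>n. real (Suc n) powr (-1 - p)"
  let ?c = "p * (1 - p) / 2 * cos_mellin p * (2 * pi) powr (1 - p) / pi\<^sup>2"
  define k where "k = (\<lambda>n. p * (1 - p) / 2 / (pi * real (Suc n))\<^sup>2)"
  define c where "c = (\<lambda>n. 2 * pi * real (Suc n))"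
  define f where "f = (\<lambda>n u. indicator {0<..} u * ((1 - cos (c n * u)) * u powr (p - 2)))"
  have k: "k n \<ge> 0" for n using p by (auto simp: k_def)
  have c: "c n > 0" for n by (auto simp: c_def)
  have "(\<integral>\<^sup>+u. ennreal (indicator {0<..} u * ?g u) \<partial>lborel)
     = (\<integral>\<^sup>+u. (\<Sum>n. ennreal (k n) * ennreal (f n u)) \<partial>lborel)"
  proof (rule nn_integral_cong)
    fix u :: real
    have "(\<lambda>n. (indicator {0<..} u * (p * (1 - p) / 2) * u powr (p - 2)) * ((1 - cos (2 * pi * real (Suc n) * u)) / (pi * real (Suc n))\<^sup>2)) sums
      ((indicator {0<..} u * (p * (1 - p) / 2) * u powr (p - 2)) * (frac u * (1 - frac u)))"
      by (rule sums_mult[OF frac_parabola_series])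
    also have "(\<lambda>n. (indicator {0<..} u * (p * (1 - p) / 2) * u powr (p - 2)) * ((1 - cos (2 * pi * real (Suc n) * u)) / (pi * real (Suc n))\<^sup>2)) = (\<lambda>n. k n * f n u)"
      by (auto simp: k_def f_def c_def indicator_def field_simps simp del: of_nat_Suc)
    also have "(indicator {0<..} u * (p * (1 - p) / 2) * u powr (p - 2)) * (frac u * (1 - frac u)) = indicator {0<..} u * ?g u"
      by (simp add: frac_parabola_def)
    finally have "(\<Sum>n. ennreal (k n * f n u)) = ennreal (indicator {0<..} u * ?g u)"
      by (intro suminf_ennreal_eq) (use k in \<open>auto simp: f_def\<close>)
    thus "ennreal (indicator {0<..} u * ?g u) = (\<Sum>n. ennreal (k n) * ennreal (f n u))"
      using k by (simp add: ennreal_mult')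
  qed
  also have "\<dots> = (\<Sum>n. \<integral>\<^sup>+u. ennreal (k n) * ennreal (f n u) \<partial>lborel)"
    unfolding f_def by (rule nn_integral_suminf) measurable
  also have "\<dots> = (\<Sum>n. ennreal (?c * ?z n))"
  proof (rule suminf_cong)
    fix n
    have "(\<integral>\<^sup>+u. ennreal (k n) * ennreal (f n u) \<partial>lborel) = ennreal (k n) * ennreal (c n powr (1 - p) * cos_mellin p)"
      unfolding f_def by (subst nn_integral_cmult, simp) (subst nn_integral_cos_mellin_scaled[OF p c], simp)
    also have "\<dots> = ennreal (k n * (c n powr (1 - p) * cos_mellin p))" using k by (simp add: ennreal_mult')
    also have "k n * (c n powr (1 - p) * cos_mellin p) = ?c * ?z n"
    proof -
      have "c n powr (1 - p) = (2 * pi) powr (1 - p) * real (Suc n) powr (1 - p)"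
        by (simp add: c_def powr_mult)
      moreover have "real (Suc n) powr (1 - p) = ?z n * (real (Suc n))\<^sup>2"
        by (simp add: powr_add[symmetric] powr_numeral[symmetric] del: powr_numeral of_nat_Suc)
      ultimately show ?thesis by (simp add: k_def power_mult_distrib del: of_nat_Suc)
    qed
    finally show "(\<integral>\<^sup>+u. ennreal (k n) * ennreal (f n u) \<partial>lborel) = ennreal (?c * ?z n)" .
  qed
  also have "\<dots> = ennreal (?c * (\<Sum>n. ?z n))"
  proof (rule suminf_ennreal_eq)
    show "0 \<le> ?c * ?z n" for n
      using p cos_mellin_pos[OF p] by (auto intro!: mult_nonneg_nonneg)
    show "(\<lambda>n. ?c * ?z n) sums
      (?c * (\<Sum>n. ?z n))"
      using p by (intro sums_mult summable_sums summable_powr_gt_one)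
  qed
  finally show ?thesis .
qed

text \<open>Reflection at (1 - p)/2 and at p brings in cos(pi p/2) and sin(pi p); the double-angle
  formula cancels the cosine and leaves sin(pi p/2) Gamma(p)/(1 - p).\<close>

lemma cos_mellin_eq:
  fixes p :: real assumes p: "0 < p" "p < 1"
  shows "p * (1 - p) / 2 * cos_mellin p * (2 * pi) powr (1 - p) / pi\<^sup>2 =
    2 powr (-p) * pi powr (-p - 1) * sin (pi * p / 2) * Gamma (1 + p)"
proof -
  have cs: "cos (pi * p / 2) > 0" 
  proof (rule cos_gt_zero_pi)
    have "pi * p > 0" using p by simp
    thus "- (pi / 2) < pi * p / 2" using pi_gt_zero by linarith
  qed (use p in auto)
  have ss: "sin (pi * p / 2) > 0" using p by (intro sin_gt_zero) (auto simp: field_simps)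
  have r1: "Gamma ((1 - p) / 2) * Gamma ((1 + p) / 2) = pi / cos (pi * p / 2)"
  proof -
    have "complex_of_real (Gamma ((1 - p) / 2) * Gamma ((1 + p) / 2)) = Gamma (of_real ((1 - p)/2)) * Gamma (1 - of_real ((1-p)/2))"
    proof -
      have e: "1 - complex_of_real ((1-p)/2) = of_real ((1+p)/2)" by (simp add: field_simps)
      show ?thesis unfolding e by (simp only: Gamma_complex_of_real of_real_mult)
    qed
    also have "\<dots> = of_real pi / sin (of_real pi * of_real ((1 - p)/2))"
      by (rule Gamma_reflection_complex)
    also have "\<dots> = of_real (pi / sin (pi * ((1 - p)/2)))"
      by (simp only: of_real_mult[symmetric] sin_of_real of_real_divide[symmetric])
    also have "pi * ((1 - p)/2) = pi / 2 - pi * p / 2" by (simp add: field_simps)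
    also have "sin (pi / 2 - pi * p / 2) = cos (pi * p / 2)" by (simp add: sin_diff)
    finally show ?thesis by (simp only: of_real_eq_iff)
  qed
  have r2: "Gamma p * Gamma (1 - p) = pi / sin (pi * p)"
  proof -
    have "complex_of_real (Gamma p * Gamma (1 - p)) = Gamma (of_real p) * Gamma (1 - of_real p)"
    proof -
      have e: "1 - complex_of_real p = of_real (1 - p)" by simp
      show ?thesis unfolding e by (simp only: Gamma_complex_of_real of_real_mult)
    qed
    also have "\<dots> = of_real pi / sin (of_real pi * of_real p)"
      by (rule Gamma_reflection_complex)
    also have "\<dots> = of_real (pi / sin (pi * p))"
      by (simp only: of_real_mult[symmetric] sin_of_real of_real_divide[symmetric])
    finally show ?thesis by (simp only: of_real_eq_iff)
  qed
  have r3: "Gamma (2 - p) = (1 - p) * Gamma (1 - p)"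
  proof -
    have "1 - p \<notin> \<int>\<^sub>\<le>\<^sub>0" using p by (auto elim!: nonpos_Ints_cases)
    from Gamma_plus1[OF this] show ?thesis by (simp add: algebra_simps)
  qed
  have r4: "Gamma (1 + p) = p * Gamma p"
  proof -
    have "p \<notin> \<int>\<^sub>\<le>\<^sub>0" using p by (auto elim!: nonpos_Ints_cases)
    from Gamma_plus1[OF this] show ?thesis by (simp add: algebra_simps)
  qed
  have s2: "sin (pi * p) = 2 * sin (pi * p / 2) * cos (pi * p / 2)"
    using sin_double[of "pi * p / 2"] by simp
  have G: "Gamma (1 - p) > 0" "Gamma p > 0" using p by (auto intro!: Gamma_real_pos)
  have "sin (pi * p) > 0" using p by (intro sin_gt_zero) auto
  hence G1: "Gamma (1 - p) = pi / (sin (pi * p) * Gamma p)"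
    using r2 G by (simp add: field_simps)
  have P: "(2 * pi) powr (1 - p) = 2 * pi * (2 powr (-p) * pi powr (-p))"
    using powr_mult[of 2 pi "1 - p"] powr_diff[of 2 1 p] powr_diff[of pi 1 p] powr_minus[of 2 p] powr_minus[of pi p]
    by (simp only:) (simp add: divide_inverse)
  have P2: "pi powr (-p - 1) = pi powr (-p) / pi" by (simp add: powr_diff)
  have cm: "cos_mellin p = sin (pi * p / 2) * Gamma p / (1 - p)"
  proof -
    have "(pi / C) / (2 * ((1 - p) * (pi / (2 * S * C * G)))) = S * G / (1 - p)"
      if "C > 0" "S > 0" "G > 0" for C S G :: real
      using that p by (simp add: divide_simps)
    from this[OF cs ss G(2)] show ?thesis unfolding cos_mellin_def r1 r3 G1 s2 .
  qed
  have "p * (1 - p) / 2 * (S * G / (1 - p)) * (2 * pi * (a * b)) / pi\<^sup>2 = a * (b / pi) * S * (p * G)" for S G a b :: real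
    using p by (simp add: divide_simps power2_eq_square)
  thus ?thesis unfolding cm P P2 r4 .
qed

text \<open>Both evaluations of the integral are equated. The finite value of the second one makes
  the first series summable, and since all terms have one sign the identity descends from extended
  to real numbers. The sum is zeta(-p), so this is the functional equation at s = -p.\<close>

theorem trapezoid_sums:
  fixes p :: real assumes p: "0 < p" "p < 1"
  shows "trapezoid p sums (- (2 powr (-p) * pi powr (-p - 1) * sin (pi * p / 2) * Gamma (1 + p) * (\<Sum>n. real (Suc n) powr (-1 - p))))"
proof -
  define R where "R = (2 powr (-p) * pi powr (-p - 1) * sin (pi * p / 2) * Gamma (1 + p) * (\<Sum>n. real (Suc n) powr (-1 - p)))"
  have "(\<Sum>n. real (Suc n) powr (-1 - p)) \<ge> 0"
    using p by (intro suminf_nonneg summable_powr_gt_one) auto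
  hence R0: "R \<ge> 0" unfolding R_def cos_mellin_eq[OF p, symmetric]
    using p cos_mellin_pos[OF p] by (intro mult_nonneg_nonneg divide_nonneg_nonneg) auto
  have eq: "(\<Sum>n. ennreal (- trapezoid p n)) = ennreal R"
    using nn_integral_frac_parabola_1[OF p] nn_integral_frac_parabola_2[OF p]
    unfolding cos_mellin_eq[OF p] R_def by simp
  have "(\<lambda>n. ennreal (- trapezoid p n)) sums ennreal R"
    unfolding eq[symmetric] by (intro summable_sums) auto
  hence "(\<lambda>n. - trapezoid p n) sums R"
    using R0 trapezoid_nonpos[OF p] by (subst (asm) sums_ennreal) auto
  from sums_minus[OF this] show ?thesis by (simp add: R_def)
qed

section \<open>Zeros in discs and variation of the argument\<close>

text \<open>Dividing out Blaschke factors one zero at a time keeps the bound on the circle.\<close>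
lemma zero_set_bound_aux:
  fixes f :: "complex \<Rightarrow> complex"
  assumes "finite Z" "f holomorphic_on ball 0 R'" "0 < r" "r < R" "R < R'"
    and "\<And>z. norm z = R \<Longrightarrow> norm (f z) \<le> M"
    and "\<And>z. z \<in> Z \<Longrightarrow> f z = 0 \<and> z \<noteq> 0 \<and> norm z \<le> r"
  shows "norm (f 0) \<le> M * (r / R) ^ card Z"
  using assms
proof (induction Z arbitrary: f rule: finite_induct)
  case empty
  have "norm (f 0) \<le> M"
  proof (rule maximum_modulus_frontier[of f "cball 0 R"])
    show "f holomorphic_on interior (cball 0 R)"
      using empty by (auto elim!: holomorphic_on_subset)
    show "continuous_on (closure (cball 0 R)) f"
      using empty by (auto intro!: holomorphic_on_imp_continuous_on elim!: holomorphic_on_subset)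
  qed (use empty in auto)
  thus ?case by simp
next
  case (insert a Z)
  have a: "f a = 0" "a \<noteq> 0" "norm a \<le> r" using insert.prems by auto
  have R: "R > 0" using insert.prems by auto
  have aR: "norm a < R" using a(3) insert.prems(3) by linarith
  define h where "h = (\<lambda>z. if z = a then deriv f a else f z / (z - a))"
  have h: "h holomorphic_on ball 0 R'"
    by (rule pole_theorem_open_0[of f _ a]) (use insert.prems a in \<open>auto simp: h_def\<close>)
  \<comment> \<open>At the centre this factor replaces the modulus of f by that of f times R/|a| >=
    R/r, so each zero divided out costs one factor r/R.\<close>
  define g where "g = (\<lambda>z. h z * ((of_real R)\<^sup>2 - cnj a * z) / of_real R)"
  have "norm (g 0) \<le> M * (r / R) ^ card Z"
  proof (rule insert.IH)
    show "g holomorphic_on ball 0 R'" unfolding g_def using R by (intro holomorphic_intros h) auto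
    show "norm (g z) \<le> M" if z: "norm z = R" for z
    proof -
      have za: "z \<noteq> a" using z aR by auto
      have "(of_real R)\<^sup>2 = z * cnj z" using complex_norm_square[of z] unfolding z by simp
      hence "(of_real R)\<^sup>2 - cnj a * z = z * cnj (z - a)" by (simp add: algebra_simps)
      hence "norm ((of_real R)\<^sup>2 - cnj a * z) = R * norm (z - a)" using z by (simp add: norm_mult del: complex_cnj_diff)
      hence "norm (g z) = norm (f z)" using za R by (simp add: g_def h_def norm_mult norm_divide)
      thus ?thesis using insert.prems z by auto
    qed
    show "g z = 0 \<and> z \<noteq> 0 \<and> norm z \<le> r" if "z \<in> Z" for z
      using that insert.prems insert.hyps by (auto simp: g_def h_def)
  qed (use insert.prems in auto)
  moreover have "norm (g 0) = norm (f 0) * R / norm a"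
    using a R by (simp add: g_def h_def norm_mult norm_divide power2_eq_square)
  ultimately have "norm (f 0) * R \<le> M * (r / R) ^ card Z * norm a"
    using a by (simp add: field_simps)
  also have "\<dots> \<le> M * (r / R) ^ card Z * r"
  proof -
    have "0 \<le> norm (g 0)" by simp
    also note \<open>norm (g 0) \<le> _\<close>
    finally show ?thesis using a by (intro mult_left_mono) auto
  qed
  finally have "norm (f 0) \<le> M * (r / R) ^ card Z * r / R" using R by (simp add: field_simps)
  thus ?case using insert.hyps by (simp add: mult_ac)
qed

lemma finite_card_le:
  assumes "\<And>F. finite F \<Longrightarrow> F \<subseteq> A \<Longrightarrow> real (card F) \<le> B"
  shows "finite A \<and> real (card A) \<le> B"
proof -
  have "finite A"
  proof (rule ccontr)
    assume "infinite A"
    then obtain F where F: "F \<subseteq> A" "finite F" "card F = nat \<lceil>B\<rceil> + 1"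
      using infinite_arbitrarily_large[of A "nat \<lceil>B\<rceil> + 1"] by blast
    with assms[of F] show False by linarith
  qed
  with assms[of A] show ?thesis by auto
qed

text \<open>The inequality m <= M (r/R)^n, solved for n. Zeros are counted without multiplicity,
  which is enough for counting sign changes on a segment; finiteness comes out of the same estimate,
  applied to all finite subsets.\<close>

lemma holomorphic_zero_count:
  fixes f :: "complex \<Rightarrow> complex"
  assumes hol: "f holomorphic_on ball c R'" and r: "0 < r" "r < R" "R < R'"
    and M: "\<And>z. norm (z - c) = R \<Longrightarrow> norm (f z) \<le> M" and f0: "m > 0" "norm (f c) \<ge> m"
  shows "finite {z. norm (z - c) \<le> r \<and> f z = 0} \<and> 
         real (card {z. norm (z - c) \<le> r \<and> f z = 0}) \<le> ln (M / m) / ln (R / r)"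
proof (rule finite_card_le)
  fix F assume F: "finite F" "F \<subseteq> {z. norm (z - c) \<le> r \<and> f z = 0}"
  define g where "g = (\<lambda>z. f (c + z))"
  have "norm (g 0) \<le> M * (r / R) ^ card ((\<lambda>z. z - c) ` F)"
  proof (rule zero_set_bound_aux[of _ _ R'])
    have "f \<circ> (\<lambda>z. c + z) holomorphic_on ball 0 R'"
      by (rule holomorphic_on_compose_gen[OF _ hol]) (auto intro!: holomorphic_intros simp: dist_norm)
    thus "g holomorphic_on ball 0 R'" by (simp add: g_def o_def)
    show "g z = 0 \<and> z \<noteq> 0 \<and> norm z \<le> r" if "z \<in> (\<lambda>z. z - c) ` F" for z
      using that F f0 by (auto simp: g_def)
    show "norm (g z) \<le> M" if "norm z = R" for z using M[of "c + z"] that by (simp add: g_def)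
  qed (use F r in auto)
  also have "card ((\<lambda>z. z - c) ` F) = card F" by (intro card_image inj_onI) auto
  finally have mle: "m \<le> M * (r / R) ^ card F" using f0 by (simp add: g_def)
  have "M > 0"
  proof (rule ccontr)
    assume "\<not> M > 0"
    hence "M * (r / R) ^ card F \<le> 0" using r by (intro mult_nonpos_nonneg) auto
    with mle f0 show False by simp
  qed
  with mle have "ln m \<le> ln (M * (r / R) ^ card F)" using f0 by (subst ln_le_cancel_iff) auto
  also have "\<dots> = ln M + real (card F) * ln (r / R)"
    using \<open>M > 0\<close> r by (simp add: ln_mult ln_realpow)
  also have "ln (r / R) = - ln (R / r)" using r by (simp add: ln_div)
  finally have "real (card F) * ln (R / r) \<le> ln (M / m)" using \<open>M > 0\<close> f0 by (simp add: ln_div)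
  moreover have "ln (R / r) > 0" using r by simp
  ultimately show "real (card F) \<le> ln (M / m) / ln (R / r)" by (simp add: field_simps)
qed

text \<open>The imaginary part is the variation of arg f along the segment. Expressed as an integral
  it involves no choice of branch, and it is additive in products and under subdivision.\<close>

definition log_deriv_integral :: "(complex \<Rightarrow> complex) \<Rightarrow> complex \<Rightarrow> complex \<Rightarrow> complex" where
  "log_deriv_integral f u v = contour_integral (linepath u v) (\<lambda>z. deriv f z / f z)"

lemma log_deriv_integrable:
  assumes "f holomorphic_on S" "open S" "closed_segment u v \<subseteq> S" "\<And>z. z \<in> closed_segment u v \<Longrightarrow> f z \<noteq> 0"
  shows "(\<lambda>z. deriv f z / f z) contour_integrable_on (linepath u v)"
proof (rule contour_integrable_continuous_linepath)
  have "continuous_on S (deriv f)" "continuous_on S f"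
    using assms by (auto intro!: holomorphic_on_imp_continuous_on holomorphic_deriv)
  thus "continuous_on (closed_segment u v) (\<lambda>z. deriv f z / f z)"
    using assms by (intro continuous_intros) (auto elim: continuous_on_subset)
qed

lemma log_deriv_integral_mult:
  assumes "f holomorphic_on S" "g holomorphic_on S" "open S" "closed_segment u v \<subseteq> S" 
    and nz: "\<And>z. z \<in> closed_segment u v \<Longrightarrow> f z \<noteq> 0" "\<And>z. z \<in> closed_segment u v \<Longrightarrow> g z \<noteq> 0"
  shows "log_deriv_integral (\<lambda>z. f z * g z) u v = log_deriv_integral f u v + log_deriv_integral g u v"
proof -
  have "log_deriv_integral (\<lambda>z. f z * g z) u v = contour_integral (linepath u v) (\<lambda>z. deriv f z / f z + deriv g z / g z)"
    unfolding log_deriv_integral_def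
  proof (rule contour_integral_eq)
    fix z assume "z \<in> path_image (linepath u v)"
    hence z: "z \<in> closed_segment u v" "z \<in> S" using assms by auto
    have "deriv (\<lambda>z. f z * g z) z = f z * deriv g z + deriv f z * g z"
      using assms z by (intro deriv_mult) (auto simp: holomorphic_on_imp_differentiable_at)
    thus "deriv (\<lambda>z. f z * g z) z / (f z * g z) = deriv f z / f z + deriv g z / g z"
      using nz[OF z(1)] by (simp add: field_simps)
  qed
  also have "\<dots> = log_deriv_integral f u v + log_deriv_integral g u v"
    unfolding log_deriv_integral_def using assms
    by (intro contour_integral_add log_deriv_integrable[of _ S]) auto
  finally show ?thesis .
qed

lemma log_deriv_integral_cong:
  assumes "open S" "closed_segment u v \<subseteq> S" "\<And>z. z \<in> S \<Longrightarrow> f z = g z"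
  shows "log_deriv_integral f u v = log_deriv_integral g u v"
  unfolding log_deriv_integral_def
proof (rule contour_integral_eq)
  fix z assume "z \<in> path_image (linepath u v)"
  hence z: "z \<in> closed_segment u v" "z \<in> S" using assms by auto
  have "eventually (\<lambda>z. f z = g z) (nhds z)"
    using eventually_nhds_in_open[OF assms(1) z(2)] by eventually_elim (use assms in auto)
  hence "deriv f z = deriv g z" by (rule deriv_cong_ev) auto
  thus "deriv f z / f z = deriv g z / g z" using assms z by simp
qed

lemma log_deriv_integral_exp:
  assumes "h holomorphic_on S" "open S" "closed_segment u v \<subseteq> S" "\<And>z. z \<in> S \<Longrightarrow> f z = exp (h z)"
  shows "log_deriv_integral f u v = h v - h u"
proof -
  have "((\<lambda>z. deriv f z / f z) has_contour_integral (h (pathfinish (linepath u v)) - h (pathstart (linepath u v)))) (linepath u v)"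
  proof (rule contour_integral_primitive[of S])
    fix z assume z: "z \<in> S"
    have "(h has_field_derivative deriv h z) (at z)" using assms z by (simp add: holomorphic_derivI)
    hence "((\<lambda>z. exp (h z)) has_field_derivative (exp (h z) * deriv h z)) (at z)"
      by (auto intro!: derivative_eq_intros)
    moreover have "eventually (\<lambda>z. f z = exp (h z)) (nhds z)"
      using eventually_nhds_in_open[OF assms(2) z] by eventually_elim (use assms in auto)
    ultimately have "deriv f z = exp (h z) * deriv h z"
      by (metis DERIV_imp_deriv deriv_cong_ev)
    hence "deriv f z / f z = deriv h z" using assms z by simp
    thus "(h has_field_derivative deriv f z / f z) (at z within S)"
      using \<open>(h has_field_derivative deriv h z) (at z)\<close> by (simp add: has_field_derivative_at_within)
  qed (use assms in auto)
  thus ?thesis unfolding log_deriv_integral_def by (simp add: contour_integral_unique)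
qed

text \<open>After the rotation by w the values avoid the branch cut, so \<open>Ln (w * f z)\<close>
  is a primitive of f'/f near the segment, and two principal arguments differ by at most 2
  pi.\<close>

lemma log_deriv_integral_slit:
  assumes "f holomorphic_on S" "open S" "closed_segment u v \<subseteq> S" "w \<noteq> 0"
    "\<And>z. z \<in> closed_segment u v \<Longrightarrow> w * f z \<notin> \<real>\<^sub>\<le>\<^sub>0"
  shows "\<bar>Im (log_deriv_integral f u v)\<bar> \<le> 2 * pi"
proof -
  define S' where "S' = {z \<in> S. w * f z \<in> - \<real>\<^sub>\<le>\<^sub>0}"
  have cont: "continuous_on S (\<lambda>z. w * f z)" using assms by (intro continuous_intros holomorphic_on_imp_continuous_on)
  have op: "open S'"
    using continuous_open_preimage[OF cont assms(2), of "- \<real>\<^sub>\<le>\<^sub>0"] closed_nonpos_Reals_complex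
    by (simp add: S'_def vimage_def Int_def open_Compl)
  have "((\<lambda>z. deriv f z / f z) has_contour_integral (Ln (w * f (pathfinish (linepath u v))) - Ln (w * f (pathstart (linepath u v))))) (linepath u v)"
  proof (rule contour_integral_primitive[of S'])
    fix z assume z: "z \<in> S'"
    hence "(f has_field_derivative deriv f z) (at z)" using assms by (auto simp: holomorphic_derivI S'_def)
    hence "((\<lambda>z. Ln (w * f z)) has_field_derivative (inverse (w * f z) * (w * deriv f z))) (at z)"
      using z by (auto intro!: derivative_eq_intros simp: S'_def)
    also have "inverse (w * f z) * (w * deriv f z) = deriv f z / f z"
      using z assms by (auto simp: S'_def field_simps)
    finally show "((\<lambda>z. Ln (w * f z)) has_field_derivative deriv f z / f z) (at z within S')"
      by (rule has_field_derivative_at_within)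
  qed (use assms in \<open>auto simp: S'_def\<close>)
  hence "log_deriv_integral f u v = Ln (w * f v) - Ln (w * f u)" 
    unfolding log_deriv_integral_def by (simp add: contour_integral_unique)
  moreover have "w * f v \<noteq> 0" "w * f u \<noteq> 0" using assms(5)[of u] assms(5)[of v] by auto
  ultimately show ?thesis
    using mpi_less_Im_Ln[of "w * f v"] Im_Ln_le_pi[of "w * f v"] mpi_less_Im_Ln[of "w * f u"] Im_Ln_le_pi[of "w * f u"]
    by auto
qed

text \<open>Between consecutive zeros of Re f the values stay in a half plane, where the argument
  varies by at most 2 pi; n zeros give n + 1 such pieces. The induction is strong because the
  segment is split at an arbitrary zero, whose two sides share the remaining ones.\<close>

lemma log_deriv_integral_sign_changes:
  fixes f :: "complex \<Rightarrow> complex" and t :: real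
  assumes hol: "f holomorphic_on S" "open S"
    and "a \<le> b" "\<And>x. a \<le> x \<Longrightarrow> x \<le> b \<Longrightarrow> Complex x t \<in> S \<and> f (Complex x t) \<noteq> 0"
    and "finite {x. a < x \<and> x < b \<and> Re (f (Complex x t)) = 0}"
    and "card {x. a < x \<and> x < b \<and> Re (f (Complex x t)) = 0} \<le> n"
  shows "\<bar>Im (log_deriv_integral f (Complex a t) (Complex b t))\<bar> \<le> (real n + 1) * (2 * pi)"
  using assms(3-)
proof (induction n arbitrary: a b rule: less_induct)
  case (less n a b)
  let ?V = "\<lambda>a b. \<bar>Im (log_deriv_integral f (Complex a t) (Complex b t))\<bar>"
  let ?L = "\<lambda>a b. log_deriv_integral f (Complex a t) (Complex b t)"
  have seg: "closed_segment (Complex a' t) (Complex b' t) = {Complex x t |x. a' \<le> x \<and> x \<le> b'}" if "a' \<le> b'" for a' b'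
    using that by (auto simp: closed_segment_same_Im closed_segment_eq_real_ivl complex_eq_iff)
  let ?Z = "{x. a < x \<and> x < b \<and> Re (f (Complex x t)) = 0}"
  show ?case
  proof (cases "?Z = {}")
    case True
    have cont: "continuous_on {a..b} (\<lambda>x. Re (f (Complex x t)))"
    proof -
      have "continuous_on {a..b} (\<lambda>x. f (Complex x t))"
      proof (rule continuous_on_compose2[of S f _ "\<lambda>x. Complex x t"])
        show "continuous_on S f" using hol by (simp add: holomorphic_on_imp_continuous_on)
        have "continuous_on {a..b} (\<lambda>x. of_real x + \<i> * of_real t)" by (intro continuous_intros)
        thus "continuous_on {a..b} (\<lambda>x. Complex x t)" by (simp add: Complex_eq)
      qed (use less.prems in auto)
      thus ?thesis by (intro continuous_intros)
    qed
    have same: False if xy: "x \<in> {a..b}" "y \<in> {a..b}" "Re (f (Complex x t)) > 0" "Re (f (Complex y t)) < 0" for x y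
    proof -
      have "\<exists>z. min x y \<le> z \<and> z \<le> max x y \<and> Re (f (Complex z t)) = 0"
      proof (cases "x \<le> y")
        case True
        have "continuous_on {x..y} (\<lambda>x. Re (f (Complex x t)))" 
          using continuous_on_subset[OF cont] xy by auto
        hence "\<exists>z\<ge>x. z \<le> y \<and> Re (f (Complex z t)) = 0" 
          using True xy by (intro IVT2') auto
        thus ?thesis using True by auto
      next
        case False
        have "continuous_on {y..x} (\<lambda>x. Re (f (Complex x t)))" 
          using continuous_on_subset[OF cont] xy by auto
        hence "\<exists>z\<ge>y. z \<le> x \<and> Re (f (Complex z t)) = 0" 
          using False xy by (intro IVT') auto
        thus ?thesis using False by auto
      qed
      then obtain z where z: "min x y \<le> z" "z \<le> max x y" "Re (f (Complex z t)) = 0" by blast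
      hence "z \<noteq> x" "z \<noteq> y" using xy by auto
      hence "a < z" "z < b" using z xy by auto
      with z True show False by blast
    qed
    \<comment> \<open>The sign that makes Re (w f) >= 0. Equality can still occur at the endpoints,
      but f is nonzero there, so the value is purely imaginary and off the cut.\<close>
    define w :: complex where "w = (if \<forall>x\<in>{a..b}. Re (f (Complex x t)) \<ge> 0 then 1 else - 1)"
    have w: "Re (w * f (Complex x t)) \<ge> 0" if "x \<in> {a..b}" for x
      using same that by (force simp: w_def not_le)
    have "?V a b \<le> 2 * pi"
    proof (rule log_deriv_integral_slit[OF hol])
      show "w * f z \<notin> \<real>\<^sub>\<le>\<^sub>0" if "z \<in> closed_segment (Complex a t) (Complex b t)" for z
      proof
        assume neg: "w * f z \<in> \<real>\<^sub>\<le>\<^sub>0"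
        from that obtain x where x: "z = Complex x t" "a \<le> x" "x \<le> b" using seg[OF less.prems(1)] by auto
        have "w * f z \<noteq> 0" using less.prems(2) x by (auto simp: w_def)
        thus False using neg w[of x] x by (auto simp: complex_nonpos_Reals_iff complex_eq_iff)
      qed
    qed (use less.prems seg in \<open>auto simp: w_def\<close>)
    also have "2 * pi \<le> (real n + 1) * (2 * pi)" by simp
    finally show ?thesis .
  next
    case False
    then obtain c where c: "a < c" "c < b" "Re (f (Complex c t)) = 0" by blast
    let ?Z1 = "{x. a < x \<and> x < c \<and> Re (f (Complex x t)) = 0}"
    let ?Z2 = "{x. c < x \<and> x < b \<and> Re (f (Complex x t)) = 0}"
    have Zeq: "?Z = insert c (?Z1 \<union> ?Z2)" using c by auto
    have fin: "finite ?Z1" "finite ?Z2" using less.prems(3) unfolding Zeq by auto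
    have "card ?Z = Suc (card (?Z1 \<union> ?Z2))" unfolding Zeq using fin by (subst card_insert_disjoint) auto
    also have "card (?Z1 \<union> ?Z2) = card ?Z1 + card ?Z2" using fin by (intro card_Un_disjoint) auto
    finally have cards: "Suc (card ?Z1 + card ?Z2) \<le> n" using less.prems(4) by simp
    have i1: "?V a c \<le> (real (card ?Z1) + 1) * (2 * pi)"
      by (rule less.IH) (use cards c fin less.prems(2) in auto)
    have i2: "?V c b \<le> (real (card ?Z2) + 1) * (2 * pi)"
      by (rule less.IH) (use cards c fin less.prems(2) in auto)
    have "?L a b = ?L a c + ?L c b"
      unfolding log_deriv_integral_def
    proof (rule contour_integral_split_linepath)
      have "continuous_on S (deriv f)" "continuous_on S f"
        using hol by (auto intro!: holomorphic_on_imp_continuous_on holomorphic_deriv)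
      thus "continuous_on (closed_segment (Complex a t) (Complex b t)) (\<lambda>z. deriv f z / f z)"
        using less.prems(2) seg[OF less.prems(1)] by (intro continuous_intros) (auto elim!: continuous_on_subset)
      show "Complex c t \<in> closed_segment (Complex a t) (Complex b t)"
        using seg[OF less.prems(1)] c by auto
    qed
    hence "?V a b \<le> (real (card ?Z1) + 1) * (2 * pi) + (real (card ?Z2) + 1) * (2 * pi)"
      using i1 i2 by simp
    also have "\<dots> = (real (Suc (card ?Z1 + card ?Z2)) + 1) * (2 * pi)" by (simp add: algebra_simps)
    also have "\<dots> \<le> (real n + 1) * (2 * pi)" using cards by (intro mult_right_mono add_right_mono) (simp_all only: of_nat_le_iff, simp_all)
    finally show ?thesis .
  qed
qed

text \<open>Backlund's device: the function \<open>g\<close> of the proof equals $\mathrm{Re}\, f(x+it)$ at real \<open>x\<close>.\<close>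
lemma log_deriv_integral_horizontal:
  fixes f :: "complex \<Rightarrow> complex" and t :: real
  assumes hol: "f holomorphic_on ball (Complex b t) R'" 
    and ab: "a < b" "b - a < R" "R < R'"
    and M: "\<And>z. norm (z - Complex b t) = R \<Longrightarrow> norm (f z) \<le> M" 
    and m: "m > 0" "Re (f (Complex b t)) \<ge> m"
    and nz: "\<And>x. a \<le> x \<Longrightarrow> x \<le> b \<Longrightarrow> f (Complex x t) \<noteq> 0"
  shows "\<bar>Im (log_deriv_integral f (Complex a t) (Complex b t))\<bar> \<le> (ln (M / m) / ln (R / (b - a)) + 1) * (2 * pi)"
proof -
  define g where "g = (\<lambda>z. (f (z + \<i> * of_real t) + cnj (f (cnj z + \<i> * of_real t))) / 2)"
  let ?B = "ball (complex_of_real b) R'"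
  let ?N = "{z. norm (z - of_real b) \<le> b - a \<and> g z = 0}"
  let ?l = "ln (M / m) / ln (R / (b - a))"
  have gx: "g (of_real x) = of_real (Re (f (Complex x t)))" for x
    by (simp add: g_def complex_eq_iff Complex_eq)
  have cb: "Complex b t = of_real b + \<i> * of_real t" by (simp add: Complex_eq)
  have h0: "(\<lambda>z. f (z + \<i> * of_real t)) holomorphic_on ?B"
  proof -
    have "f \<circ> (\<lambda>z. z + \<i> * of_real t) holomorphic_on ?B"
      by (rule holomorphic_on_compose_gen[OF _ hol]) (auto intro!: holomorphic_intros simp: dist_norm cb algebra_simps)
    thus ?thesis by (simp add: o_def)
  qed
  \<comment> \<open>The ball is centred on the real axis, hence symmetric under conjugation, and
    conjugating inside and outside preserves holomorphy.\<close>
  have h1: "(cnj \<circ> (\<lambda>z. f (z + \<i> * of_real t)) \<circ> cnj) holomorphic_on ?B"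
  proof (subst holomorphic_on_compose_cnj_cnj)
    have "cnj ` ?B = ?B"
    proof -
      have d: "dist (complex_of_real b) (cnj z) = dist (complex_of_real b) z" for z :: complex
        by (metis complex_cnj_complex_of_real complex_cnj_diff complex_mod_cnj dist_norm)
      show ?thesis
      proof (intro subset_antisym subsetI)
        fix z assume z: "z \<in> ?B"
        hence "cnj z \<in> ?B" using d by simp
        thus "z \<in> cnj ` ?B" by (metis complex_cnj_cnj image_eqI)
      qed (use d in auto)
    qed
    thus "(\<lambda>z. f (z + \<i> * of_real t)) holomorphic_on cnj ` ?B" using h0 by simp
  qed auto
  have g: "g holomorphic_on ?B"
    using h0 h1 unfolding g_def by (intro holomorphic_intros) (auto simp: o_def)
  have C: "finite ?N \<and> 
         real (card ?N) \<le> ?l"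
  proof (rule holomorphic_zero_count[OF g])
    show "norm (g z) \<le> M" if "norm (z - of_real b) = R" for z
    proof -
      have "norm (f (z + \<i> * of_real t)) \<le> M"
        by (rule M) (use that in \<open>simp add: cb\<close>)
      moreover have "norm (f (cnj z + \<i> * of_real t)) \<le> M"
      proof (rule M)
        have "cnj z + \<i> * of_real t - Complex b t = cnj (z - of_real b)" by (simp add: cb)
        thus "norm (cnj z + \<i> * of_real t - Complex b t) = R" using that by (simp only: complex_mod_cnj)
      qed
      ultimately have "norm (f (z + \<i> * of_real t) + cnj (f (cnj z + \<i> * of_real t))) \<le> M + M"
        by (intro norm_triangle_le add_mono) auto
      thus ?thesis by (simp add: g_def norm_divide)
    qed
    show "norm (g (of_real b)) \<ge> m" unfolding gx using m by simp
  qed (use ab m in auto)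
  let ?Z = "{x. a < x \<and> x < b \<and> Re (f (Complex x t)) = 0}"
  have sub: "of_real ` ?Z \<subseteq> ?N"
  proof safe
    fix x assume "a < x" "x < b" "Re (f (Complex x t)) = 0"
    thus "norm (of_real x - complex_of_real b) \<le> b - a" "g (of_real x) = 0"
      unfolding gx by (simp_all add: of_real_diff[symmetric] del: of_real_diff)
  qed
  have fin: "finite ?Z" 
    using C finite_subset[OF sub] by (metis (no_types, lifting) finite_imageD inj_on_def of_real_eq_iff)
  have "card ?Z = card (complex_of_real ` ?Z)" by (intro card_image[symmetric] inj_onI) auto
  also have "\<dots> \<le> card ?N" using C sub by (intro card_mono) auto
  finally have "real (card ?Z) \<le> ?l" using C by linarith
  have "\<bar>Im (log_deriv_integral f (Complex a t) (Complex b t))\<bar> \<le> (real (card ?Z) + 1) * (2 * pi)"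
  proof (rule log_deriv_integral_sign_changes[OF hol open_ball])
    fix x assume x: "a \<le> x" "x \<le> b"
    have "norm (Complex b t - Complex x t) = \<bar>b - x\<bar>" by (simp add: cmod_def)
    thus "Complex x t \<in> ball (Complex b t) R' \<and> f (Complex x t) \<noteq> 0" using nz[OF x] x ab by (simp add: dist_norm)
  qed (use ab fin in auto)
  also have "\<dots> \<le> (?l + 1) * (2 * pi)"
    using \<open>real (card ?Z) \<le> _\<close> by (intro mult_right_mono) auto
  finally show ?thesis .
qed

section \<open>The functional equation\<close>

definition zeta_reflect :: "complex \<Rightarrow> complex" where
  "zeta_reflect s = 2 powr s * of_real pi powr (s - 1) * sin (of_real pi * s / 2) * Gamma (1 - s) * zeta_series (1 - s)"

lemma Re_pos_not_nonpos_Ints: "Re z > 0 \<Longrightarrow> z \<notin> \<int>\<^sub>\<le>\<^sub>0"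
  by (auto elim!: nonpos_Ints_cases)

lemma holomorphic_zeta_series_reflected: "(\<lambda>s. zeta_series (1 - s)) holomorphic_on {s. Re s < 0}"
proof -
  have "(zeta_series \<circ> (\<lambda>s. 1 - s)) holomorphic_on {s. Re s < 0}"
    by (rule holomorphic_on_compose_gen[OF _ holomorphic_zeta_series]) (auto intro!: holomorphic_intros)
  thus ?thesis by (simp add: o_def)
qed

lemma holomorphic_zeta_reflect: "zeta_reflect holomorphic_on {s. Re s < 0}"
  unfolding zeta_reflect_def[abs_def]
  by (intro holomorphic_intros holomorphic_zeta_series_reflected Re_pos_not_nonpos_Ints) auto

text \<open>The initial part 1 + (s - 1)/2 of \<open>pole_free_zeta\<close> is the contribution of
  the interval [0,1]: at s = -p it equals (1 - p)/2, which is also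
  \<open>- (1 + p) * trapezoid p 0\<close>. Hence the sum over trapezoids starts at 0 while
  \<open>zeta_term\<close> starts one interval later.\<close>

lemma pole_free_zeta_minus_of_real:
  assumes p: "0 < p" "p < 1"
  shows "pole_free_zeta (- of_real p) = of_real (- (1 + p) * (\<Sum>n. trapezoid p n))"
proof -
  let ?S = "\<Sum>n. trapezoid p n"
  have sm: "summable (trapezoid p)" using trapezoid_sums[OF p] by (simp add: sums_iff)
  have powr: "complex_of_nat k powr (of_real x) = of_real (real k powr x)" for k x
    using powr_of_real[of "real k" x] by simp
  have t: "zeta_term n (- of_real p) = of_real (- (1 + p) * trapezoid p (Suc n))" for n
  proof -
    have "zeta_term n (- of_real p) = (- of_real p - 1) * (of_nat (Suc n) powr (of_real p) + of_nat (Suc (Suc n)) powr (of_real p)) / 2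
     - of_nat (Suc n) powr (of_real (1 + p)) + of_nat (Suc (Suc n)) powr (of_real (1 + p))"
      by (simp add: zeta_term_def del: of_nat_Suc)
    also have "\<dots> = of_real ((- p - 1) * (real (Suc n) powr p + real (Suc (Suc n)) powr p) / 2 - real (Suc n) powr (1 + p) + real (Suc (Suc n)) powr (1 + p))"
      unfolding powr by (simp del: of_nat_Suc)
    also have "(- p - 1) * (real (Suc n) powr p + real (Suc (Suc n)) powr p) / 2 - real (Suc n) powr (1 + p) + real (Suc (Suc n)) powr (1 + p)
       = - (1 + p) * trapezoid p (Suc n)"
    proof -
      have "(- p - 1) * (a + b) / 2 - c + d = - (1 + p) * ((a + b) / 2 - (d - c) / (1 + p))" for a b c d :: real
        using p by (simp add: field_simps)
      thus ?thesis unfolding trapezoid_def .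
    qed
    finally show ?thesis .
  qed
  have t0: "trapezoid p 0 = (p - 1) / (2 * (1 + p))"
    using p by (simp add: trapezoid_def field_simps)
  have "(\<lambda>n. complex_of_real (- (1 + p) * trapezoid p (Suc n))) sums of_real (- (1 + p) * (?S - trapezoid p 0))"
    unfolding sums_of_real_iff using summable_sums[OF sm] by (intro sums_mult) (simp add: sums_Suc_iff)
  hence "(\<Sum>n. zeta_term n (- of_real p)) = of_real (- (1 + p) * (?S - trapezoid p 0))"
    unfolding t by (simp add: sums_iff)
  hence "pole_free_zeta (- of_real p) = of_real (1 + (- p - 1) / 2 + (- (1 + p) * (?S - trapezoid p 0)))"
    by (simp add: pole_free_zeta_def)
  also have "1 + (- p - 1) / 2 + (- (1 + p) * (?S - trapezoid p 0)) = - (1 + p) * ?S"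
    unfolding t0 using p by (simp add: field_simps)
  finally show ?thesis .
qed

lemma functional_equation_real:
  assumes p: "0 < p" "p < 1"
  shows "pole_free_zeta (- of_real p) / (- of_real p - 1) = zeta_reflect (- of_real p)"
proof -
  let ?S = "\<Sum>n. trapezoid p n"
  let ?Z = "\<Sum>n. real (Suc n) powr (-1 - p)"
  have z: "zeta_series (1 + of_real p) = of_real ?Z"
  proof -
    have "(\<lambda>n. of_real (real (Suc n) powr (-1 - p))) sums complex_of_real ?Z"
      unfolding sums_of_real_iff using p by (intro summable_sums summable_powr_gt_one)
    moreover have "complex_of_nat (Suc n) powr (- (1 + of_real p)) = of_real (real (Suc n) powr (-1 - p))" for n
    proof -
      have "complex_of_nat (Suc n) powr (- (1 + of_real p)) = of_real (real (Suc n)) powr of_real (-1 - p)"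
        by (simp del: of_nat_Suc)
      also have "\<dots> = of_real (real (Suc n) powr (-1 - p))" by (rule powr_of_real) auto
      finally show ?thesis .
    qed
    ultimately show ?thesis unfolding zeta_series_def by (simp add: sums_iff del: of_nat_Suc)
  qed
  have "zeta_reflect (- of_real p) = of_real 2 powr of_real (- p) * of_real pi powr of_real (- p - 1) * sin (of_real (pi * (- p) / 2)) * Gamma (of_real (1 + p)) * zeta_series (1 + of_real p)"
    by (simp add: zeta_reflect_def)
  also have "\<dots> = of_real (2 powr (- p) * pi powr (- p - 1) * sin (pi * (-p) / 2) * Gamma (1 + p) * ?Z)"
    unfolding z by (simp only: of_real_mult powr_of_real pi_ge_zero sin_of_real Gamma_complex_of_real order.refl zero_le_numeral)
  also have "2 powr (- p) * pi powr (- p - 1) * sin (pi * (-p) / 2) * Gamma (1 + p) * ?Z = ?S"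
    using trapezoid_sums[OF p] by (simp add: sums_iff)
  finally have r: "zeta_reflect (- of_real p) = of_real ?S" .
  have "pole_free_zeta (- of_real p) = (- of_real p - 1) * of_real ?S"
    by (subst pole_free_zeta_minus_of_real[OF p]) simp
  moreover have "- complex_of_real p - 1 \<noteq> 0"
  proof -
    have "Re (- complex_of_real p - 1) < 0" using p by simp
    thus ?thesis by force
  qed
  ultimately show ?thesis by (simp add: r)
qed

lemma functional_equation_strip:
  assumes s: "-1 < Re s" "Re s < 0"
  shows "pole_free_zeta s / (s - 1) = zeta_reflect s"
proof -
  let ?f = "\<lambda>s. pole_free_zeta s / (s - 1) - zeta_reflect s"
  define S where "S = {s. -1 < Re s} \<inter> {s. Re s < 0}"
  define U where "U = (\<lambda>p. - complex_of_real p) ` {0<..<1}"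
  have "?f s = 0"
  proof (rule analytic_continuation[of ?f S U "- of_real (1/2)"])
    show "?f holomorphic_on S"
      by (intro holomorphic_intros holomorphic_on_subset[OF holomorphic_pole_free_zeta] holomorphic_on_subset[OF holomorphic_zeta_reflect])
         (auto simp: S_def)
    show "open S" unfolding S_def by (intro open_Int open_halfspace_Re_gt open_halfspace_Re_lt)
    show "connected S" unfolding S_def by (intro convex_connected convex_Int convex_halfspace_Re_gt convex_halfspace_Re_lt)
    show "U \<subseteq> S" by (auto simp: U_def S_def)
    show "- of_real (1/2) \<in> S" by (simp add: S_def)
    show "- of_real (1/2) islimpt U"
      unfolding islimpt_approachable
    proof safe
      fix e :: real assume e: "e > 0"
      define p where "p = 1/2 + min (e/2) (1/4)"
      have p: "0 < p" "p < 1" "p \<noteq> 1/2" "p - 1/2 < e" "p - 1/2 > 0" using e by (auto simp: p_def min_def)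
      have "dist (- complex_of_real p) (- of_real (1/2)) = \<bar>p - 1/2\<bar>"
        by (metis dist_minus dist_of_real dist_real_def)
      hence "dist (- complex_of_real p) (- of_real (1/2)) < e" using p by simp
      moreover have "- complex_of_real p \<in> U" using p by (auto simp: U_def)
      moreover have "- complex_of_real p \<noteq> - of_real (1/2)" using p(3) by (metis neg_equal_iff_equal of_real_eq_iff)
      ultimately show "\<exists>x'\<in>U. x' \<noteq> - of_real (1/2) \<and> dist x' (- of_real (1/2)) < e" by blast
    qed
    show "?f z = 0" if "z \<in> U" for z
      using that functional_equation_real by (auto simp: U_def)
    show "s \<in> S" using s by (simp add: S_def)
  qed
  thus ?thesis by simp
qed

section \<open>The meromorphic continuation of zeta and its uniqueness\<close>

definition zeta_cont :: "complex \<Rightarrow> complex" where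
  "zeta_cont s = (if s = 1 then 0 else if Re s > -1 then pole_free_zeta s / (s - 1) else zeta_reflect s)"

lemma zeta_cont_eq_reflect: "Re s < 0 \<Longrightarrow> zeta_cont s = zeta_reflect s"
  using functional_equation_strip[of s] by (auto simp: zeta_cont_def)

lemma zeta_cont_eq_series: "Re s > 1 \<Longrightarrow> zeta_cont s = zeta_series s"
  using pole_free_zeta_eq_series[of s] by (auto simp: zeta_cont_def)

lemma holomorphic_zeta_cont: "zeta_cont holomorphic_on (UNIV - {1})"
proof -
  have "zeta_cont holomorphic_on ({s. Re s > -1} - {1}) \<union> {s. Re s < 0}"
  proof (rule holomorphic_on_Un)
    have "(\<lambda>s. pole_free_zeta s / (s - 1)) holomorphic_on ({s. Re s > -1} - {1})"
      by (intro holomorphic_intros holomorphic_on_subset[OF holomorphic_pole_free_zeta]) auto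
    thus "zeta_cont holomorphic_on ({s. Re s > -1} - {1})"
      by (rule holomorphic_transform) (auto simp: zeta_cont_def)
    show "zeta_cont holomorphic_on {s. Re s < 0}"
      by (rule holomorphic_transform[OF holomorphic_zeta_reflect]) (simp add: zeta_cont_eq_reflect)
  qed (auto intro!: open_Diff open_halfspace_Re_gt open_halfspace_Re_lt)
  also have "({s. Re s > -1} - {1}) \<union> {s. Re s < 0} = UNIV - {1::complex}" by auto
  finally show ?thesis .
qed

text \<open>The pole at 1 is genuine since \<open>pole_free_zeta 1 = 1\<close>, and the value 0 put
  there by \<open>zeta_cont\<close> is the one that the normalisation prescribes.\<close>

lemma nicely_meromorphic_zeta_cont: "zeta_cont nicely_meromorphic_on UNIV"
proof (rule nicely_meromorphic_onI_open[where pts = "{1}"])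
  show an: "zeta_cont analytic_on UNIV - {1}"
    using holomorphic_zeta_cont by (subst analytic_on_open) auto
  show "is_pole zeta_cont x \<and> zeta_cont x = 0" if "x \<in> {1}" for x
  proof
    have "is_pole (\<lambda>w. pole_free_zeta w / (w - 1) ^ 1) 1"
      by (rule is_pole_basic[OF holomorphic_pole_free_zeta open_halfspace_Re_gt]) (auto simp: pole_free_zeta_1)
    moreover have "eventually (\<lambda>w. pole_free_zeta w / (w - 1) ^ 1 = zeta_cont w) (at 1)"
    proof -
      have "eventually (\<lambda>w. w \<in> {s. Re s > -1}) (at (1::complex))"
        by (intro eventually_at_in_open' open_halfspace_Re_gt) auto
      moreover have "eventually (\<lambda>w. w \<noteq> 1) (at (1::complex))" by (simp add: eventually_at_filter)
      ultimately show ?thesis by eventually_elim (simp add: zeta_cont_def)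
    qed
    ultimately show "is_pole zeta_cont x" using that by (auto intro: is_pole_transform)
    show "zeta_cont x = 0" using that by (simp add: zeta_cont_def)
  qed
  show "isolated_singularity_at zeta_cont x" for x
  proof (cases "x = 1")
    case True
    thus ?thesis unfolding isolated_singularity_at_def
      using an by (auto intro!: exI[of _ 1] elim!: analytic_on_subset)
  next
    case False
    thus ?thesis unfolding isolated_singularity_at_def
      using an by (auto intro!: exI[of _ "dist x 1"] elim!: analytic_on_subset simp: dist_commute)
  qed
qed auto

text \<open>A meromorphic function vanishes either almost everywhere or almost nowhere, up to a
  sparse set; agreement on an open set excludes the latter for f - g. Normalised functions are fixed
  by \<open>remove_sings\<close>, which depends only on punctured neighbourhoods, so equality
  extends to every point.\<close>

lemma nicely_meromorphic_eqI:
  assumes f: "f nicely_meromorphic_on UNIV" and g: "g nicely_meromorphic_on UNIV"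
    and S: "open S" "z0 \<in> S" "\<And>z. z \<in> S \<Longrightarrow> f z = g z"
  shows "f = g"
proof
  fix z
  have mero: "(\<lambda>z. f z - g z) meromorphic_on UNIV"
    using f g by (auto simp: nicely_meromorphic_on_def intro!: meromorphic_intros)
  have "\<not> eventually (\<lambda>z. f z - g z \<noteq> 0) (cosparse UNIV)"
  proof
    assume "eventually (\<lambda>z. f z - g z \<noteq> 0) (cosparse UNIV)"
    hence "eventually (\<lambda>z. f z - g z \<noteq> 0) (at z0)"
      by (rule eventually_cosparse_imp_eventually_at) auto
    moreover have "eventually (\<lambda>z. z \<in> S) (at z0)" using S by (intro eventually_at_in_open')
    ultimately have "eventually (\<lambda>z. False) (at z0)" by eventually_elim (use S in auto)
    thus False by simp
  qed
  hence "eventually (\<lambda>z. f z - g z = 0) (cosparse UNIV)"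
    using meromorphic_imp_constant_or_avoid[OF mero, of 0] by auto
  hence ev: "eventually (\<lambda>z. f z = g z) (at z)"
    using eventually_cosparse_imp_eventually_at[of _ UNIV z UNIV] by auto
  have nice: "remove_sings h z = h z" if "h nicely_meromorphic_on UNIV" for h
  proof -
    have "is_pole h z \<and> h z = 0 \<or> h \<midarrow>z\<rightarrow> h z" using that by (auto simp: nicely_meromorphic_on_def)
    thus ?thesis by auto
  qed
  show "f z = g z"
    using remove_sings_cong[OF ev refl] nice[OF f] nice[OF g] by simp
qed

theorem riemann_zeta_eq: "riemann_zeta = zeta_cont"
  unfolding riemann_zeta_def
proof (rule the_equality)
  show "zeta_cont nicely_meromorphic_on UNIV \<and> (\<forall>s. Re s > 1 \<longrightarrow> (\<lambda>n. of_nat (Suc n) powr (- s)) sums zeta_cont s)"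
    using nicely_meromorphic_zeta_cont zeta_series_sums zeta_cont_eq_series by auto
next
  fix f assume f: "f nicely_meromorphic_on UNIV \<and> (\<forall>s. Re s > 1 \<longrightarrow> (\<lambda>n. of_nat (Suc n) powr (- s)) sums f s)"
  show "f = zeta_cont"
  proof (rule nicely_meromorphic_eqI[of _ _ "{s. Re s > 1}" 2])
    show "f z = zeta_cont z" if "z \<in> {s. Re s > 1}" for z
      using that f zeta_series_sums[of z] zeta_cont_eq_series[of z] by (auto intro: sums_unique2)
  qed (use f nicely_meromorphic_zeta_cont in \<open>auto intro: open_halfspace_Re_gt\<close>)
qed

lemma riemann_zeta_eq_series: "Re s > 1 \<Longrightarrow> riemann_zeta s = zeta_series s"
  by (simp add: riemann_zeta_eq zeta_cont_eq_series)

lemma riemann_zeta_eq_reflect: "Re s < 0 \<Longrightarrow> riemann_zeta s = zeta_reflect s"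
  by (simp add: riemann_zeta_eq zeta_cont_eq_reflect)

lemma riemann_zeta_times: "Re s > -1 \<Longrightarrow> s \<noteq> 1 \<Longrightarrow> (s - 1) * riemann_zeta s = pole_free_zeta s"
  by (simp add: riemann_zeta_eq zeta_cont_def)

lemma holomorphic_riemann_zeta: "riemann_zeta holomorphic_on (UNIV - {1})"
  unfolding riemann_zeta_eq by (rule holomorphic_zeta_cont)

section \<open>The digamma function\<close>

lemma Ln_plus_one_diff:
  fixes w :: complex
  assumes "Re w > 0"
  shows "Ln (w + 1) - Ln w = Ln (1 + 1 / w)"
proof -
  have w0: "w \<noteq> 0" using assms by auto
  have "Re (1 / w) > 0" using assms by (auto simp: Re_divide intro!: divide_pos_pos add_pos_nonneg)
  hence r: "Re (1 + 1 / w) > 0" by simp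
  hence n: "1 + 1 / w \<noteq> 0" by (metis less_irrefl zero_complex.sel(1))
  have "\<bar>Im (Ln w)\<bar> < pi / 2" "\<bar>Im (Ln (1 + 1 / w))\<bar> < pi / 2"
    using Re_Ln_pos_lt[OF w0] Re_Ln_pos_lt[OF n] assms r by blast+
  hence "Ln (w * (1 + 1 / w)) = Ln w + Ln (1 + 1 / w)"
    using w0 n by (intro Ln_times_simple) auto
  moreover have "w * (1 + 1 / w) = w + 1" using w0 by (simp add: field_simps)
  ultimately show ?thesis by simp
qed

lemma norm_Ln_step_le:
  fixes w :: complex
  assumes "Re w > 0" "norm w \<ge> 2"
  shows "norm (Ln (w + 1) - Ln w - 1 / w) \<le> 2 / (norm w)\<^sup>2"
proof -
  have n: "norm (1 / w) \<le> 1 / 2" using frac_le[of 1 1 2 "norm w"] assms by (simp add: norm_divide)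
  have "norm (Ln (1 + 1 / w) - 1 / w) \<le> norm (1 / w)^2 / (1 - norm (1 / w))"
    by (rule Ln_approx_linear) (use n in simp)
  also have "\<dots> \<le> norm (1 / w)^2 / (1 / 2)"
    using n by (intro divide_left_mono) auto
  finally show ?thesis using assms by (simp add: Ln_plus_one_diff norm_divide power_divide)
qed

text \<open>By its limit formula, psi(z) - Ln z is the sum over n of Ln(z+n+1) - Ln(z+n) - 1/(z+n),
  and each term is quadratic in 1/(z+n). Since Re z > 0, consecutive logarithms differ by Ln(1 +
  1/(z+n)) without a jump of branch.\<close>

theorem norm_Digamma_minus_Ln_le:
  fixes z :: complex
  assumes z: "Re z > 0" "\<bar>Im z\<bar> \<ge> 2"
  shows "norm (Digamma z - Ln z) \<le> 8 / \<bar>Im z\<bar>"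
proof -
  let ?d = "\<lambda>n::nat. Ln (z + of_nat n + 1) - Ln (z + of_nat n) - 1 / (z + of_nat n)"
  define y where "y = \<bar>Im z\<bar>"
  have y: "y \<ge> 2" using z by (simp add: y_def)
  have z0: "z \<noteq> 0" using z by auto
  have part: "(\<Sum>n<m. ?d n) =
     Ln (z + of_nat m) - Ln z - (\<Sum>n<m. inverse (z + of_nat n))" for m
    by (induction m) (simp_all add: algebra_simps inverse_eq_divide)
  have lim0: "(\<lambda>m. Ln (z + of_nat m) - of_real (ln (real m))) \<longlonglongrightarrow> 0"
  proof (rule Lim_transform_eventually)
    have "(\<lambda>m. Ln (1 + z * of_real (1 / real m))) \<longlonglongrightarrow> Ln (1 + z * of_real 0)"
      by (intro tendsto_intros lim_1_over_n) auto
    thus "(\<lambda>m. Ln (1 + z * of_real (1 / real m))) \<longlonglongrightarrow> 0" by simp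
    show "\<forall>\<^sub>F m in sequentially. Ln (1 + z * of_real (1 / real m)) = Ln (z + of_nat m) - of_real (ln (real m))"
      using eventually_gt_at_top[of 0]
    proof eventually_elim
      case (elim m)
      have "1 + z * of_real (1 / real m) = (z + of_nat m) / of_real (real m)"
        using elim by (simp add: field_simps)
      moreover have "z + of_nat m \<noteq> 0" using z by (metis Re_complex_of_real add_pos_nonneg of_nat_0_le_iff of_real_of_nat_eq plus_complex.sel(1) less_irrefl zero_complex.sel(1))
      ultimately show ?case using elim Ln_divide_of_real[of "real m" "z + of_nat m"] by simp
    qed
  qed
  have "(\<lambda>m. (Ln (z + of_nat m) - of_real (ln (real m))) + (of_real (ln (real m)) - (\<Sum>n<m. inverse (z + of_nat n))) - Ln z) \<longlonglongrightarrow> 0 + Digamma z - Ln z"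
    by (intro tendsto_intros lim0 Digamma_LIMSEQ z0)
  hence lim: "(\<lambda>m. \<Sum>n<m. ?d n) \<longlonglongrightarrow> Digamma z - Ln z"
    unfolding part by (simp add: algebra_simps)
  \<comment> \<open>With y = |Im z|, one has |z+n|^2 >= n^2 + y^2 >= (n+y)^2/2, and 1/(n+y)^2 <=
    1/(n+y-1) - 1/(n+y), a telescoping bound. Its sum 4/(y-1) is at most 8/y because y >= 2.\<close>
  have b: "norm (?d n) \<le> 4 * (1 / (real n + y - 1) - 1 / (real (Suc n) + y - 1))" for n
  proof -
    have nw: "norm (z + of_nat n) \<ge> y" using abs_Im_le_cmod[of "z + of_nat n"] by (simp add: y_def)
    have "norm (?d n) \<le> 2 / (norm (z + of_nat n))\<^sup>2"
      by (rule norm_Ln_step_le) (use z nw y in auto)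
    also have "\<dots> \<le> 2 / ((real n + y)\<^sup>2 / 2)"
    proof (rule divide_left_mono)
      have "(norm (z + of_nat n))\<^sup>2 = (Re z + real n)\<^sup>2 + y\<^sup>2" by (simp add: cmod_power2 y_def)
      moreover have "(Re z + real n)\<^sup>2 \<ge> (real n)\<^sup>2" using z by (intro power_mono) auto
      moreover have "(real n + y)\<^sup>2 + (real n - y)\<^sup>2 = 2 * ((real n)\<^sup>2 + y\<^sup>2)" by (simp add: power2_eq_square algebra_simps)
      moreover have "(real n - y)\<^sup>2 \<ge> 0" by simp
      ultimately show "(real n + y)\<^sup>2 / 2 \<le> (norm (z + of_nat n))\<^sup>2" by argo
      show "0 < (norm (z + of_nat n))\<^sup>2 * ((real n + y)\<^sup>2 / 2)" using nw y by (intro mult_pos_pos) auto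
    qed simp
    also have "\<dots> = 4 * (1 / (real n + y)\<^sup>2)" by simp
    also have "1 / (real n + y)\<^sup>2 \<le> 1 / ((real n + y - 1) * (real n + y))"
      using y by (intro divide_left_mono) (auto simp: power2_eq_square intro!: mult_right_mono mult_pos_pos)
    also have "1 / ((real n + y - 1) * (real n + y)) = 1 / (real n + y - 1) - 1 / (real (Suc n) + y - 1)"
      using y by (simp add: field_simps)
    finally show ?thesis by simp
  qed
  have "norm (\<Sum>n<m. ?d n) \<le> 8 / y" for m
  proof -
    have "norm (\<Sum>n<m. ?d n) \<le> (\<Sum>n<m. 4 * (1 / (real n + y - 1) - 1 / (real (Suc n) + y - 1)))"
      by (rule sum_norm_le) (use b in blast)
    also have "\<dots> = 4 * (1 / (real 0 + y - 1) - 1 / (real m + y - 1))"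
      by (subst sum_distrib_left[symmetric], subst sum_lessThan_telescope') simp
    also have "\<dots> \<le> 4 * (1 / (y - 1))" using y by simp
    also have "\<dots> \<le> 8 / y" using y by (simp add: field_simps)
    finally show ?thesis .
  qed
  thus ?thesis using tendsto_upperbound[OF tendsto_norm[OF lim], of "8 / y"] by (simp add: y_def)
qed

lemma DERIV_ln_Gamma_line:
  assumes "a > 0"
  shows "((\<lambda>t. Im (ln_Gamma (Complex a (- t)))) has_real_derivative (- Re (Digamma (Complex a (- t))))) (at t)"
proof -
  have e: "Complex a (- t) = of_real a - \<i> * of_real t" for t by (simp add: Complex_eq)
  have nin: "of_real a - \<i> * of_real t \<notin> \<real>\<^sub>\<le>\<^sub>0" using assms by (auto simp: complex_nonpos_Reals_iff)
  have "((\<lambda>w. ln_Gamma (of_real a - \<i> * w)) has_field_derivative (- \<i> * Digamma (of_real a - \<i> * of_real t))) (at (of_real t))"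
    using nin by (auto intro!: derivative_eq_intros)
  hence "((\<lambda>t. ln_Gamma (of_real a - \<i> * of_real t)) has_vector_derivative (- \<i> * Digamma (of_real a - \<i> * of_real t))) (at t)"
    by (rule has_vector_derivative_real_field)
  hence "((\<lambda>t. Im (ln_Gamma (of_real a - \<i> * of_real t))) has_vector_derivative Im (- \<i> * Digamma (of_real a - \<i> * of_real t))) (at t)"
    by (rule bounded_linear.has_vector_derivative[OF bounded_linear_Im])
  thus ?thesis by (simp add: e has_real_derivative_iff_has_vector_derivative)
qed

lemma DERIV_ln_Gamma_horizontal:
  assumes "x > 0"
  shows "((\<lambda>x. Re (ln_Gamma (Complex x y))) has_real_derivative (Re (Digamma (Complex x y)))) (at x)"
proof -
  have e: "Complex x y = of_real x + \<i> * of_real y" for x by (simp add: Complex_eq)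
  have nin: "of_real x + \<i> * of_real y \<notin> \<real>\<^sub>\<le>\<^sub>0" using assms by (auto simp: complex_nonpos_Reals_iff)
  have "((\<lambda>w. ln_Gamma (w + \<i> * of_real y)) has_field_derivative Digamma (of_real x + \<i> * of_real y)) (at (of_real x))"
    using nin by (auto intro!: derivative_eq_intros)
  hence "((\<lambda>x. ln_Gamma (of_real x + \<i> * of_real y)) has_vector_derivative (Digamma (of_real x + \<i> * of_real y))) (at x)"
    by (rule has_vector_derivative_real_field)
  hence "((\<lambda>x. Re (ln_Gamma (of_real x + \<i> * of_real y))) has_vector_derivative Re (Digamma (of_real x + \<i> * of_real y))) (at x)"
    by (rule bounded_linear.has_vector_derivative[OF bounded_linear_Re])
  thus ?thesis by (simp add: e has_real_derivative_iff_has_vector_derivative)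
qed

lemma Re_Digamma_bounds:
  assumes a: "0 < a" "a \<le> 5/4" and t: "t \<ge> 2"
  shows "\<bar>Re (Digamma (Complex a (- t))) - ln t\<bar> \<le> 9 / t"
proof -
  let ?z = "Complex a (- t)"
  have n0: "?z \<noteq> 0" using a by (auto simp: complex_eq_iff)
  have "\<bar>Re (Digamma ?z - Ln ?z)\<bar> \<le> 8 / t"
    using norm_Digamma_minus_Ln_le[of ?z] abs_Re_le_cmod[of "Digamma ?z - Ln ?z"] a t by simp
  hence 1: "\<bar>Re (Digamma ?z) - ln (norm ?z)\<bar> \<le> 8 / t" using n0 by simp
  have ge: "ln (norm ?z) \<ge> ln t"
    using abs_Im_le_cmod[of ?z] t by (subst ln_le_cancel_iff) auto
  have "norm ?z \<le> t + a\<^sup>2 / t"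
  proof (rule power2_le_imp_le)
    have "(norm ?z)\<^sup>2 = a\<^sup>2 + t\<^sup>2" by (simp add: cmod_power2)
    also have "\<dots> \<le> t\<^sup>2 + 2 * a\<^sup>2 + (a\<^sup>2 / t)\<^sup>2" by simp
    also have "\<dots> = (t + a\<^sup>2 / t)\<^sup>2" using t by (simp add: power2_sum)
    finally show "(norm ?z)\<^sup>2 \<le> (t + a\<^sup>2 / t)\<^sup>2" .
  qed (use t in auto)
  also have "\<dots> = t * (1 + a\<^sup>2 / t\<^sup>2)" using t by (simp add: field_simps power2_eq_square)
  finally have "ln (norm ?z) \<le> ln (t * (1 + a\<^sup>2 / t\<^sup>2))" using n0 by (subst ln_le_cancel_iff) (use t in \<open>auto intro!: mult_pos_pos add_pos_nonneg\<close>)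
  also have "\<dots> = ln t + ln (1 + a\<^sup>2 / t\<^sup>2)" 
  proof -
    have "1 + a\<^sup>2 / t\<^sup>2 > 0" by (intro add_pos_nonneg) auto
    thus ?thesis using t by (simp add: ln_mult)
  qed
  also have "ln (1 + a\<^sup>2 / t\<^sup>2) \<le> a\<^sup>2 / t\<^sup>2" by (rule ln_add_one_self_le_self) simp
  also have "a\<^sup>2 / t\<^sup>2 \<le> 2 / t\<^sup>2"
  proof -
    have "a * a \<le> 5/4 * (5/4)" using a by (intro mult_mono) auto
    hence "a\<^sup>2 \<le> 2" by (simp add: power2_eq_square)
    thus ?thesis by (rule divide_right_mono) simp
  qed
  also have "2 / t\<^sup>2 \<le> 1 / t" using t by (simp add: field_simps power2_eq_square)
  finally have "ln (norm ?z) \<le> ln t + 1 / t" by simp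
  moreover have "9 / t = 8 / t + 1 / t" by (simp add: add_divide_distrib[symmetric])
  ultimately show ?thesis using 1 ge by linarith
qed

theorem Im_ln_Gamma_asymp:
  assumes T0: "2 \<le> T0" "T0 \<le> T"
  shows "\<bar>(Im (ln_Gamma (Complex (5/4) (- T))) + (T * ln T - T)) - (Im (ln_Gamma (Complex (5/4) (- T0))) + (T0 * ln T0 - T0))\<bar> \<le> 9 * (ln T - ln T0)"
proof -
  define g where "g = (\<lambda>t. Im (ln_Gamma (Complex (5/4) (- t))) + (t * ln t - t))"
  define g' where "g' = (\<lambda>t. - Re (Digamma (Complex (5/4) (- t))) + ln t)"
  have g: "(g has_real_derivative g' t) (at t)" if "t \<ge> T0" for t
  proof -
    have "((\<lambda>t. t * ln t - t) has_real_derivative ln t) (at t)"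
      using that T0 by (auto intro!: derivative_eq_intros)
    from DERIV_add[OF DERIV_ln_Gamma_line[of "5/4" t] this] show ?thesis
      by (simp add: g_def[abs_def] g'_def)
  qed
  have b: "\<bar>g' t\<bar> \<le> 9 / t" if "t \<ge> T0" for t
    using Re_Digamma_bounds[of "5/4" t] that T0 by (simp add: g'_def abs_minus_commute)
  have "g T0 + - 9 * ln T0 \<ge> g T + - 9 * ln T"
  proof (rule DERIV_nonpos_imp_nonincreasing[OF T0(2)])
    fix x assume x: "T0 \<le> x" "x \<le> T"
    have "((\<lambda>x. g x + - 9 * ln x) has_real_derivative (g' x + - 9 * (1 / x))) (at x)"
      using x T0 by (auto intro!: derivative_eq_intros g)
    moreover have "g' x + - 9 * (1 / x) \<le> 0" using b[of x] x by simp
    ultimately show "\<exists>y. ((\<lambda>x. g x + - 9 * ln x) has_real_derivative y) (at x) \<and> y \<le> 0" by blast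
  qed
  moreover have "g T0 + 9 * ln T0 \<le> g T + 9 * ln T"
  proof (rule DERIV_nonneg_imp_nondecreasing[OF T0(2)])
    fix x assume x: "T0 \<le> x" "x \<le> T"
    have "((\<lambda>x. g x + 9 * ln x) has_real_derivative (g' x + 9 * (1 / x))) (at x)"
      using x T0 by (auto intro!: derivative_eq_intros g)
    moreover have "g' x + 9 * (1 / x) \<ge> 0" using b[of x] x by simp
    ultimately show "\<exists>y. ((\<lambda>x. g x + 9 * ln x) has_real_derivative y) (at x) \<and> 0 \<le> y" by blast
  qed
  ultimately have "\<bar>g T - g T0\<bar> \<le> 9 * (ln T - ln T0)" by (simp add: abs_le_iff algebra_simps)
  thus ?thesis by (simp add: g_def)
qed

section \<open>The modulus of Gamma on vertical lines\<close>

lemma norm_sin_le_exp: "norm (sin z :: complex) \<le> exp \<bar>Im z\<bar>"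
proof -
  have "norm (sin z) = norm (exp (\<i> * z) - exp (- (\<i> * z))) / 2"
    by (simp add: sin_exp_eq norm_divide norm_mult)
  also have "\<dots> \<le> (norm (exp (\<i> * z)) + norm (exp (- (\<i> * z)))) / 2"
    by (intro divide_right_mono norm_triangle_ineq4) auto
  also have "\<dots> \<le> (exp \<bar>Im z\<bar> + exp \<bar>Im z\<bar>) / 2"
    by (intro divide_right_mono add_mono) (auto simp: norm_exp_eq_Re)
  finally show ?thesis by simp
qed

text \<open>For z = it the conjugate of 1 - z is 1 + z, so the squared modulus is z Gamma(z) Gamma(1
  - z), which reflection evaluates to pi z / sin(pi z).\<close>

lemma norm_Gamma_one_line:
  assumes t: "t > 0"
  shows "(norm (Gamma (Complex 1 (- t))))\<^sup>2 \<ge> pi * t * exp (- (pi * t))"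
proof -
  define z where "z = \<i> * complex_of_real t"
  have z1: "Complex 1 (- t) = 1 - z" "cnj (1 - z) = 1 + z" by (simp_all add: z_def Complex_eq)
  have z0: "z \<noteq> 0" "z \<notin> \<int>\<^sub>\<le>\<^sub>0" using t by (auto simp: z_def complex_eq_iff elim!: nonpos_Ints_cases)
  have "of_real ((norm (Gamma (1 - z)))\<^sup>2) = Gamma (1 - z) * Gamma (1 + z)"
    by (subst complex_norm_square) (simp add: z1(2)[symmetric] cnj_Gamma)
  also have "Gamma (1 + z) = z * Gamma z" using Gamma_plus1[OF z0(2)] by (simp add: add.commute)
  also have "Gamma (1 - z) * (z * Gamma z) = z * (of_real pi / sin (of_real pi * z))"
    using Gamma_reflection_complex[of z] by (simp add: mult_ac)
  finally have "norm (complex_of_real ((norm (Gamma (1 - z)))\<^sup>2)) = norm (z * (of_real pi / sin (of_real pi * z)))" by simp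
  hence "(norm (Gamma (1 - z)))\<^sup>2 = pi * t / norm (sin (of_real pi * z))"
    using t by (simp add: norm_mult norm_divide z_def norm_power)
  moreover have "norm (sin (of_real pi * z)) \<le> exp (pi * t)"
    using norm_sin_le_exp[of "of_real pi * z"] t by (simp add: z_def)
  moreover have "norm (sin (of_real pi * z)) > 0"
  proof -
    have "(norm (Gamma (1 - z)))\<^sup>2 > 0"
    proof -
      have "1 - z \<notin> \<int>\<^sub>\<le>\<^sub>0" by (auto simp: z_def complex_eq_iff elim!: nonpos_Ints_cases)
      thus ?thesis by (simp add: Gamma_eq_zero_iff)
    qed
    thus ?thesis using \<open>(norm (Gamma (1 - z)))\<^sup>2 = _\<close> by (metis div_by_0 less_irrefl norm_eq_zero zero_less_norm_iff)
  qed
  ultimately have "pi * t / exp (pi * t) \<le> (norm (Gamma (1 - z)))\<^sup>2"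
    using t by (auto intro!: divide_left_mono)
  thus ?thesis by (simp add: z1 exp_minus field_simps)
qed

text \<open>Reflection gives $|\Gamma(1-it)|$ exactly, and $|\Gamma(x-it)|$ increases in $x$ as soon as
  $\mathrm{Re}\,\psi(x-it)\ge 0$; this replaces the modulus in Stirling's formula.\<close>
theorem norm_Gamma_five_fourths_line:
  assumes t: "t \<ge> 9"
  shows "norm (Gamma (Complex (5/4) (- t))) \<ge> sqrt (pi * t) * exp (- (pi * t / 2))"
proof -
  have lnt: "ln t \<ge> 1"
  proof -
    have "exp 1 \<le> (3::real)" by (rule exp_le)
    hence "exp 1 \<le> t" using t by linarith
    thus ?thesis using t by (metis ln_exp ln_le_cancel_iff exp_gt_zero less_le_trans)
  qed
  have "Re (ln_Gamma (Complex 1 (- t))) \<le> Re (ln_Gamma (Complex (5/4) (- t)))"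
  proof (rule DERIV_nonneg_imp_nondecreasing[of 1 "5/4" "\<lambda>x. Re (ln_Gamma (Complex x (- t)))"])
    fix x :: real assume x: "1 \<le> x" "x \<le> 5/4"
    \<comment> \<open>Here the threshold t >= 9 enters: the digamma error is at most 1, hence at
      most ln t, and Re psi is nonnegative on the whole horizontal segment.\<close>
    have "9 / t \<le> 1" using t by simp
    hence "Re (Digamma (Complex x (- t))) \<ge> 0" using Re_Digamma_bounds[of x t] x t lnt by linarith
    thus "\<exists>y. ((\<lambda>x. Re (ln_Gamma (Complex x (- t)))) has_real_derivative y) (at x) \<and> 0 \<le> y"
      using DERIV_ln_Gamma_horizontal[of x "- t"] x by (intro exI[of _ "Re (Digamma (Complex x (- t)))"]) auto
  qed simp
  moreover have "norm (Gamma (Complex x (- t))) = exp (Re (ln_Gamma (Complex x (- t))))" if "x > 0" for x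
  proof -
    have "Complex x (- t) \<notin> \<int>\<^sub>\<le>\<^sub>0" using that by (auto elim!: nonpos_Ints_cases simp: complex_eq_iff)
    thus ?thesis by (subst Gamma_complex_altdef) (simp add: norm_exp_eq_Re)
  qed
  ultimately have le: "norm (Gamma (Complex 1 (- t))) \<le> norm (Gamma (Complex (5/4) (- t)))" by simp
  have "(sqrt (pi * t) * exp (- (pi * t / 2)))\<^sup>2 = pi * t * exp (- (pi * t))"
    using t by (simp add: power_mult_distrib exp_double[symmetric])
  also have "\<dots> \<le> (norm (Gamma (Complex 1 (- t))))\<^sup>2" by (rule norm_Gamma_one_line) (use t in simp)
  finally have "sqrt (pi * t) * exp (- (pi * t / 2)) \<le> norm (Gamma (Complex 1 (- t)))"
    by (rule power2_le_imp_le) simp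
  with le show ?thesis by linarith
qed

section \<open>Finite Euler products\<close>

definition dirichlet_coprime :: "nat set \<Rightarrow> complex \<Rightarrow> complex" where
  "dirichlet_coprime P w = infsum (\<lambda>n. of_nat n powr (- w)) {n. n > 0 \<and> (\<forall>p\<in>P. \<not> p dvd n)}"

lemma summable_on_real_powr: "a > 1 \<Longrightarrow> (\<lambda>n. real n powr (- a)) summable_on A"
proof -
  assume "a > 1"
  hence "summable (\<lambda>n. real n powr (- a))" by (simp add: summable_real_powr_iff)
  hence "(\<lambda>n. real n powr (- a)) summable_on UNIV" by (subst summable_on_UNIV_nonneg_real_iff) auto
  thus ?thesis by (rule summable_on_subset_banach) auto
qed

lemma summable_on_of_nat_powr:
  assumes "Re w > 1"
  shows "(\<lambda>n. norm (of_nat n powr (- w) :: complex)) summable_on A" "(\<lambda>n. of_nat n powr (- w) :: complex) summable_on A"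
proof -
  show *: "(\<lambda>n. norm (of_nat n powr (- w) :: complex)) summable_on A"
    unfolding norm_of_nat_powr using summable_on_real_powr[OF assms] by simp
  show "(\<lambda>n. of_nat n powr (- w) :: complex) summable_on A"
    by (rule abs_summable_summable[OF *])
qed

lemma dirichlet_coprime_empty:
  assumes "Re w > 1"
  shows "dirichlet_coprime {} w = zeta_series w"
proof -
  have "(\<lambda>n. of_nat (Suc n) powr (- w)) sums zeta_series w" by (rule zeta_series_sums[OF assms])
  hence "((\<lambda>n. of_nat (Suc n) powr (- w)) has_sum zeta_series w) UNIV"
    by (intro norm_summable_imp_has_sum summable_norm_zeta_series assms)
  hence "((\<lambda>n. of_nat n powr (- w)) has_sum zeta_series w) (range Suc)"
    by (subst has_sum_reindex) (auto simp: o_def)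
  moreover have "range Suc = {n. n > 0 \<and> (\<forall>p\<in>{}. \<not> p dvd n)}" by (auto simp: image_iff gr0_conv_Suc)
  ultimately show ?thesis unfolding dirichlet_coprime_def by (simp add: infsumI)
qed

text \<open>Among the integers free of the primes in P, the multiples of p are exactly p times such
  integers, so discarding them subtracts p^(-w) times the whole sum.\<close>

lemma dirichlet_coprime_insert:
  assumes w: "Re w > 1" and p: "prime p" "p \<notin> P" "\<And>q. q \<in> P \<Longrightarrow> prime q"
  shows "dirichlet_coprime (insert p P) w = (1 - of_nat p powr (- w)) * dirichlet_coprime P w"
proof -
  define A where "A = (\<lambda>P. {n::nat. n > 0 \<and> (\<forall>p\<in>P. \<not> p dvd n)})"
  let ?f = "\<lambda>n. of_nat n powr (- w) :: complex"
  have pp: "p > 0" using p(1) by (simp add: prime_gt_0_nat)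
  have split: "A P = A (insert p P) \<union> (\<lambda>m. p * m) ` A P"
  proof (intro subset_antisym subsetI)
    fix n assume n: "n \<in> A P"
    show "n \<in> A (insert p P) \<union> (\<lambda>m. p * m) ` A P"
    proof (cases "p dvd n")
      case True
      then obtain m where m: "n = p * m" by (elim dvdE)
      hence "m \<in> A P" using n by (auto simp: A_def)
      thus ?thesis using m by blast
    qed (use n in \<open>auto simp: A_def\<close>)
  next
    fix n assume "n \<in> A (insert p P) \<union> (\<lambda>m. p * m) ` A P"
    thus "n \<in> A P"
    proof
      assume "n \<in> (\<lambda>m. p * m) ` A P"
      then obtain m where m: "n = p * m" "m \<in> A P" by blast
      have "\<not> q dvd p * m" if q: "q \<in> P" for q
      proof
        assume "q dvd p * m"
        hence "q dvd p \<or> q dvd m" using p(3)[OF q] by (simp add: prime_dvd_mult_iff)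
        moreover have "\<not> q dvd p" using p q primes_dvd_imp_eq[of q p] by auto
        ultimately show False using m q by (auto simp: A_def)
      qed
      thus ?thesis using m pp by (auto simp: A_def)
    qed (auto simp: A_def)
  qed
  have "infsum ?f (A P) = infsum ?f (A (insert p P)) + infsum ?f ((\<lambda>m. p * m) ` A P)"
    by (subst split, rule infsum_Un_disjoint) (auto simp: A_def intro!: summable_on_of_nat_powr w)
  also have "infsum ?f ((\<lambda>m. p * m) ` A P) = infsum (?f \<circ> (\<lambda>m. p * m)) (A P)"
    by (rule infsum_reindex) (use pp in \<open>auto intro!: inj_onI\<close>)
  also have "\<dots> = infsum (\<lambda>m. ?f p * ?f m) (A P)"
    by (intro infsum_cong) (simp add: powr_times_real)
  also have "\<dots> = ?f p * infsum ?f (A P)" by (rule infsum_cmult_right')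
  finally show ?thesis unfolding dirichlet_coprime_def A_def by (simp add: algebra_simps)
qed

lemma finite_Euler_product:
  assumes "finite P" "\<And>q. q \<in> P \<Longrightarrow> prime q" "Re w > 1"
  shows "zeta_series w * (\<Prod>p\<in>P. 1 - of_nat p powr (- w)) = dirichlet_coprime P w"
  using assms
proof (induction P rule: finite_induct)
  case (insert p P)
  have "zeta_series w * (\<Prod>p\<in>insert p P. 1 - of_nat p powr (- w)) = (1 - of_nat p powr (- w)) * (zeta_series w * (\<Prod>p\<in>P. 1 - of_nat p powr (- w)))"
    using insert by simp
  also have "\<dots> = (1 - of_nat p powr (- w)) * dirichlet_coprime P w" using insert by simp
  also have "\<dots> = dirichlet_coprime (insert p P) w"
    using insert by (intro dirichlet_coprime_insert[symmetric]) auto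
  finally show ?case .
qed (simp add: dirichlet_coprime_empty)

lemma real_powr_tail:
  assumes "a > 1" "e > 0"
  obtains N where "infsum (\<lambda>n. real n powr (- a)) {N<..} < e"
proof -
  have s: "summable (\<lambda>n. real n powr (- a))" using assms by (simp add: summable_real_powr_iff)
  from suminf_exist_split[OF assms(2) s] obtain N where N: "\<And>n. n \<ge> N \<Longrightarrow> norm (\<Sum>i. real (i + n) powr (- a)) < e" by blast
  let ?g = "\<lambda>i. real (i + Suc N) powr (- a)"
  have "(?g has_sum suminf ?g) UNIV"
  proof (rule norm_summable_imp_has_sum)
    have "summable ?g" using s by (rule summable_ignore_initial_segment)
    thus "summable (\<lambda>i. norm (?g i))" "?g sums suminf ?g"
      by (auto intro: summable_sums)
  qed
  hence "((\<lambda>n. real n powr (- a)) has_sum suminf ?g) ((\<lambda>i. i + Suc N) ` UNIV)"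
    by (subst has_sum_reindex) (auto simp: o_def inj_on_def)
  moreover have "(\<lambda>i. i + Suc N) ` UNIV = {N<..}"
  proof (intro subset_antisym subsetI)
    fix n assume "n \<in> {N<..}"
    hence "n = (n - Suc N) + Suc N" by simp
    thus "n \<in> (\<lambda>i. i + Suc N) ` UNIV" by blast
  qed auto
  ultimately have "infsum (\<lambda>n. real n powr (- a)) {N<..} = suminf ?g"
    by (simp add: infsumI)
  also have "\<dots> < e" using N[of "Suc N"] by simp
  finally show ?thesis by (rule that)
qed

text \<open>Once all primes up to N are removed, every surviving n > 1 exceeds N, and what is left
  is a tail of the sum of n^(-a). The bound does not involve Im w, so one finite P serves an entire
  vertical line.\<close>

lemma dirichlet_coprime_near_one:
  assumes a: "a > 1"
  obtains P where "finite P" "\<And>q. q \<in> P \<Longrightarrow> prime (q::nat)" "\<And>w. Re w \<ge> a \<Longrightarrow> norm (dirichlet_coprime P w - 1) \<le> 1 / 2"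
proof -
  obtain N where N: "infsum (\<lambda>n. real n powr (- a)) {N<..} < 1 / 2"
    using real_powr_tail[OF a, of "1/2"] by auto
  define P where "P = {p. prime p \<and> p \<le> N}"
  define B where "B = {n. n > 1 \<and> (\<forall>p\<in>P. \<not> p dvd n)}"
  have AB: "{n. n > 0 \<and> (\<forall>p\<in>P. \<not> p dvd n)} = insert 1 B"
    by (auto simp: B_def P_def)
  have BN: "B \<subseteq> {N<..}"
  proof
    fix n assume n: "n \<in> B"
    hence "n \<noteq> 1" by (auto simp: B_def)
    then obtain p where p: "prime p" "p dvd n" using prime_factor_nat by blast
    hence "p > N" using n by (auto simp: B_def P_def)
    moreover have "p \<le> n" using p n by (intro dvd_imp_le) (auto simp: B_def)
    ultimately show "n \<in> {N<..}" by simp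
  qed
  show ?thesis
  proof (rule that)
    show "finite P" unfolding P_def by (rule finite_subset[of _ "{..N}"]) auto
    show "prime q" if "q \<in> P" for q using that by (simp add: P_def)
    fix w assume w: "Re w \<ge> a"
    hence w1: "Re w > 1" using a by simp
    have "dirichlet_coprime P w = infsum (\<lambda>n. of_nat n powr (- w)) {1} + infsum (\<lambda>n. of_nat n powr (- w)) B"
      unfolding dirichlet_coprime_def AB insert_is_Un[of 1 B]
      by (rule infsum_Un_disjoint) (auto simp: B_def intro!: summable_on_of_nat_powr w1)
    hence "norm (dirichlet_coprime P w - 1) = norm (infsum (\<lambda>n. of_nat n powr (- w) :: complex) B)" by simp
    also have "\<dots> \<le> infsum (\<lambda>n. norm (of_nat n powr (- w) :: complex)) B"
      by (rule norm_infsum_bound) (rule summable_on_of_nat_powr[OF w1])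
    also have "\<dots> \<le> infsum (\<lambda>n. real n powr (- a)) {N<..}"
      unfolding norm_of_nat_powr
    proof (rule infsum_mono_neutral)
      show "(\<lambda>n. real n powr Re (- w)) summable_on B" using summable_on_real_powr[OF w1] by simp
      show "(\<lambda>n. real n powr (- a)) summable_on {N<..}" by (rule summable_on_real_powr[OF a])
      show "real n powr Re (- w) \<le> real n powr - a" if "n \<in> B \<inter> {N<..}" for n
        using that w by (intro powr_mono) (auto simp: B_def)
    qed (use BN in auto)
    finally show "norm (dirichlet_coprime P w - 1) \<le> 1 / 2" using N by simp
  qed
qed

lemma norm_euler_factor:
  assumes "prime p" "Re w > 0"
  shows "norm (of_nat p powr (- w) :: complex) < 1"
proof -
  have "real p > 1" using prime_gt_1_nat[OF assms(1)] by simp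
  hence "real p powr (- Re w) < real p powr 0" using assms by (intro powr_less_mono) auto
  thus ?thesis using \<open>real p > 1\<close> by (simp add: norm_of_nat_powr)
qed

lemma zeta_series_lower_bound:
  assumes a: "a > 1"
  obtains c where "c > 0" "\<And>w. Re w \<ge> a \<Longrightarrow> norm (zeta_series w) \<ge> c"
proof -
  obtain P where P: "finite P" "\<And>q. q \<in> P \<Longrightarrow> prime q" "\<And>w. Re w \<ge> a \<Longrightarrow> norm (dirichlet_coprime P w - 1) \<le> 1 / 2"
    using dirichlet_coprime_near_one[OF a] by blast
  show ?thesis
  proof (rule that)
    \<comment> \<open>The product of zeta with the removed factors has modulus at least 1/2, and
      each of the \<open>card P\<close> factors has modulus at most 2.\<close>
    show "1 / 2 / 2 ^ card P > (0::real)" by simp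
    fix w assume w: "Re w \<ge> a"
    have "norm (\<Prod>p\<in>P. 1 - of_nat p powr (- w)) \<le> (\<Prod>p\<in>P. 2)"
      unfolding prod_norm[symmetric]
    proof (rule prod_mono, safe)
      fix p assume "p \<in> P"
      hence "norm (of_nat p powr (- w) :: complex) < 1" using norm_euler_factor[of p w] P w a by auto
      thus "norm (1 - of_nat p powr (- w) :: complex) \<le> 2" using norm_triangle_ineq4[of 1 "of_nat p powr (- w) :: complex"] by simp
    qed auto
    hence pr: "norm (\<Prod>p\<in>P. 1 - of_nat p powr (- w)) \<le> 2 ^ card P" by simp
    have "norm (1 - (1 - dirichlet_coprime P w)) \<ge> norm (1::complex) - norm (1 - dirichlet_coprime P w)"
      by (rule norm_triangle_ineq2)
    hence "1 / 2 \<le> norm (dirichlet_coprime P w)"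
      using P(3)[OF w] by (simp add: norm_minus_commute field_simps)
    also have "dirichlet_coprime P w = zeta_series w * (\<Prod>p\<in>P. 1 - of_nat p powr (- w))"
      using P w a by (intro finite_Euler_product[symmetric]) auto
    also have "norm \<dots> \<le> norm (zeta_series w) * 2 ^ card P"
      unfolding norm_mult using pr by (intro mult_left_mono) auto
    finally show "1 / 2 / 2 ^ card P \<le> norm (zeta_series w)" by (simp add: field_simps)
  qed
qed

lemma log_deriv_integral_prod:
  assumes "finite I" "\<And>i. i \<in> I \<Longrightarrow> f i holomorphic_on S" "open S" "closed_segment u v \<subseteq> S"
    and "\<And>i z. i \<in> I \<Longrightarrow> z \<in> closed_segment u v \<Longrightarrow> f i z \<notin> \<real>\<^sub>\<le>\<^sub>0"
  shows "\<bar>Im (log_deriv_integral (\<lambda>z. \<Prod>i\<in>I. f i z) u v)\<bar> \<le> real (card I) * (2 * pi)"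
  using assms
proof (induction I rule: finite_induct)
  case empty
  show ?case by (simp add: log_deriv_integral_def)
next
  case (insert i I)
  have nz: "f j z \<noteq> 0" if "j \<in> insert i I" "z \<in> closed_segment u v" for j z
    using insert.prems(4)[OF that] by auto
  have "log_deriv_integral (\<lambda>z. \<Prod>i\<in>insert i I. f i z) u v = log_deriv_integral (\<lambda>z. f i z * (\<Prod>i\<in>I. f i z)) u v"
    using insert by simp
  also have "\<dots> = log_deriv_integral (f i) u v + log_deriv_integral (\<lambda>z. \<Prod>i\<in>I. f i z) u v"
    by (rule log_deriv_integral_mult[of _ S]) (use insert nz in \<open>auto intro!: holomorphic_intros\<close>)
  finally have "Im (log_deriv_integral (\<lambda>z. \<Prod>i\<in>insert i I. f i z) u v) = Im (log_deriv_integral (f i) u v) + Im (log_deriv_integral (\<lambda>z. \<Prod>i\<in>I. f i z) u v)"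
    by simp
  moreover have "\<bar>Im (log_deriv_integral (f i) u v)\<bar> \<le> 2 * pi"
    by (rule log_deriv_integral_slit[of _ S _ _ 1]) (use insert in auto)
  moreover have "\<bar>Im (log_deriv_integral (\<lambda>z. \<Prod>i\<in>I. f i z) u v)\<bar> \<le> real (card I) * (2 * pi)"
    by (rule insert.IH) (use insert.prems in auto)
  moreover have "real (card (insert i I)) * (2 * pi) = 2 * pi + real (card I) * (2 * pi)"
    using insert by (simp add: algebra_simps)
  ultimately show ?case by linarith
qed

lemma zeta_series_nonzero: "Re w > 1 \<Longrightarrow> zeta_series w \<noteq> 0"
proof
  assume w: "Re w > 1" "zeta_series w = 0"
  obtain c where "c > 0" "norm (zeta_series w) \<ge> c" using zeta_series_lower_bound[OF w(1)] by blast
  with w show False by simp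
qed

text \<open>For small a the crude bound zeta(1+a) - 1 on |zeta(w) - 1| exceeds 1 and does not
  confine zeta to a half plane. Each factor 1 - p^(-w) and the remaining sum over integers free of P
  do lie in the right half plane, so the total is at most 2 pi (card P + 1), whatever the
  endpoints.\<close>

lemma log_deriv_integral_zeta_series:
  assumes a: "a > 0"
  obtains K where "\<And>u v. Re u = - a \<Longrightarrow> Re v = - a \<Longrightarrow> \<bar>Im (log_deriv_integral (\<lambda>s. zeta_series (1 - s)) u v)\<bar> \<le> K"
proof -
  obtain P where P: "finite P" "\<And>q. q \<in> P \<Longrightarrow> prime q" "\<And>w. Re w \<ge> 1 + a \<Longrightarrow> norm (dirichlet_coprime P w - 1) \<le> 1 / 2"
    using dirichlet_coprime_near_one[of "1 + a"] a by auto
  show ?thesis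
  proof (rule that)
    fix u v assume uv: "Re u = - a" "Re v = - a"
    let ?S = "{s. Re s < 0}"
    have seg: "Re z = - a" if "z \<in> closed_segment u v" for z
      using that uv by (auto simp: closed_segment_same_Re)
    have S: "open ?S" "closed_segment u v \<subseteq> ?S" using seg a by (auto simp: open_halfspace_Re_lt)
    define f where "f = (\<lambda>p s. 1 - of_nat p powr (- (1 - s)) :: complex)"
    let ?F = "\<lambda>s. \<Prod>p\<in>P. f p s"
    let ?D = "\<lambda>z. dirichlet_coprime P (1 - z)"
    have f: "f p holomorphic_on ?S" if "p \<in> P" for p
      unfolding f_def using P(2)[OF that] by (intro holomorphic_intros) auto
    have fpos: "f p z \<notin> \<real>\<^sub>\<le>\<^sub>0" if "p \<in> P" "z \<in> closed_segment u v" for p z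
    proof -
      have "norm (of_nat p powr (- (1 - z)) :: complex) < 1" using norm_euler_factor[of p "1 - z"] P(2) that seg a by auto
      hence "Re (f p z) > 0" using complex_Re_le_cmod[of "of_nat p powr (- (1 - z)) :: complex"] by (simp add: f_def)
      thus ?thesis by (auto simp: complex_nonpos_Reals_iff)
    qed
    have eq: "zeta_series (1 - s) * ?F s = dirichlet_coprime P (1 - s)" if "s \<in> ?S" for s
      unfolding f_def using that P by (intro finite_Euler_product) auto
    have fprod: "?F holomorphic_on ?S" by (intro holomorphic_intros f)
    have fnz: "?F z \<noteq> 0" if "z \<in> closed_segment u v" for z
      using fpos[OF _ that] P(1) by force
    have "log_deriv_integral (\<lambda>s. zeta_series (1 - s) * ?F s) u v = 
        log_deriv_integral (\<lambda>s. zeta_series (1 - s)) u v + log_deriv_integral ?F u v"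
      by (rule log_deriv_integral_mult[OF holomorphic_zeta_series_reflected fprod S _ fnz])
         (use seg a in \<open>auto intro!: zeta_series_nonzero\<close>)
    moreover have "\<bar>Im (log_deriv_integral ?F u v)\<bar> \<le> real (card P) * (2 * pi)"
      by (rule log_deriv_integral_prod[OF P(1) f S fpos])
    moreover have "\<bar>Im (log_deriv_integral (\<lambda>s. zeta_series (1 - s) * ?F s) u v)\<bar> \<le> 2 * pi"
    proof (rule log_deriv_integral_slit[of _ ?S _ _ 1])
      show "(\<lambda>s. zeta_series (1 - s) * ?F s) holomorphic_on ?S"
        by (intro holomorphic_intros fprod holomorphic_zeta_series_reflected)
      fix z assume z: "z \<in> closed_segment u v"
      have "norm (?D z - 1) \<le> 1 / 2" using seg[OF z] by (intro P(3)) simp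
      hence "Re (1 - ?D z) \<le> 1 / 2"
        using complex_Re_le_cmod[of "1 - ?D z"] by (metis norm_minus_commute order_trans)
      hence "1 - Re (?D z) \<le> 1 / 2" by simp
      hence "Re (?D z) > 0" by argo
      moreover have "1 * (zeta_series (1 - z) * ?F z) = ?D z"
        using eq[of z] S z by auto
      ultimately show "1 * (zeta_series (1 - z) * ?F z) \<notin> \<real>\<^sub>\<le>\<^sub>0"
        by (auto simp: complex_nonpos_Reals_iff)
    qed (use S in auto)
    ultimately show "\<bar>Im (log_deriv_integral (\<lambda>s. zeta_series (1 - s)) u v)\<bar> \<le> (real (card P) + 1) * (2 * pi)"
      by (simp add: algebra_simps)
  qed
qed

section \<open>The function D\<close>

text \<open>The index is shifted: the value is zeta(2n + 2), so \<open>zeta_even 0\<close> is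
  zeta(2).\<close>

definition zeta_even :: "nat \<Rightarrow> real" where
  "zeta_even n = (\<Sum>m. real (Suc m) powr (- real (2 * Suc n)))"

lemma riemann_zeta_even: "riemann_zeta (of_nat (2 * Suc n)) = of_real (zeta_even n)"
proof -
  have "(\<lambda>m. of_real (real (Suc m) powr (- real (2 * Suc n)))) sums complex_of_real (zeta_even n)"
    unfolding sums_of_real_iff zeta_even_def by (intro summable_sums summable_Suc_powr) simp
  moreover have "complex_of_nat (Suc m) powr (- of_nat (2 * Suc n)) = of_real (real (Suc m) powr (- real (2 * Suc n)))" for m
  proof -
    have "complex_of_nat (Suc m) powr (- of_nat (2 * Suc n)) = of_real (real (Suc m)) powr of_real (- real (2 * Suc n))"
      by (simp only: of_real_minus of_real_of_nat_eq)
    also have "\<dots> = of_real (real (Suc m) powr (- real (2 * Suc n)))" by (rule powr_of_real) auto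
    finally show ?thesis .
  qed
  moreover have "Re (of_nat (2 * Suc n)) > 1" by simp
  ultimately show ?thesis
    by (subst riemann_zeta_eq_series) (simp_all only: zeta_series_def sums_iff)
qed

text \<open>All bases in zeta(2n+2) - 1 are at least 2, so 2n of the 2n + 2 powers yield 4^(-n), and
  the remaining squares sum to at most zeta(2).\<close>

lemma zeta_even_bounds: "0 \<le> zeta_even n - 1" "zeta_even n - 1 \<le> zeta_even 0 * (1 / 4) ^ n"
proof -
  define f where "f = (\<lambda>m. real (Suc m) powr (- real (2 * Suc n)))"
  have f: "summable f" unfolding f_def by (intro summable_Suc_powr) simp
  have s2: "summable (\<lambda>m. real (Suc m) powr (- real (2 * Suc 0)))" by (intro summable_Suc_powr) simp
  have eq: "zeta_even n - 1 = (\<Sum>m. f (Suc m))"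
    using suminf_split_head[OF f] by (simp add: zeta_even_def f_def)
  have fS: "summable (\<lambda>m. f (Suc m))" using f by (subst summable_Suc_iff)
  show "0 \<le> zeta_even n - 1" unfolding eq by (rule suminf_nonneg[OF fS]) (simp add: f_def)
  have "(\<Sum>m. f (Suc m)) \<le> (\<Sum>m. real (Suc m) powr (- real (2 * Suc 0)) * (1 / 4) ^ n)"
  proof (rule suminf_le)
    fix m
    have "f (Suc m) = real (Suc (Suc m)) powr (- 2) * real (Suc (Suc m)) powr (- real (2 * n))"
      by (simp add: f_def powr_add[symmetric])
    also have "\<dots> \<le> real (Suc m) powr (- 2) * 2 powr (- real (2 * n))"
      by (intro mult_mono powr_mono2') auto
    also have "2 powr (- real (2 * n)) = (1 / 4) ^ n"
    proof -
      have "(2::real) powr (- real (2 * n)) = inverse (2 powr real (2 * n))" by (rule powr_minus)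
      also have "(2::real) powr real (2 * n) = 2 ^ (2 * n)" by (rule powr_realpow) simp
      finally show ?thesis by (simp add: power_mult power_divide inverse_eq_divide)
    qed
    finally show "f (Suc m) \<le> real (Suc m) powr (- real (2 * Suc 0)) * (1 / 4) ^ n" by simp
  qed (rule fS, rule summable_mult2[OF s2])
  also have "\<dots> = zeta_even 0 * (1 / 4) ^ n" unfolding zeta_even_def by (rule suminf_mult2[OF s2, symmetric])
  finally show "zeta_even n - 1 \<le> zeta_even 0 * (1 / 4) ^ n" unfolding eq .
qed

lemma zeta_even_ge_1: "zeta_even n \<ge> 1"
  using zeta_even_bounds(1)[of n] by simp

lemma zeta_even_le: "zeta_even n \<le> 1 + zeta_even 0"
proof -
  have "zeta_even 0 * (1 / 4) ^ n \<le> zeta_even 0 * 1"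
    using zeta_even_ge_1[of 0] by (intro mult_left_mono power_le_one) auto
  thus ?thesis using zeta_even_bounds(2)[of n] by simp
qed

lemma E_fun_eq: "E_fun s = (\<Sum>n. of_real (zeta_even n - 1) * of_nat (Suc n) powr (- s))"
  unfolding E_fun_def riemann_zeta_even by simp

text \<open>For Re s > -1 the power of n + 1 is at most n + 1 <= 2^n, which uses up only part of the
  decay 4^(-n). The majorant is independent of s and so serves for convergence, holomorphy and
  boundedness alike.\<close>

lemma norm_E_term_le:
  assumes "Re s > -1"
  shows "norm (of_real (zeta_even n - 1) * of_nat (Suc n) powr (- s) :: complex) \<le> zeta_even 0 * (1 / 2) ^ n"
proof -
  let ?t = "of_real (zeta_even n - 1) * of_nat (Suc n) powr (- s) :: complex"
  have "norm ?t = (zeta_even n - 1) * real (Suc n) powr (- Re s)"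
  proof -
    have "norm (complex_of_real (zeta_even n - 1)) = zeta_even n - 1"
      using zeta_even_bounds(1)[of n] by (simp only: norm_of_real abs_of_nonneg)
    thus ?thesis unfolding norm_mult norm_of_nat_powr by simp
  qed
  also have "\<dots> \<le> (zeta_even 0 * (1 / 4) ^ n) * 2 ^ n"
  proof (rule mult_mono)
    have "real (Suc n) powr (- Re s) \<le> real (Suc n) powr 1" using assms by (intro powr_mono) auto
    also have "\<dots> = real (Suc n)" by simp
    also have "real (Suc n) \<le> 2 ^ n"
      using Suc_leI[OF less_exp[of n]] by (metis of_nat_le_iff of_nat_numeral of_nat_power)
    finally show "real (Suc n) powr (- Re s) \<le> 2 ^ n" .
  qed (use zeta_even_bounds[of n] zeta_even_ge_1[of 0] in auto)
  also have "\<dots> = zeta_even 0 * (1 / 2) ^ n" 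
  proof -
    have "(1 / 4) ^ n * 2 ^ n = ((1 / 2) ^ n :: real)" by (subst power_mult_distrib[symmetric]) simp
    thus ?thesis by (simp only: mult.assoc)
  qed
  finally show ?thesis .
qed

lemma summable_E_bound: "summable (\<lambda>n. zeta_even 0 * (1 / 2) ^ n)"
  by (intro summable_mult summable_geometric) simp

lemma E_fun_sums:
  assumes "Re s > -1"
  shows "(\<lambda>n. of_real (zeta_even n - 1) * of_nat (Suc n) powr (- s)) sums E_fun s"
  unfolding E_fun_eq 
  by (intro summable_sums summable_comparison_test'[OF summable_E_bound, of 0]) (use norm_E_term_le[OF assms] in auto)

lemma norm_E_fun_le:
  assumes "Re s > -1"
  shows "norm (E_fun s) \<le> 2 * zeta_even 0"
proof -
  have "norm (E_fun s) \<le> (\<Sum>n. zeta_even 0 * (1 / 2) ^ n)"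
    unfolding E_fun_eq by (rule norm_suminf_le[OF norm_E_term_le[OF assms] summable_E_bound])
  also have "\<dots> = zeta_even 0 * (\<Sum>n. (1 / 2) ^ n)" by (rule suminf_mult) (simp add: summable_geometric)
  also have "(\<Sum>n. (1 / 2) ^ n) = (2::real)" by (subst suminf_geometric) auto
  finally show ?thesis by simp
qed

lemma holomorphic_E_fun: "E_fun holomorphic_on {s. Re s > -1}"
proof -
  have "(\<lambda>s. \<Sum>n. of_real (zeta_even n - 1) * of_nat (Suc n) powr (- s)) holomorphic_on {s. Re s > -1}"
  proof (rule holomorphic_suminf)
    show "open {s. Re s > -1}" by (rule open_halfspace_Re_gt)
    show "(\<lambda>s. of_real (zeta_even n - 1) * of_nat (Suc n) powr (- s)) holomorphic_on {s. Re s > -1}" for n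
      by (intro holomorphic_intros)
    fix x :: complex assume "x \<in> {s. Re s > -1}"
    then obtain d where d: "d > 0" "cball x d \<subseteq> {s. Re s > -1}"
      using open_contains_cball[of "{s. Re s > -1}"] open_halfspace_Re_gt[of "-1"] by blast
    thus "\<exists>d M. d > 0 \<and> cball x d \<subseteq> {s. Re s > -1} \<and> summable M \<and> (\<forall>n. \<forall>y\<in>cball x d. norm (of_real (zeta_even n - 1) * of_nat (Suc n) powr (- y) :: complex) \<le> M n)"
      using summable_E_bound norm_E_term_le by (intro exI[of _ d] exI[of _ "\<lambda>n. zeta_even 0 * (1 / 2) ^ n"]) blast
  qed
  thus ?thesis unfolding E_fun_eq[abs_def] .
qed

definition pole_free_D :: "complex \<Rightarrow> complex" where
  "pole_free_D s = pole_free_zeta s + (s - 1) * E_fun s"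

lemma holomorphic_pole_free_D: "pole_free_D holomorphic_on {s. Re s > -1}"
  unfolding pole_free_D_def[abs_def] by (intro holomorphic_intros holomorphic_pole_free_zeta holomorphic_E_fun)

lemma pole_free_D_eq: "Re s > -1 \<Longrightarrow> s \<noteq> 1 \<Longrightarrow> pole_free_D s = (s - 1) * D_fun s"
  by (simp add: pole_free_D_def D_fun_def distrib_left riemann_zeta_times)

lemma pole_free_D_1: "pole_free_D 1 = 1"
  by (simp add: pole_free_D_def pole_free_zeta_1)

lemma holomorphic_D_fun: "D_fun holomorphic_on {s. Re s > -1} - {1}"
  unfolding D_fun_def[abs_def]
  by (intro holomorphic_intros holomorphic_on_subset[OF holomorphic_riemann_zeta] holomorphic_on_subset[OF holomorphic_E_fun]) auto

text \<open>The series over n >= 2 from the definition of \<open>sigma0\<close>. The term n = 1 of D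
  is the constant zeta(2), so \<open>sigma0\<close> is where the tail balances it.\<close>

definition D_tail :: "real \<Rightarrow> real" where
  "D_tail \<sigma> = (\<Sum>n. zeta_even (Suc n) * real (Suc (Suc n)) powr (- \<sigma>))"

lemma D_fun_sums:
  assumes "Re s > 1"
  shows "(\<lambda>n. of_real (zeta_even n) * of_nat (Suc n) powr (- s)) sums D_fun s"
proof -
  have "(\<lambda>n. of_nat (Suc n) powr (- s) + of_real (zeta_even n - 1) * of_nat (Suc n) powr (- s)) sums (zeta_series s + E_fun s)"
    using assms by (intro sums_add zeta_series_sums E_fun_sums) auto
  moreover have "of_nat (Suc n) powr (- s) + of_real (zeta_even n - 1) * of_nat (Suc n) powr (- s) = of_real (zeta_even n) * of_nat (Suc n) powr (- s)" for n
    by (simp add: algebra_simps)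
  ultimately show ?thesis using riemann_zeta_eq_series[OF assms] by (simp add: D_fun_def)
qed

lemma summable_D_tail:
  assumes "\<sigma> > 1"
  shows "summable (\<lambda>n. zeta_even (Suc n) * real (Suc (Suc n)) powr (- \<sigma>))"
proof (rule summable_comparison_test')
  show "summable (\<lambda>n. (1 + zeta_even 0) * real (Suc (Suc n)) powr (- \<sigma>))"
    using summable_Suc_powr[OF assms] by (intro summable_mult) (subst summable_Suc_iff)
  show "norm (zeta_even (Suc n) * real (Suc (Suc n)) powr (- \<sigma>)) \<le> (1 + zeta_even 0) * real (Suc (Suc n)) powr (- \<sigma>)" for n
    using zeta_even_le[of "Suc n"] zeta_even_ge_1[of "Suc n"] by (simp add: abs_mult mult_right_mono del: of_nat_Suc)
qed

lemma norm_D_fun_minus_le: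
  assumes "Re s > 1"
  shows "norm (D_fun s - of_real (zeta_even 0)) \<le> D_tail (Re s)"
proof -
  have "(\<lambda>n. of_real (zeta_even (Suc n)) * of_nat (Suc (Suc n)) powr (- s)) sums (D_fun s - of_real (zeta_even 0))"
    using D_fun_sums[OF assms] by (subst sums_Suc_iff) simp
  hence eq: "D_fun s - of_real (zeta_even 0) = (\<Sum>n. of_real (zeta_even (Suc n)) * of_nat (Suc (Suc n)) powr (- s))"
    by (simp add: sums_iff)
  show ?thesis unfolding eq D_tail_def
  proof (rule norm_suminf_le)
    show "norm (of_real (zeta_even (Suc n)) * of_nat (Suc (Suc n)) powr (- s) :: complex) \<le> zeta_even (Suc n) * real (Suc (Suc n)) powr (- Re s)" for n
      unfolding norm_mult norm_of_nat_powr using zeta_even_ge_1[of "Suc n"] by simp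
  qed (rule summable_D_tail[OF assms])
qed

lemma D_fun_of_real:
  assumes "\<sigma> > 1"
  shows "D_fun (of_real \<sigma>) = of_real (zeta_even 0 + D_tail \<sigma>)"
proof -
  have "(\<lambda>n. zeta_even (Suc n) * real (Suc (Suc n)) powr (- \<sigma>)) sums D_tail \<sigma>"
    unfolding D_tail_def by (intro summable_sums summable_D_tail assms)
  hence "(\<lambda>n. zeta_even n * real (Suc n) powr (- \<sigma>)) sums (D_tail \<sigma> + zeta_even 0)"
    by (subst (asm) sums_Suc_iff) simp
  hence "(\<lambda>n. of_real (zeta_even n * real (Suc n) powr (- \<sigma>))) sums complex_of_real (D_tail \<sigma> + zeta_even 0)"
    by (simp only: sums_of_real_iff)
  moreover have "complex_of_real (zeta_even n * real (Suc n) powr (- \<sigma>)) = of_real (zeta_even n) * of_nat (Suc n) powr (- of_real \<sigma>)" for n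
    using powr_of_real[of "real (Suc n)" "- \<sigma>"] by (simp del: of_nat_Suc)
  ultimately have "(\<lambda>n. of_real (zeta_even n) * of_nat (Suc n) powr (- of_real \<sigma>)) sums complex_of_real (D_tail \<sigma> + zeta_even 0)"
    by (simp only:)
  moreover have "(\<lambda>n. of_real (zeta_even n) * of_nat (Suc n) powr (- of_real \<sigma>)) sums D_fun (of_real \<sigma>)"
    using assms by (intro D_fun_sums) simp
  ultimately show ?thesis by (metis sums_unique2 add.commute)
qed

section \<open>The abscissa sigma0\<close>

lemma D_tail_strict_antimono:
  assumes "1 < \<sigma>" "\<sigma> < \<tau>"
  shows "D_tail \<tau> < D_tail \<sigma>"
proof -
  let ?a = "\<lambda>\<sigma> n. zeta_even (Suc n) * real (Suc (Suc n)) powr (- \<sigma>)"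
  have s: "summable (\<lambda>n. ?a \<sigma> n - ?a \<tau> n)"
    using assms by (intro summable_diff summable_D_tail) auto
  have "0 < (\<Sum>n. ?a \<sigma> n - ?a \<tau> n)"
  proof (rule suminf_pos[OF s])
    fix n
    have "real (Suc (Suc n)) powr (- \<tau>) < real (Suc (Suc n)) powr (- \<sigma>)" using assms by (intro powr_less_mono) auto
    thus "0 < ?a \<sigma> n - ?a \<tau> n"
      using zeta_even_ge_1[of "Suc n"] by (simp add: mult_strict_left_mono del: of_nat_Suc)
  qed
  also have "\<dots> = D_tail \<sigma> - D_tail \<tau>" unfolding D_tail_def
    using assms by (intro suminf_diff[symmetric] summable_D_tail) auto
  finally show ?thesis by simp
qed

text \<open>The simple pole forces this: (\<sigma> - 1) D(\<sigma>) tends to 1, so D exceeds 2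
  zeta(2) just to the right of 1. The bound \<sigma> \<le> 2 places this point to the left of the
  one in the next lemma.\<close>

lemma D_tail_large: "\<exists>\<sigma>. 1 < \<sigma> \<and> \<sigma> \<le> 2 \<and> D_tail \<sigma> \<ge> zeta_even 0"
proof -
  have "continuous_on {s. Re s > -1} pole_free_D"
    by (rule holomorphic_on_imp_continuous_on[OF holomorphic_pole_free_D])
  hence "isCont pole_free_D 1"
    using continuous_on_eq_continuous_at[of "{s. Re s > -1}" pole_free_D] by (simp add: open_halfspace_Re_gt)
  then obtain d where d: "d > 0" "\<And>s. dist s 1 < d \<Longrightarrow> dist (pole_free_D s) 1 < 1 / 2"
    unfolding continuous_at_eps_delta pole_free_D_1 by (metis half_gt_zero_iff zero_less_one)
  \<comment> \<open>Below d, the product e D(1 + e) exceeds 1/2; with e at most 1/(4 zeta(2)) this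
    gives D(1 + e) > 2 zeta(2).\<close>
  define e where "e = min (d / 2) (1 / (4 * zeta_even 0))"
  define \<sigma> where "\<sigma> = 1 + e"
  have a0: "zeta_even 0 \<ge> 1" by (rule zeta_even_ge_1)
  have e: "0 < e" "e < d" "e \<le> 1 / (4 * zeta_even 0)" using d a0 by (auto simp: e_def min_def)
  have "1 / (4 * zeta_even 0) \<le> 1" using a0 by simp
  hence \<sigma>: "1 < \<sigma>" "\<sigma> \<le> 2" using e by (auto simp: \<sigma>_def)
  have "dist (of_real \<sigma>) (1::complex) < d"
    using e by (simp add: \<sigma>_def dist_norm)
  hence "norm (1 - pole_free_D (of_real \<sigma>)) < 1 / 2" using d(2) by (simp add: dist_norm norm_minus_commute)
  hence "Re (1 - pole_free_D (of_real \<sigma>)) < 1 / 2" using complex_Re_le_cmod le_less_trans by blast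
  hence 1: "1 - Re (pole_free_D (of_real \<sigma>)) < 1 / 2" by simp
  have "of_real \<sigma> \<noteq> (1::complex)" using \<sigma> by (metis less_irrefl of_real_1 of_real_eq_iff)
  hence "pole_free_D (of_real \<sigma>) = (of_real \<sigma> - 1) * of_real (zeta_even 0 + D_tail \<sigma>)"
    using \<sigma> pole_free_D_eq[of "of_real \<sigma>"] D_fun_of_real[of \<sigma>] by simp
  also have "\<dots> = of_real (e * (zeta_even 0 + D_tail \<sigma>))" by (simp add: \<sigma>_def)
  finally have "Re (pole_free_D (of_real \<sigma>)) = e * (zeta_even 0 + D_tail \<sigma>)" by simp
  with 1 have 2: "1 / 2 < e * (zeta_even 0 + D_tail \<sigma>)" by argo
  have pos: "zeta_even 0 + D_tail \<sigma> > 0" using 2 e(1) by (smt (verit) divide_pos_pos mult_le_0_iff)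
  have "e * (zeta_even 0 + D_tail \<sigma>) \<le> 1 / (4 * zeta_even 0) * (zeta_even 0 + D_tail \<sigma>)"
    using e pos by (intro mult_right_mono) auto
  with 2 have "1 / 2 < 1 / (4 * zeta_even 0) * (zeta_even 0 + D_tail \<sigma>)" by (rule less_le_trans)
  hence "2 * zeta_even 0 < zeta_even 0 + D_tail \<sigma>" using a0 by (simp add: field_simps)
  thus ?thesis using \<sigma> by (intro exI[of _ \<sigma>]) auto
qed

text \<open>All bases are at least 2, so raising the exponent by m shrinks the tail by the factor
  2^(-m), below 1 for large m, while zeta(2) >= 1.\<close>

lemma D_tail_small: "\<exists>\<sigma>. 2 \<le> \<sigma> \<and> D_tail \<sigma> \<le> zeta_even 0"
proof -
  let ?a = "\<lambda>n. real (Suc (Suc n))"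
  obtain m where m: "D_tail 2 < 2 ^ m" using real_arch_pow[of 2 "D_tail 2"] by auto
  have "D_tail (2 + real m) \<le> (\<Sum>n. zeta_even (Suc n) * ?a n powr (- 2) * (1 / 2) ^ m)"
    unfolding D_tail_def
  proof (rule suminf_le)
    fix n
    have "?a n powr (- (2 + real m)) = ?a n powr (- 2) * ?a n powr (- real m)"
      by (simp add: powr_add[symmetric])
    also have "\<dots> \<le> ?a n powr (- 2) * 2 powr (- real m)"
      by (intro mult_mono powr_mono2') auto
    also have "2 powr (- real m) = (1 / 2) ^ m"
      by (simp add: powr_minus powr_realpow power_divide inverse_eq_divide)
    finally show "zeta_even (Suc n) * ?a n powr (- (2 + real m)) \<le> zeta_even (Suc n) * ?a n powr (- 2) * (1 / 2) ^ m"
      using zeta_even_ge_1[of "Suc n"] by (simp add: mult.assoc mult_left_mono del: of_nat_Suc)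
  qed (rule summable_D_tail, simp, rule summable_mult2, rule summable_D_tail, simp)
  also have "\<dots> = D_tail 2 * (1 / 2) ^ m" unfolding D_tail_def
    by (rule suminf_mult2[symmetric]) (rule summable_D_tail, simp)
  also have "\<dots> \<le> 2 ^ m * (1 / 2) ^ m" using m by (intro mult_right_mono) auto
  also have "\<dots> = 1" by (simp add: power_mult_distrib[symmetric])
  also have "\<dots> \<le> zeta_even 0" by (rule zeta_even_ge_1)
  finally show ?thesis by (intro exI[of _ "2 + real m"]) auto
qed

text \<open>As \<open>sigma0\<close> is a definite description, its properties rest on existence, by
  the intermediate value theorem between the two points just found, and uniqueness, by strict
  monotonicity. Continuity of the tail is inherited from holomorphy of D.\<close>

lemma sigma0_props: "sigma0 > 1" "D_tail sigma0 = zeta_even 0"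
proof -
  have cont: "continuous_on {\<sigma>. 1 < \<sigma>} D_tail"
  proof -
    have "continuous_on {\<sigma>. 1 < \<sigma>} (\<lambda>\<sigma>. Re (D_fun (of_real \<sigma>)) - zeta_even 0)"
    proof (intro continuous_intros continuous_on_compose2[OF holomorphic_on_imp_continuous_on[OF holomorphic_D_fun]])
      show "complex_of_real ` {\<sigma>. 1 < \<sigma>} \<subseteq> {s. Re s > -1} - {1}"
        by auto
    qed
    thus ?thesis by (rule continuous_on_eq) (simp add: D_fun_of_real)
  qed
  obtain a b where ab: "1 < a" "a \<le> 2" "D_tail a \<ge> zeta_even 0" "2 \<le> b" "D_tail b \<le> zeta_even 0"
    using D_tail_large D_tail_small by blast
  have "\<exists>x\<ge>a. x \<le> b \<and> D_tail x = zeta_even 0"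
  proof (rule IVT2')
    show "continuous_on {a..b} D_tail" by (rule continuous_on_subset[OF cont]) (use ab in auto)
  qed (use ab in auto)
  then obtain x where x: "x \<ge> a" "D_tail x = zeta_even 0" by blast
  define Q where "Q = (\<lambda>\<sigma>. \<sigma> > 1 \<and> (\<lambda>n. riemann_zeta (of_nat (2 * (n + 2))) * of_nat (n + 2) powr (- of_real \<sigma>)) sums riemann_zeta 2)"
  have Q: "Q \<sigma> \<longleftrightarrow> \<sigma> > 1 \<and> D_tail \<sigma> = zeta_even 0" for \<sigma>
  proof (cases "\<sigma> > 1")
    case True
    have "riemann_zeta (of_nat (2 * (n + 2))) * of_nat (n + 2) powr (- of_real \<sigma>) = of_real (zeta_even (Suc n) * real (Suc (Suc n)) powr (- \<sigma>))" for n
    proof -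
      have e: "n + 2 = Suc (Suc n)" by simp
      have p: "complex_of_nat k powr (- of_real \<sigma>) = of_real (real k powr (- \<sigma>))" for k
        using powr_of_real[of "real k" "- \<sigma>"] by simp
      show ?thesis unfolding e riemann_zeta_even p by (simp only: of_real_mult)
    qed
    moreover have "riemann_zeta 2 = of_real (zeta_even 0)"
      using riemann_zeta_even[of 0] by simp
    ultimately have "Q \<sigma> \<longleftrightarrow> (\<lambda>n. zeta_even (Suc n) * real (Suc (Suc n)) powr (- \<sigma>)) sums zeta_even 0"
      using True unfolding Q_def by (simp only: sums_of_real_iff simp_thms)
    also have "\<dots> \<longleftrightarrow> D_tail \<sigma> = zeta_even 0"
      using summable_D_tail[OF True] by (simp add: sums_iff D_tail_def)
    finally show ?thesis using True by simp
  qed (simp add: Q_def)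
  have "sigma0 = x"
    unfolding sigma0_def Q_def[symmetric]
  proof (rule the_equality)
    show "Q x" using Q x ab by simp
    fix y assume "Q y"
    hence "y > 1" "D_tail y = D_tail x" using Q x by auto
    thus "y = x" using D_tail_strict_antimono[of x y] D_tail_strict_antimono[of y x] x ab by (cases x y rule: linorder_cases) auto
  qed
  thus "sigma0 > 1" "D_tail sigma0 = zeta_even 0" using x ab by auto
qed

text \<open>The margin is zeta(2) minus the tail at b, and it shrinks to 0 as b approaches
  \<open>sigma0\<close>; hence the right edge is placed strictly beyond
  \<open>sigma0\<close>.\<close>

lemma Re_D_fun_pos:
  assumes "b > sigma0"
  obtains m where "m > 0" "\<And>s. Re s \<ge> b \<Longrightarrow> Re (D_fun s) \<ge> m"
proof
  have b: "b > 1" using assms sigma0_props by simp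
  show "zeta_even 0 - D_tail b > 0" using D_tail_strict_antimono[OF sigma0_props(1) assms] sigma0_props(2) by simp
  fix s assume s: "Re s \<ge> b"
  have "norm (of_real (zeta_even 0) - D_fun s) \<le> D_tail (Re s)"
    using norm_D_fun_minus_le[of s] s b by (simp add: norm_minus_commute)
  hence "Re (of_real (zeta_even 0) - D_fun s) \<le> D_tail (Re s)" using complex_Re_le_cmod order_trans by blast
  moreover have "D_tail (Re s) \<le> D_tail b" using D_tail_strict_antimono[OF b, of "Re s"] s by (cases "Re s = b") auto
  ultimately show "Re (D_fun s) \<ge> zeta_even 0 - D_tail b" by simp
qed

lemma D_fun_nonzero: "Re s > sigma0 \<Longrightarrow> D_fun s \<noteq> 0"
  using Re_D_fun_pos[of "Re s"] by (metis less_le_not_le order_refl zero_complex.sel(1))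

text \<open>For |Im s| >= 1 also |s - 1| >= 1, so dividing by s - 1 preserves the cubic bound on (s
  - 1) zeta(s).\<close>

lemma norm_D_fun_le:
  obtains C where "C > 0" "\<And>s. Re s \<ge> -1/2 \<Longrightarrow> \<bar>Im s\<bar> \<ge> 1 \<Longrightarrow> norm (D_fun s) \<le> C * (1 + norm s) ^ 3"
proof -
  obtain C where C: "C > 0" "\<And>s. Re s \<ge> -1/2 \<Longrightarrow> norm (pole_free_zeta s) \<le> C * (1 + norm s) ^ 3"
    using norm_pole_free_zeta_le by blast
  have a0: "zeta_even 0 \<ge> 1" by (rule zeta_even_ge_1)
  show ?thesis
  proof
    show "C + 2 * zeta_even 0 > 0" using C a0 by simp
    fix s :: complex assume s: "Re s \<ge> -1/2" "\<bar>Im s\<bar> \<ge> 1"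
    have R: "Re s > -1" using s by argo
    have s1: "s \<noteq> 1" using s by auto
    have n1: "norm (s - 1) \<ge> 1" using abs_Im_le_cmod[of "s - 1"] s by simp
    have "norm (riemann_zeta s) \<le> norm (s - 1) * norm (riemann_zeta s)"
      using mult_right_mono[OF n1, of "norm (riemann_zeta s)"] by simp
    also have "\<dots> = norm (pole_free_zeta s)" using riemann_zeta_times[OF R s1] by (simp add: norm_mult[symmetric])
    also have "\<dots> \<le> C * (1 + norm s) ^ 3" by (rule C(2)[OF s(1)])
    finally have 1: "norm (riemann_zeta s) \<le> C * (1 + norm s) ^ 3" .
    have "2 * zeta_even 0 * 1 \<le> 2 * zeta_even 0 * (1 + norm s) ^ 3"
      using a0 by (intro mult_left_mono one_le_power) auto
    hence 2: "norm (E_fun s) \<le> 2 * zeta_even 0 * (1 + norm s) ^ 3" using norm_E_fun_le[OF R] by linarith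
    have "norm (D_fun s) \<le> norm (riemann_zeta s) + norm (E_fun s)" unfolding D_fun_def by (rule norm_triangle_ineq)
    thus "norm (D_fun s) \<le> (C + 2 * zeta_even 0) * (1 + norm s) ^ 3" using 1 2 by (simp add: distrib_right)
  qed
qed

section \<open>Variation of the argument on the left edge\<close>

text \<open>A holomorphic logarithm of the functional equation without its two factors of bounded
  argument. The sine is split as (i/2) exp(-i pi s/2) (1 - exp(i pi s)); for Im s > 0 the last
  factor lies in the right half plane and is left out, as is zeta(1 - s).\<close>

definition reflect_exponent :: "complex \<Rightarrow> complex" where
  "reflect_exponent s = s * of_real (ln 2) + (s - 1) * of_real (ln pi) + Ln (\<i> / 2)
     - \<i> * of_real pi * s / 2 + ln_Gamma (1 - s)"

lemma sin_eq_exp_times: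
  "sin w = \<i> / 2 * exp (- (\<i> * w)) * (1 - exp (2 * \<i> * w))" for w :: complex
proof -
  have "exp (- (\<i> * w)) * exp (2 * \<i> * w) = exp (\<i> * w)"
    by (simp add: exp_add[symmetric] algebra_simps)
  thus ?thesis unfolding sin_exp_eq' by (simp add: algebra_simps)
qed

lemma zeta_reflect_factor:
  assumes "Re s < 0"
  shows "zeta_reflect s = exp (reflect_exponent s) * ((1 - exp (\<i> * of_real pi * s)) * zeta_series (1 - s))"
proof -
  have L: "2 powr s = exp (s * of_real (ln 2))" "of_real pi powr (s - 1) = exp ((s - 1) * of_real (ln pi))"
    using Ln_of_real[of 2] Ln_of_real[of pi] by (simp_all add: powr_def)
  have G: "Gamma (1 - s) = exp (ln_Gamma (1 - s))"
    using Re_pos_not_nonpos_Ints[of "1 - s"] assms by (simp add: Gamma_complex_altdef)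
  have S: "sin (of_real pi * s / 2) = exp (Ln (\<i> / 2)) * exp (- (\<i> * of_real pi * s / 2)) * (1 - exp (\<i> * of_real pi * s))"
    unfolding sin_eq_exp_times by (simp add: mult_ac)
  have "exp (reflect_exponent s) = exp (s * of_real (ln 2)) * exp ((s - 1) * of_real (ln pi)) * exp (Ln (\<i> / 2)) * exp (- (\<i> * of_real pi * s / 2)) * exp (ln_Gamma (1 - s))"
    unfolding reflect_exponent_def diff_conv_add_uminus by (simp only: exp_add)
  thus ?thesis unfolding zeta_reflect_def L G S by (simp only: mult_ac)
qed

lemma holomorphic_reflect_exponent: "reflect_exponent holomorphic_on {s. Re s < 0}"
proof -
  have "(ln_Gamma \<circ> (\<lambda>s. 1 - s)) holomorphic_on {s::complex. Re s < 0}"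
    by (rule holomorphic_on_compose_gen[of _ _ _ "{s. Re s > 0}"])
       (auto intro!: holomorphic_intros holomorphic_ln_Gamma simp: complex_nonpos_Reals_iff)
  hence "(\<lambda>s. ln_Gamma (1 - s)) holomorphic_on {s::complex. Re s < 0}" by (simp add: o_def)
  thus ?thesis unfolding reflect_exponent_def[abs_def] by (intro holomorphic_intros) auto
qed

lemma one_minus_exp_Re_pos:
  assumes "Im s > 0"
  shows "Re (1 - exp (\<i> * of_real pi * s)) > 0"
proof -
  have "norm (exp (\<i> * of_real pi * s)) < 1" using assms by (simp add: norm_exp_eq_Re)
  hence "Re (exp (\<i> * of_real pi * s)) < 1" using complex_Re_le_cmod le_less_trans by blast
  thus ?thesis by simp
qed

lemma zeta_reflect_nonzero: "Re s < 0 \<Longrightarrow> Im s > 0 \<Longrightarrow> zeta_reflect s \<noteq> 0"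
  using one_minus_exp_Re_pos[of s] zeta_series_nonzero[of "1 - s"] by (auto simp: zeta_reflect_factor)

lemma log_deriv_integral_riemann_zeta:
  assumes a: "a > 0"
  obtains K where "\<And>t0 t. 0 < t0 \<Longrightarrow> t0 \<le> t \<Longrightarrow>
    \<bar>Im (log_deriv_integral riemann_zeta (Complex (- a) t0) (Complex (- a) t)) -
      (ln (2 * pi) * (t - t0) + (Im (ln_Gamma (Complex (1 + a) (- t))) - Im (ln_Gamma (Complex (1 + a) (- t0)))))\<bar> \<le> K"
proof -
  let ?G = "\<lambda>t. Im (ln_Gamma (Complex (1 + a) (- t)))"
  obtain K where K: "\<And>u v. Re u = - a \<Longrightarrow> Re v = - a \<Longrightarrow> \<bar>Im (log_deriv_integral (\<lambda>s. zeta_series (1 - s)) u v)\<bar> \<le> K"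
    using log_deriv_integral_zeta_series[OF a] by blast
  show ?thesis
  proof
    fix t0 t :: real assume t: "0 < t0" "t0 \<le> t"
    define u v where "u = Complex (- a) t0" and "v = Complex (- a) t"
    define S where "S = {s. Re s < 0} \<inter> {s. Im s > 0}"
    have oS: "open S" unfolding S_def by (intro open_Int open_halfspace_Re_lt open_halfspace_Im_gt)
    have seg: "closed_segment u v \<subseteq> S"
      using t a by (auto simp: S_def u_def v_def closed_segment_same_Re closed_segment_eq_real_ivl)
    have "Re z = - a" if "z \<in> closed_segment u v" for z
      using that by (auto simp: u_def v_def closed_segment_same_Re)
    define f g h where "f = (\<lambda>s. exp (reflect_exponent s))" and "g = (\<lambda>s. 1 - exp (\<i> * of_real pi * s))"
      and "h = (\<lambda>s. zeta_series (1 - s))"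
    have hol: "f holomorphic_on S" "g holomorphic_on S" "h holomorphic_on S"
      unfolding f_def g_def h_def S_def
      by (auto intro!: holomorphic_intros holomorphic_on_subset[OF holomorphic_reflect_exponent] holomorphic_on_subset[OF holomorphic_zeta_series_reflected])
    have nz: "f z \<noteq> 0" "g z \<noteq> 0" "h z \<noteq> 0" if "z \<in> closed_segment u v" for z
    proof -
      have "z \<in> S" using that seg by blast
      thus "g z \<noteq> 0" "h z \<noteq> 0" using one_minus_exp_Re_pos[of z] zeta_series_nonzero[of "1 - z"]
        by (auto simp: g_def h_def S_def)
    qed (simp add: f_def)
    have eq: "riemann_zeta s = f s * (g s * h s)" if "s \<in> S" for s
      using that by (simp add: S_def riemann_zeta_eq_reflect zeta_reflect_factor f_def g_def h_def)
    have "log_deriv_integral riemann_zeta u v = log_deriv_integral (\<lambda>s. f s * (g s * h s)) u v"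
      by (rule log_deriv_integral_cong[OF oS seg eq])
    also have "\<dots> = log_deriv_integral f u v + log_deriv_integral (\<lambda>s. g s * h s) u v"
      by (rule log_deriv_integral_mult[OF hol(1) _ oS seg]) (use nz in \<open>auto intro!: holomorphic_intros hol\<close>)
    also have "log_deriv_integral (\<lambda>s. g s * h s) u v = log_deriv_integral g u v + log_deriv_integral h u v"
      by (rule log_deriv_integral_mult[OF hol(2,3) oS seg]) (use nz in auto)
    also have "log_deriv_integral f u v = reflect_exponent v - reflect_exponent u"
      by (rule log_deriv_integral_exp[OF _ oS seg]) 
         (auto simp: f_def S_def intro: holomorphic_on_subset[OF holomorphic_reflect_exponent])
    finally have dec: "Im (log_deriv_integral riemann_zeta u v) = Im (reflect_exponent v - reflect_exponent u) + (Im (log_deriv_integral g u v) + Im (log_deriv_integral h u v))"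
      by simp
    have e: "1 - u = Complex (1 + a) (- t0)" "1 - v = Complex (1 + a) (- t)" by (simp_all add: u_def v_def complex_eq_iff)
    \<comment> \<open>The terms Ln(i/2) and -i pi s/2 drop out: their imaginary parts depend only on
      Re s, which is the same at both ends.\<close>
    have "Im (reflect_exponent v - reflect_exponent u) = (t - t0) * ln 2 + (t - t0) * ln pi + (Im (ln_Gamma (1 - v)) - Im (ln_Gamma (1 - u)))"
      by (simp add: reflect_exponent_def u_def v_def algebra_simps)
    also have "\<dots> = ln (2 * pi) * (t - t0) + (?G t - ?G t0)"
      unfolding e by (simp add: ln_mult algebra_simps)
    finally have 1: "Im (reflect_exponent v - reflect_exponent u) = \<dots>" .
    have 2: "\<bar>Im (log_deriv_integral g u v)\<bar> \<le> 2 * pi"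
    proof (rule log_deriv_integral_slit[OF hol(2) oS seg, of 1])
      fix z assume "z \<in> closed_segment u v"
      hence "Re (g z) > 0" using seg one_minus_exp_Re_pos[of z] by (auto simp: g_def S_def)
      thus "1 * g z \<notin> \<real>\<^sub>\<le>\<^sub>0" by (auto simp: complex_nonpos_Reals_iff)
    qed simp
    have 3: "\<bar>Im (log_deriv_integral h u v)\<bar> \<le> K" unfolding h_def by (rule K) (simp_all add: u_def v_def)
    show "\<bar>Im (log_deriv_integral riemann_zeta (Complex (- a) t0) (Complex (- a) t)) -
      (ln (2 * pi) * (t - t0) + (?G t - ?G t0))\<bar> \<le> 2 * pi + K"
      using dec 1 2 3 unfolding u_def v_def by linarith
  qed
qed

section \<open>Domination of E by zeta on the left edge\<close>

lemma norm_sin_ge_exp: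
  assumes "Im w \<ge> 1"
  shows "norm (sin w :: complex) \<ge> exp (Im w) / 4"
proof -
  have "exp (Im w) \<ge> 1 + Im w" by (rule exp_ge_add_one_self)
  moreover have "exp (- Im w) \<le> 1" using assms by simp
  ultimately have 1: "exp (- Im w) \<le> exp (Im w) / 2" using assms by argo
  have "norm (exp (- (\<i> * w)) - exp (\<i> * w)) \<ge> norm (exp (- (\<i> * w))) - norm (exp (\<i> * w))"
    by (rule norm_triangle_ineq2)
  hence "norm (exp (- (\<i> * w)) - exp (\<i> * w)) \<ge> exp (Im w) - exp (- Im w)" by (simp add: norm_exp_eq_Re)
  moreover have "norm (sin w) = norm (exp (- (\<i> * w)) - exp (\<i> * w)) / 2"
    unfolding sin_exp_eq' by (simp add: norm_mult norm_divide)
  ultimately show ?thesis using 1 by argo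
qed

text \<open>The growth exp(pi t/2) of the sine cancels the exponential decay of Gamma(5/4 - it).
  Comparing with the line Re = 1 gives sqrt t instead of the true order t^(3/4), but any unbounded
  lower bound beats the bounded E.\<close>

lemma riemann_zeta_left_line_lower_bound:
  obtains k where "k > 0" "\<And>t. t \<ge> 9 \<Longrightarrow> norm (riemann_zeta (Complex (- (1/4)) t)) \<ge> k * sqrt t"
proof -
  obtain c where c: "c > 0" "\<And>w. Re w \<ge> 5/4 \<Longrightarrow> norm (zeta_series w) \<ge> c"
    using zeta_series_lower_bound[of "5/4"] by auto
  define k where "k = 2 powr (- (1/4)) * pi powr (- (1/4) - 1) * (1 / 4) * sqrt pi * c"
  show ?thesis
  proof
    show "k > 0" using c by (simp add: k_def)
    fix t :: real assume t: "t \<ge> 9"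
    define s where "s = Complex (- (1/4)) t"
    have e: "1 - s = Complex (5/4) (- t)" by (simp add: s_def complex_eq_iff)
    have "Im (of_real pi * s / 2) = pi * t / 2" by (simp add: s_def)
    moreover have "pi * t / 2 \<ge> 1" using pi_ge_two t mult_mono[of 2 pi 9 t] by simp
    ultimately have 1: "norm (sin (of_real pi * s / 2)) \<ge> exp (pi * t / 2) / 4"
      using norm_sin_ge_exp[of "of_real pi * s / 2"] by simp
    have 2: "norm (Gamma (1 - s)) \<ge> sqrt (pi * t) * exp (- (pi * t / 2))"
      unfolding e by (rule norm_Gamma_five_fourths_line[OF t])
    have 3: "norm (zeta_series (1 - s)) \<ge> c" by (rule c(2)) (simp add: s_def)
    have 4: "norm ((2::complex) powr s) = 2 powr (- (1/4))" by (subst norm_powr_real_powr) (auto simp: s_def)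
    have 5: "norm (of_real pi powr (s - 1)) = pi powr (- (1/4) - 1)" by (subst norm_powr_real_powr) (auto simp: s_def)
    have "k * sqrt t = 2 powr (- (1/4)) * pi powr (- (1/4) - 1) * (exp (pi * t / 2) / 4) * (sqrt (pi * t) * exp (- (pi * t / 2))) * c"
    proof -
      have "exp (pi * t / 2) * exp (- (pi * t / 2)) = 1" by (simp add: exp_minus)
      hence "(exp (pi * t / 2) / 4) * (sqrt (pi * t) * exp (- (pi * t / 2))) = 1 / 4 * (sqrt pi * sqrt t)"
        by (simp add: real_sqrt_mult)
      thus ?thesis by (simp add: k_def mult.assoc mult.commute mult.left_commute)
    qed
    also have "\<dots> \<le> 2 powr (- (1/4)) * pi powr (- (1/4) - 1) * norm (sin (of_real pi * s / 2)) * norm (Gamma (1 - s)) * norm (zeta_series (1 - s))"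
      using 1 2 3 c(1) t by (intro mult_mono order.refl) auto
    also have "\<dots> = norm (zeta_reflect s)" unfolding zeta_reflect_def norm_mult 4 5 ..
    also have "zeta_reflect s = riemann_zeta s" by (simp add: riemann_zeta_eq_reflect s_def)
    finally show "k * sqrt t \<le> norm (riemann_zeta (Complex (- (1/4)) t))" by (simp add: s_def)
  qed
qed

theorem D_fun_left_edge:
  obtains T0 K where "T0 \<ge> 9" "\<And>t. t \<ge> T0 \<Longrightarrow> D_fun (Complex (- (1/4)) t) \<noteq> 0"
    "\<And>t0 t. T0 \<le> t0 \<Longrightarrow> t0 \<le> t \<Longrightarrow>
      \<bar>Im (log_deriv_integral D_fun (Complex (- (1/4)) t0) (Complex (- (1/4)) t)) +
        ((t * ln t - t - ln (2 * pi) * t) - (t0 * ln t0 - t0 - ln (2 * pi) * t0))\<bar> \<le> K + 9 * (ln t - ln t0)"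
proof -
  let ?s = "Complex (- (1/4))"
  obtain k where k: "k > 0" "\<And>t. t \<ge> 9 \<Longrightarrow> norm (riemann_zeta (?s t)) \<ge> k * sqrt t"
    using riemann_zeta_left_line_lower_bound by blast
  obtain K where K: "\<And>t0 t. 0 < t0 \<Longrightarrow> t0 \<le> t \<Longrightarrow>
    \<bar>Im (log_deriv_integral riemann_zeta (?s t0) (?s t)) -
      (ln (2 * pi) * (t - t0) + (Im (ln_Gamma (Complex (1 + 1/4) (- t))) - Im (ln_Gamma (Complex (1 + 1/4) (- t0)))))\<bar> \<le> K"
    using log_deriv_integral_riemann_zeta[of "1/4"] by auto
  \<comment> \<open>From t >= M^2 on, |zeta| >= k sqrt t >= k M = 4 zeta(2), twice the bound 2
    zeta(2) on |E|, so the quotient E/zeta has modulus at most 1/2.\<close>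
  define M where "M = 4 * zeta_even 0 / k"
  have a0: "zeta_even 0 \<ge> 1" by (rule zeta_even_ge_1)
  have M: "M > 0" using k a0 by (simp add: M_def)
  define T0 where "T0 = max 9 (M\<^sup>2)"
  have ratio: "riemann_zeta (?s t) \<noteq> 0 \<and> norm (E_fun (?s t) / riemann_zeta (?s t)) \<le> 1 / 2"
    if t: "t \<ge> T0" for t
  proof -
    have "M = sqrt (M\<^sup>2)" using M by simp
    also have "\<dots> \<le> sqrt t" using t by (intro real_sqrt_le_mono) (simp add: T0_def)
    finally have "k * M \<le> k * sqrt t" using k by simp
    hence "4 * zeta_even 0 \<le> k * sqrt t" using k by (simp add: M_def)
    also have "\<dots> \<le> norm (riemann_zeta (?s t))" using t by (intro k(2)) (simp add: T0_def)
    finally have z: "4 * zeta_even 0 \<le> norm (riemann_zeta (?s t))" .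
    have "norm (E_fun (?s t)) \<le> 2 * zeta_even 0" by (rule norm_E_fun_le) simp
    hence "norm (E_fun (?s t)) \<le> norm (riemann_zeta (?s t)) / 2" using z by argo
    moreover have "norm (riemann_zeta (?s t)) > 0" using z a0 by linarith
    ultimately show ?thesis by (simp add: norm_divide field_simps)
  qed
  have factor: "Re (1 + E_fun (?s t) / riemann_zeta (?s t)) > 0" if "t \<ge> T0" for t
    using ratio[OF that] abs_Re_le_cmod[of "E_fun (?s t) / riemann_zeta (?s t)"]
    by (simp add: abs_le_iff)
  show ?thesis
  proof
    show "T0 \<ge> 9" by (simp add: T0_def)
    show "D_fun (?s t) \<noteq> 0" if "t \<ge> T0" for t
    proof
      assume "D_fun (?s t) = 0"
      hence "E_fun (?s t) = - riemann_zeta (?s t)"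
        unfolding D_fun_def by (metis add.commute add_eq_0_iff)
      thus False using ratio[OF that, THEN conjunct1] ratio[OF that, THEN conjunct2] by simp
    qed
    fix t0 t assume t: "T0 \<le> t0" "t0 \<le> t"
    define u v where "u = ?s t0" and "v = ?s t"
    have t0: "t0 \<ge> 9" using t by (simp add: T0_def)
    define S where "S = {s. -1 < Re s} \<inter> {s. Re s < 0} \<inter> {s. Im s > 0}"
    have oS: "open S" unfolding S_def by (intro open_Int open_halfspace_Re_gt open_halfspace_Re_lt open_halfspace_Im_gt)
    have segz: "\<exists>x. z = ?s x \<and> x \<ge> T0" if "z \<in> closed_segment u v" for z
    proof -
      have "Re z = - (1/4) \<and> Im z \<in> {t0..t}"
        using that t by (auto simp: u_def v_def closed_segment_same_Re closed_segment_eq_real_ivl)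
      thus ?thesis using t by (intro exI[of _ "Im z"]) (auto simp: complex_eq_iff)
    qed
    have seg: "closed_segment u v \<subseteq> S"
    proof
      fix z assume "z \<in> closed_segment u v"
      thus "z \<in> S" using segz[of z] by (auto simp: S_def T0_def)
    qed
    have hz: "riemann_zeta holomorphic_on S"
      by (rule holomorphic_on_subset[OF holomorphic_riemann_zeta]) (auto simp: S_def)
    have he: "E_fun holomorphic_on S"
      by (rule holomorphic_on_subset[OF holomorphic_E_fun]) (auto simp: S_def)
    have nz: "riemann_zeta s \<noteq> 0" if "s \<in> S" for s
      using that zeta_reflect_nonzero[of s] by (simp add: S_def riemann_zeta_eq_reflect)
    have hq: "(\<lambda>s. 1 + E_fun s / riemann_zeta s) holomorphic_on S"
      by (intro holomorphic_intros hz he nz)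
    have pos: "Re (1 + E_fun z / riemann_zeta z) > 0" if "z \<in> closed_segment u v" for z
      using segz[OF that] factor by auto
    have "log_deriv_integral D_fun u v = log_deriv_integral (\<lambda>s. riemann_zeta s * (1 + E_fun s / riemann_zeta s)) u v"
      by (rule log_deriv_integral_cong[OF oS seg]) (use nz in \<open>simp add: D_fun_def field_simps\<close>)
    also have "\<dots> = log_deriv_integral riemann_zeta u v + log_deriv_integral (\<lambda>s. 1 + E_fun s / riemann_zeta s) u v"
    proof (rule log_deriv_integral_mult[OF hz hq oS seg])
      show "riemann_zeta z \<noteq> 0" if "z \<in> closed_segment u v" for z using that seg nz by blast
      show "1 + E_fun z / riemann_zeta z \<noteq> 0" if "z \<in> closed_segment u v" for z
        using pos[OF that] by (metis less_irrefl zero_complex.sel(1))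
    qed
    finally have dec: "Im (log_deriv_integral D_fun u v) = Im (log_deriv_integral riemann_zeta u v) + Im (log_deriv_integral (\<lambda>s. 1 + E_fun s / riemann_zeta s) u v)"
      by simp
    have 1: "\<bar>Im (log_deriv_integral (\<lambda>s. 1 + E_fun s / riemann_zeta s) u v)\<bar> \<le> 2 * pi"
    proof (rule log_deriv_integral_slit[OF hq oS seg, of 1])
      fix z assume "z \<in> closed_segment u v"
      from pos[OF this] show "1 * (1 + E_fun z / riemann_zeta z) \<notin> \<real>\<^sub>\<le>\<^sub>0" by (auto simp: complex_nonpos_Reals_iff)
    qed simp
    have 2: "\<bar>Im (log_deriv_integral riemann_zeta u v) -
      (ln (2 * pi) * (t - t0) + (Im (ln_Gamma (Complex (5/4) (- t))) - Im (ln_Gamma (Complex (5/4) (- t0)))))\<bar> \<le> K"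
      using K[of t0 t] t0 t by (simp add: u_def v_def)
    have 3: "\<bar>(Im (ln_Gamma (Complex (5/4) (- t))) + (t * ln t - t)) - (Im (ln_Gamma (Complex (5/4) (- t0))) + (t0 * ln t0 - t0))\<bar> \<le> 9 * (ln t - ln t0)"
      by (rule Im_ln_Gamma_asymp) (use t0 t in auto)
    have 4: "ln (2 * pi) * (t - t0) = ln (2 * pi) * t - ln (2 * pi) * t0" by (simp add: algebra_simps)
    show "\<bar>Im (log_deriv_integral D_fun (?s t0) (?s t)) +
        ((t * ln t - t - ln (2 * pi) * t) - (t0 * ln t0 - t0 - ln (2 * pi) * t0))\<bar> \<le> (K + 2 * pi) + 9 * (ln t - ln t0)"
      using dec 1 2 3 4 unfolding u_def v_def by linarith
  qed
qed

section \<open>Counting zeros\<close>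

text \<open>The compact box reaches down to the real axis and may contain the pole, so the zeros are
  located among those of (s - 1) D(s), which is holomorphic throughout.\<close>

lemma finite_zeros_rectangle:
  assumes "a > -1"
  shows "finite {s. D_fun s = 0 \<and> a \<le> Re s \<and> Re s \<le> b \<and> 0 < Im s \<and> Im s \<le> t}"
proof (rule finite_subset)
  define K where "K = cbox (Complex a 0) (Complex b t)"
  show "finite {z \<in> K. pole_free_D z = 0}"
  proof (rule holomorphic_compact_finite_zeros[OF holomorphic_pole_free_D])
    show "open {s. - 1 < Re s}" by (rule open_halfspace_Re_gt)
    show "connected {s. - 1 < Re s}" by (intro convex_connected convex_halfspace_Re_gt)
    show "compact K" unfolding K_def by (rule compact_cbox)
    show "K \<subseteq> {s. - 1 < Re s}" using assms by (auto simp: K_def in_cbox_complex_iff)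
    show "\<not> pole_free_D constant_on {s. - 1 < Re s}"
    proof
      assume "pole_free_D constant_on {s. - 1 < Re s}"
      then obtain c where c: "\<And>s. Re s > -1 \<Longrightarrow> pole_free_D s = c" unfolding constant_on_def by blast
      hence "c = 1" using pole_free_D_1 c[of 1] by simp
      text \<open>Otherwise $D(\sigma)=1/(\sigma-1)$, contradicting $D(\sigma)\ge\zeta(2)$ for large $\sigma$.\<close>
      define x where "x = max 3 (sigma0 + 1)"
      have x: "x > sigma0" "x \<ge> 3" by (auto simp: x_def)
      have "norm (D_fun (of_real x) - of_real (zeta_even 0)) \<le> D_tail x"
        using norm_D_fun_minus_le[of "of_real x"] x by simp
      have "(of_real x - 1) * D_fun (of_real x) = 1"
        using c[of "of_real x"] \<open>c = 1\<close> x pole_free_D_eq[of "of_real x"] by (auto simp: complex_eq_iff)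
      moreover have "D_fun (of_real x) = of_real (zeta_even 0 + D_tail x)" using x by (intro D_fun_of_real) simp
      ultimately have "complex_of_real ((x - 1) * (zeta_even 0 + D_tail x)) = of_real 1" by simp
      hence "(x - 1) * (zeta_even 0 + D_tail x) = 1" by (simp only: of_real_eq_iff)
      moreover have "D_tail x \<ge> 0" unfolding D_tail_def
      proof (rule suminf_nonneg[OF summable_D_tail])
        show "0 \<le> zeta_even (Suc n) * real (Suc (Suc n)) powr - x" for n
          using zeta_even_ge_1[of "Suc n"] by (intro mult_nonneg_nonneg) auto
      qed (use x in simp)
      hence "2 * 1 \<le> (x - 1) * (zeta_even 0 + D_tail x)"
        using x zeta_even_ge_1[of 0] by (intro mult_mono) auto
      ultimately show False by simp
    qed
  qed
  show "{s. D_fun s = 0 \<and> a \<le> Re s \<and> Re s \<le> b \<and> 0 < Im s \<and> Im s \<le> t} \<subseteq> {z \<in> K. pole_free_D z = 0}"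
  proof safe
    fix s assume s: "D_fun s = 0" "a \<le> Re s" "Re s \<le> b" "0 < Im s" "Im s \<le> t"
    show "s \<in> K" using s by (auto simp: K_def in_cbox_complex_iff)
    have "s \<noteq> 1" using s by auto
    thus "pole_free_D s = 0" using s assms pole_free_D_eq[of s] by simp
  qed
qed

text \<open>The top and left edges are reversed, so that every edge is traversed in the direction of
  increasing coordinate used by the edge estimates.\<close>

lemma log_deriv_integral_rectpath:
  assumes "f holomorphic_on S" "open S" "path_image (rectpath a1 a3) \<subseteq> S" 
    and "\<And>z. z \<in> path_image (rectpath a1 a3) \<Longrightarrow> f z \<noteq> 0"
  defines "a2 \<equiv> Complex (Re a3) (Im a1)" and "a4 \<equiv> Complex (Re a1) (Im a3)"
  shows "contour_integral (rectpath a1 a3) (\<lambda>z. deriv f z / f z) =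
    log_deriv_integral f a1 a2 + log_deriv_integral f a2 a3 - log_deriv_integral f a4 a3 - log_deriv_integral f a1 a4"
proof -
  let ?d = "\<lambda>z. deriv f z / f z"
  have R: "rectpath a1 a3 = linepath a1 a2 +++ linepath a2 a3 +++ linepath a3 a4 +++ linepath a4 a1"
    by (simp add: rectpath_def a2_def a4_def Let_def)
  have P: "path_image (rectpath a1 a3) = closed_segment a1 a2 \<union> closed_segment a2 a3 \<union> closed_segment a3 a4 \<union> closed_segment a4 a1"
    unfolding R by (simp add: path_image_join Un_assoc)
  have int: "?d contour_integrable_on linepath u v" if "closed_segment u v \<subseteq> path_image (rectpath a1 a3)" for u v
    by (rule log_deriv_integrable[of _ S]) (use assms that in auto)
  have cont: "continuous_on (closed_segment u v) ?d" if "closed_segment u v \<subseteq> path_image (rectpath a1 a3)" for u v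
  proof -
    have "continuous_on S (deriv f)" "continuous_on S f"
      using assms by (auto intro!: holomorphic_on_imp_continuous_on holomorphic_deriv)
    thus ?thesis using assms that by (intro continuous_intros) (auto elim!: continuous_on_subset)
  qed
  have ints: "?d contour_integrable_on linepath a1 a2" "?d contour_integrable_on linepath a2 a3"
      "?d contour_integrable_on linepath a3 a4" "?d contour_integrable_on linepath a4 a1"
    by (rule int, use P in blast)+
  have "contour_integral (rectpath a1 a3) ?d = log_deriv_integral f a1 a2 + (log_deriv_integral f a2 a3 + (log_deriv_integral f a3 a4 + log_deriv_integral f a4 a1))"
    unfolding R log_deriv_integral_def using ints
    by (simp add: contour_integrable_join)
  also have "log_deriv_integral f a3 a4 = - log_deriv_integral f a4 a3"
    unfolding log_deriv_integral_def by (rule contour_integral_reverse_linepath, rule cont) (use P in blast)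
  also have "log_deriv_integral f a4 a1 = - log_deriv_integral f a1 a4"
    unfolding log_deriv_integral_def by (rule contour_integral_reverse_linepath, rule cont) (use P in blast)
  finally show ?thesis by simp
qed

text \<open>Argument principle between the heights t0 and t. The hypotheses keep zeros off three
  edges; on the right edge none can occur because b > sigma0.\<close>

lemma D_fun_zero_count_rectangle:
  assumes t: "0 < t0" "t0 < t" and b: "b > sigma0"
    and nz: "\<And>s. D_fun s = 0 \<Longrightarrow> - (1/4) \<le> Re s \<Longrightarrow> Re s \<le> b \<Longrightarrow> Im s \<noteq> t0 \<and> Im s \<noteq> t"
    and left: "\<And>y. t0 \<le> y \<Longrightarrow> y \<le> t \<Longrightarrow> D_fun (Complex (- (1/4)) y) \<noteq> 0"
  shows "2 * pi * real_of_int (N_D t - N_D t0) =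
     Im (log_deriv_integral D_fun (Complex (- (1/4)) t0) (Complex b t0)) + Im (log_deriv_integral D_fun (Complex b t0) (Complex b t))
     - Im (log_deriv_integral D_fun (Complex (- (1/4)) t) (Complex b t)) - Im (log_deriv_integral D_fun (Complex (- (1/4)) t0) (Complex (- (1/4)) t))"
proof -
  define a1 a3 where "a1 = Complex (- (1/4)) t0" and "a3 = Complex b t"
  let ?W = "winding_number (rectpath a1 a3)"
  let ?P = "path_image (rectpath a1 a3)"
  have b1: "b > 1" using b sigma0_props by simp
  \<comment> \<open>An open convex neighbourhood of the closed rectangle. Its lower side at t0/2 > 0
    keeps it away from the pole; zeros of D in it outside the rectangle have winding number
    0.\<close>
  define S where "S = box (Complex (- (1/2)) (t0 / 2)) (Complex (b + 1) (t + 1))"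
  have S: "s \<in> S \<longleftrightarrow> - (1/2) < Re s \<and> Re s < b + 1 \<and> t0 / 2 < Im s \<and> Im s < t + 1" for s
    by (simp add: S_def in_box_complex_iff)
  have hol: "D_fun holomorphic_on S"
    by (rule holomorphic_on_subset[OF holomorphic_D_fun]) (use t in \<open>auto simp: S\<close>)
  define Z where "Z = {s \<in> S. D_fun s = 0}"
  have finZ: "finite Z"
    by (rule finite_subset[OF _ finite_zeros_rectangle[of "- (1/2)" "b + 1" "t + 1"]]) (use t in \<open>auto simp: Z_def S\<close>)
  have pi: "?P = {z. Re z \<in> {- (1/4), b} \<and> Im z \<in> {t0..t}} \<union> {z. Im z \<in> {t0, t} \<and> Re z \<in> {- (1/4)..b}}"
    using path_image_rectpath[of a1 a3] t b1 by (simp add: a1_def a3_def)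
  have piS: "?P \<subseteq> S"
    unfolding pi using t b1 by (auto simp: S)
  have nzp: "D_fun z \<noteq> 0" if "z \<in> ?P" for z
  proof
    assume z: "D_fun z = 0"
    from that consider "Re z = - (1/4)" "Im z \<in> {t0..t}" | "Re z = b" | "Im z \<in> {t0, t}" "- (1/4) \<le> Re z" "Re z \<le> b"
      unfolding pi by auto
    thus False
    proof cases
      case 1
      hence "z = Complex (- (1/4)) (Im z)" by (simp add: complex_eq_iff)
      thus False using left[of "Im z"] 1 z by auto
    next
      case 2
      thus False using D_fun_nonzero[of z] b z by simp
    next
      case 3
      thus False using nz[OF z] by auto
    qed
  qed
  have "contour_integral (rectpath a1 a3) (\<lambda>x. deriv D_fun x * 1 / D_fun x) = 2 * pi * \<i> *
     (\<Sum>p\<in>{w \<in> S. D_fun w = 0 \<or> w \<in> {}}. ?W p * 1 * zorder D_fun p)"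
  proof (rule argument_principle[where h = "\<lambda>_. 1"])
    show "connected S" unfolding S_def by (intro convex_connected convex_box)
    show "?P \<subseteq> S - {w \<in> S. D_fun w = 0 \<or> w \<in> {}}" using piS nzp by auto
    show "\<forall>z. z \<notin> S \<longrightarrow> ?W z = 0"
    proof safe
      fix z assume "z \<notin> S"
      hence "z \<notin> cbox a1 a3" using t b1 by (auto simp: S a1_def a3_def in_cbox_complex_iff)
      thus "?W z = 0"
        using t b1 by (intro winding_number_rectpath_outside) (auto simp: a1_def a3_def)
    qed
    show "finite {w \<in> S. D_fun w = 0 \<or> w \<in> {}}" using finZ by (simp add: Z_def)
  qed (use hol in \<open>auto simp: S_def open_box\<close>)
  also have "{w \<in> S. D_fun w = 0 \<or> w \<in> {}} = Z" by (simp add: Z_def)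
  also have "(\<Sum>p\<in>Z. ?W p * 1 * zorder D_fun p) = (\<Sum>p\<in>Z \<inter> box a1 a3. of_int (zorder D_fun p))"
  proof (rule sum.mono_neutral_cong_right)
    show "\<forall>p\<in>Z - Z \<inter> box a1 a3. ?W p * 1 * of_int (zorder D_fun p) = 0"
    proof
      fix p assume p: "p \<in> Z - Z \<inter> box a1 a3"
      hence "p \<notin> ?P" using nzp[of p] by (auto simp: Z_def)
      hence "p \<notin> cbox a1 a3" using p path_image_rectpath_cbox_minus_box[of a1 a3] t b1 by (auto simp: a1_def a3_def)
      hence "?W p = 0"
        using t b1 by (intro winding_number_rectpath_outside) (auto simp: a1_def a3_def)
      thus "?W p * 1 * of_int (zorder D_fun p) = 0" by simp
    qed
    show "?W p * 1 * of_int (zorder D_fun p) = of_int (zorder D_fun p)" if "p \<in> Z \<inter> box a1 a3" for p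
      using winding_number_rectpath[of p a1 a3] that by simp
  qed (use finZ in auto)
  \<comment> \<open>Widening the strip from sigma0 to b adds no zeros, and the half-open range t0 <
    Im s <= t agrees with the open one since no zero has ordinate t.\<close>
  also have "Z \<inter> box a1 a3 = D_zeros t - D_zeros t0"
  proof (intro subset_antisym subsetI)
    fix s assume s: "s \<in> Z \<inter> box a1 a3"
    hence "Re s \<le> sigma0" using D_fun_nonzero[of s] by (force simp: Z_def)
    thus "s \<in> D_zeros t - D_zeros t0" using s t by (auto simp: Z_def D_zeros_def a1_def a3_def in_box_complex_iff)
  next
    fix s assume s: "s \<in> D_zeros t - D_zeros t0"
    hence s': "D_fun s = 0" "- (1/4) \<le> Re s" "Re s < b" "t0 < Im s" "Im s \<le> t" using b by (auto simp: D_zeros_def)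
    have "Im s \<noteq> t" using nz[of s] s' by auto
    moreover have "Re s \<noteq> - (1/4)"
    proof
      assume "Re s = - (1/4)"
      hence "s = Complex (- (1/4)) (Im s)" by (simp add: complex_eq_iff)
      thus False using left[of "Im s"] s' by auto
    qed
    ultimately show "s \<in> Z \<inter> box a1 a3" using s' t b1 by (auto simp: Z_def S a1_def a3_def in_box_complex_iff)
  qed
  also have "(\<Sum>p\<in>D_zeros t - D_zeros t0. of_int (zorder D_fun p)) = complex_of_int (N_D t - N_D t0)"
  proof -
    have sub: "D_zeros t0 \<subseteq> D_zeros t" using t by (auto simp: D_zeros_def)
    have fin: "finite (D_zeros t)" unfolding D_zeros_def by (rule finite_zeros_rectangle) simp
    have "(\<Sum>p\<in>D_zeros t - D_zeros t0. zorder D_fun p) = N_D t - N_D t0"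
      unfolding N_D_def by (rule sum_diff[OF fin sub])
    thus ?thesis by (metis of_int_sum)
  qed
  finally have "contour_integral (rectpath a1 a3) (\<lambda>x. deriv D_fun x / D_fun x) = 2 * pi * \<i> * of_int (N_D t - N_D t0)" by simp
  hence "2 * pi * real_of_int (N_D t - N_D t0) = Im (contour_integral (rectpath a1 a3) (\<lambda>x. deriv D_fun x / D_fun x))" by simp
  also have "contour_integral (rectpath a1 a3) (\<lambda>x. deriv D_fun x / D_fun x) = 
    log_deriv_integral D_fun a1 (Complex (Re a3) (Im a1)) + log_deriv_integral D_fun (Complex (Re a3) (Im a1)) a3
     - log_deriv_integral D_fun (Complex (Re a1) (Im a3)) a3 - log_deriv_integral D_fun a1 (Complex (Re a1) (Im a3))"
    by (rule log_deriv_integral_rectpath[OF hol _ piS nzp]) (auto simp: S_def open_box)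
  finally show ?thesis by (simp add: a1_def a3_def)
qed

lemma D_fun_right_edge:
  assumes b: "b > sigma0"
  shows "\<bar>Im (log_deriv_integral D_fun (Complex b t0) (Complex b t))\<bar> \<le> 2 * pi"
proof (rule log_deriv_integral_slit[of _ "{s. Re s > 1}" _ _ 1])
  have b1: "b > 1" using b sigma0_props by simp
  have seg: "Re z = b" if "z \<in> closed_segment (Complex b t0) (Complex b t)" for z
    using that by (auto simp: closed_segment_same_Re)
  show "D_fun holomorphic_on {s. Re s > 1}" by (rule holomorphic_on_subset[OF holomorphic_D_fun]) auto
  show "open {s. Re s > 1}" by (rule open_halfspace_Re_gt)
  show "closed_segment (Complex b t0) (Complex b t) \<subseteq> {s. Re s > 1}" using seg b1 by auto
  fix z assume z: "z \<in> closed_segment (Complex b t0) (Complex b t)"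
  obtain m where m: "m > 0" "\<And>s. Re s \<ge> b \<Longrightarrow> Re (D_fun s) \<ge> m" using Re_D_fun_pos[OF b] by blast
  have "Re (D_fun z) > 0" using m(1) m(2)[of z] seg[OF z] by simp
  thus "1 * D_fun z \<notin> \<real>\<^sub>\<le>\<^sub>0" by (auto simp: complex_nonpos_Reals_iff)
qed simp

lemma D_fun_top_edge:
  assumes b: "b > sigma0"
  obtains K2 K1 where "K2 \<ge> 0" "\<forall>t\<ge>b + 2. (\<forall>x. - (1/4) \<le> x \<longrightarrow> x \<le> b \<longrightarrow> D_fun (Complex x t) \<noteq> 0) \<longrightarrow>
     \<bar>Im (log_deriv_integral D_fun (Complex (- (1/4)) t) (Complex b t))\<bar> \<le> K1 + K2 * ln t"
proof -
  let ?c = "Complex (- (1/4))"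
  have b1: "b > 1" using b sigma0_props by simp
  obtain m where m: "m > 0" "\<And>s. Re s \<ge> b \<Longrightarrow> Re (D_fun s) \<ge> m" using Re_D_fun_pos[OF b] by blast
  obtain C where C: "C > 0" "\<And>s. Re s \<ge> -1/2 \<Longrightarrow> \<bar>Im s\<bar> \<ge> 1 \<Longrightarrow> norm (D_fun s) \<le> C * (1 + norm s) ^ 3"
    using norm_D_fun_le by blast
  \<comment> \<open>The inner radius is the length b + 1/4 of the edge. The two outer radii lie
    strictly between b + 1/4 and b + 1/2, so the discs stay in Re s > -1/2; for t >= b + 2 they also
    stay in Im s > 1, where D is polynomially bounded.\<close>
  define r R R' where "r = b - (- (1/4))" and "R = b + 3/8" and "R' = b + 7/16"
  have rR: "0 < r" "r < R" "R < R'" using b1 by (auto simp: r_def R_def R'_def)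
  define A where "A = C * (2 + b + R) ^ 3"
  have A: "A > 0" using C b1 by (auto simp: A_def R_def intro!: mult_pos_pos zero_less_power)
  define L where "L = ln (R / r)"
  have L: "L > 0" using rR by (simp add: L_def)
  show ?thesis
  proof (rule that)
    show "3 * (2 * pi) / L \<ge> 0" using L by simp
    show "\<forall>t\<ge>b + 2. (\<forall>x. - (1/4) \<le> x \<longrightarrow> x \<le> b \<longrightarrow> D_fun (Complex x t) \<noteq> 0) \<longrightarrow>
      \<bar>Im (log_deriv_integral D_fun (?c t) (Complex b t))\<bar> \<le> (ln (A / m) / L + 1) * (2 * pi) + 3 * (2 * pi) / L * ln t"
    proof (intro allI impI)
      fix t assume t: "t \<ge> b + 2" and nz: "\<forall>x. - (1/4) \<le> x \<longrightarrow> x \<le> b \<longrightarrow> D_fun (Complex x t) \<noteq> 0"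
      have t0: "t \<ge> 1" using t b1 by simp
      have "\<bar>Im (log_deriv_integral D_fun (?c t) (Complex b t))\<bar> \<le> (ln (A * t ^ 3 / m) / ln (R / (b - (- (1/4)))) + 1) * (2 * pi)"
      proof (rule log_deriv_integral_horizontal[of D_fun b t R'])
        show "D_fun holomorphic_on ball (Complex b t) R'"
        proof (rule holomorphic_on_subset[OF holomorphic_D_fun], rule subsetI)
          fix z assume z: "z \<in> ball (Complex b t) R'"
          have "norm (Complex b t - z) < R'" using z by (simp add: dist_norm)
          hence "\<bar>Re (Complex b t - z)\<bar> < R'" "\<bar>Im (Complex b t - z)\<bar> < R'"
            using abs_Re_le_cmod abs_Im_le_cmod le_less_trans by blast+
          hence "b - Re z < R'" "t - Im z < R'" by auto
          hence "-1 < Re z" "0 < Im z" using t by (auto simp: R'_def)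
          thus "z \<in> {s. -1 < Re s} - {1}" by auto
        qed
        show "norm (D_fun z) \<le> A * t ^ 3" if z: "norm (z - Complex b t) = R" for z
        proof -
          have "norm (Complex b t - z) \<le> R" using z by (simp add: norm_minus_commute)
          hence "\<bar>Re (Complex b t - z)\<bar> \<le> R" "\<bar>Im (Complex b t - z)\<bar> \<le> R"
            using abs_Re_le_cmod abs_Im_le_cmod order_trans by blast+
          hence "b - Re z \<le> R" "t - Im z \<le> R" by auto
          hence zz: "Re z \<ge> -1/2" "Im z \<ge> 1" using t by (auto simp: R_def)
          have "norm z \<le> norm (Complex b t) + R" using z norm_triangle_sub[of z "Complex b t"] by simp
          also have "norm (Complex b t) \<le> b + t" using cmod_le[of "Complex b t"] b1 t0 by simp
          finally have "1 + norm z \<le> (1 + b + R) * 1 + t" by simp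
          also have "\<dots> \<le> (1 + b + R) * t + t" using t0 b1 rR by (intro add_right_mono mult_left_mono) auto
          also have "\<dots> = (2 + b + R) * t" by (simp add: algebra_simps)
          finally have "(1 + norm z) ^ 3 \<le> ((2 + b + R) * t) ^ 3" by (intro power_mono) auto
          hence "C * (1 + norm z) ^ 3 \<le> A * t ^ 3" using C(1) by (simp add: A_def power_mult_distrib mult.assoc)
          thus ?thesis using C(2)[of z] zz by simp
        qed
        show "m \<le> Re (D_fun (Complex b t))" by (rule m(2)) simp
      qed (use b1 rR m nz in \<open>auto simp: r_def\<close>)
      also have "ln (A * t ^ 3 / m) = ln (A / m) + 3 * ln t"
        using A m t0 by (simp add: ln_mult ln_div ln_realpow)
      also have "((ln (A / m) + 3 * ln t) / ln (R / (b - (- (1/4)))) + 1) * (2 * pi) = (ln (A / m) / L + 1) * (2 * pi) + 3 * (2 * pi) / L * ln t"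
        unfolding L_def r_def by (simp add: add_divide_distrib distrib_right)
      finally show "\<bar>Im (log_deriv_integral D_fun (?c t) (Complex b t))\<bar> \<le> (ln (A / m) / L + 1) * (2 * pi) + 3 * (2 * pi) / L * ln t" .
    qed
  qed
qed

text \<open>Only finitely many zeros of the strip lie below height t + 1, so there is a gap just
  above t, whether or not t is itself the ordinate of a zero.\<close>

lemma no_zeros_right_of:
  assumes "t > 0"
  shows "eventually (\<lambda>t'. \<forall>s. D_fun s = 0 \<longrightarrow> - (1/4) \<le> Re s \<longrightarrow> Re s \<le> b \<longrightarrow> \<not> (t < Im s \<and> Im s \<le> t')) (at_right t)"
proof -
  define Z where "Z = {s. D_fun s = 0 \<and> - (1/4) \<le> Re s \<and> Re s \<le> b \<and> 0 < Im s \<and> Im s \<le> t + 1}"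
  have fin: "finite Z" unfolding Z_def by (rule finite_zeros_rectangle) simp
  have "eventually (\<lambda>t'. \<forall>s\<in>Z. t < Im s \<longrightarrow> t' < Im s) (at_right t)"
    using fin
  proof (rule eventually_ball_finite, safe)
    fix s assume "s \<in> Z"
    show "\<forall>\<^sub>F t' in at_right t. t < Im s \<longrightarrow> t' < Im s"
    proof (cases "t < Im s")
      case True
      hence "eventually (\<lambda>t'. t' < Im s) (at_right t)" using eventually_at_right[of t] by blast
      thus ?thesis by eventually_elim simp
    qed simp
  qed
  moreover have "eventually (\<lambda>t'. t' < t + 1) (at_right t)" unfolding eventually_at_right_field by (intro exI[of _ "t + 1"]) auto
  ultimately show ?thesis
  proof eventually_elim
    case (elim t')
    show ?case
    proof safe
      fix s assume s: "D_fun s = 0" "- (1/4) \<le> Re s" "Re s \<le> b" "t < Im s" "Im s \<le> t'"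
      hence "s \<in> Z" using elim assms by (auto simp: Z_def)
      thus False using elim s by force
    qed
  qed
qed

lemma N_D_bound:
  obtains Q t1 P where "Q \<ge> 0" "\<forall>t>t1. \<bar>2 * pi * real_of_int (N_D t) - (t * ln t - t - ln (2 * pi) * t)\<bar> \<le> P + Q * ln t"
proof -
  let ?c = "Complex (- (1/4))"
  obtain T0 K where left: "T0 \<ge> 9" "\<And>t. t \<ge> T0 \<Longrightarrow> D_fun (?c t) \<noteq> 0"
    "\<And>t0 t. T0 \<le> t0 \<Longrightarrow> t0 \<le> t \<Longrightarrow>
      \<bar>Im (log_deriv_integral D_fun (?c t0) (?c t)) +
        ((t * ln t - t - ln (2 * pi) * t) - (t0 * ln t0 - t0 - ln (2 * pi) * t0))\<bar> \<le> K + 9 * (ln t - ln t0)"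
    using D_fun_left_edge by blast
  define b where "b = sigma0 + 1"
  have b: "b > sigma0" by (simp add: b_def)
  obtain K2 K1 where top: "K2 \<ge> 0" "\<forall>t\<ge>b + 2. (\<forall>x. - (1/4) \<le> x \<longrightarrow> x \<le> b \<longrightarrow> D_fun (Complex x t) \<noteq> 0) \<longrightarrow>
     \<bar>Im (log_deriv_integral D_fun (?c t) (Complex b t))\<bar> \<le> K1 + K2 * ln t"
    by (rule D_fun_top_edge[OF b]) (rule that)
  define f where "f = (\<lambda>t. t * ln t - t - ln (2 * pi) * t)"
  define good where "good = (\<lambda>t. \<forall>s. D_fun s = 0 \<longrightarrow> - (1/4) \<le> Re s \<longrightarrow> Re s \<le> b \<longrightarrow> Im s \<noteq> t)"
  have ev_good: "eventually (\<lambda>t'. t' > t \<and> good t' \<and> N_D t' = N_D t) (at_right t)" if t: "t > 0" for t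
    using no_zeros_right_of[OF t, of b] eventually_at_right_less[of t]
  proof eventually_elim
    case (elim t')
    have "good t'" using elim by (auto simp: good_def)
    moreover have "D_zeros t' = D_zeros t"
    proof (intro subset_antisym subsetI)
      fix s assume s: "s \<in> D_zeros t'"
      hence "\<not> (t < Im s \<and> Im s \<le> t')" using elim(1) b by (auto simp: D_zeros_def)
      thus "s \<in> D_zeros t" using s by (auto simp: D_zeros_def)
    qed (use elim in \<open>auto simp: D_zeros_def\<close>)
    ultimately show ?case using elim by (simp add: N_D_def)
  qed
  define tb where "tb = max T0 (b + 2)"
  have "tb > 0" using left(1) by (simp add: tb_def)
  \<comment> \<open>The base height is fixed once, beyond all thresholds and off the ordinates of
    zeros; the bottom edge and the zeros below it then contribute constants.\<close>
  from eventually_happens[OF ev_good[OF this]] obtain t0 where t0: "t0 > tb" "good t0" by auto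
  have t0': "t0 \<ge> T0" "t0 \<ge> b + 2" "t0 \<ge> 9" using t0 left(1) by (auto simp: tb_def)
  define B where "B = \<bar>Im (log_deriv_integral D_fun (?c t0) (Complex b t0))\<bar>"
  \<comment> \<open>P gathers what does not depend on t: the zeros up to t0, the bottom and right
    edges, the main term at t0 and the constants of the other two estimates. Q adds the logarithmic
    slopes of the top edge and of the left edge, the latter being 9.\<close>
  define P where "P = 2 * pi * \<bar>real_of_int (N_D t0)\<bar> + B + 2 * pi + K1 + \<bar>f t0\<bar> + K"
  define Q where "Q = K2 + 9"
  have bound: "\<bar>2 * pi * real_of_int (N_D t) - f t\<bar> \<le> P + Q * ln t" if t: "t > t0" "good t" for t
  proof -
    let ?L = "Im (log_deriv_integral D_fun (?c t0) (?c t))"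
    let ?T = "Im (log_deriv_integral D_fun (?c t) (Complex b t))"
    let ?R = "Im (log_deriv_integral D_fun (Complex b t0) (Complex b t))"
    let ?B = "Im (log_deriv_integral D_fun (?c t0) (Complex b t0))"
    have "2 * pi * real_of_int (N_D t - N_D t0) = ?B + ?R - ?T - ?L"
      by (rule D_fun_zero_count_rectangle) (use t t0 t0' b left(2) in \<open>auto simp: good_def\<close>)
    hence 1: "2 * pi * real_of_int (N_D t) = 2 * pi * real_of_int (N_D t0) + ?B + ?R - ?T - ?L"
      by (simp add: algebra_simps)
    have 2: "\<bar>?R\<bar> \<le> 2 * pi" by (rule D_fun_right_edge[OF b])
    have 3: "\<bar>?T\<bar> \<le> K1 + K2 * ln t"
      by (rule top(2)[rule_format]) (use t t0' in \<open>auto simp: good_def\<close>)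
    have 4: "\<bar>?L + (f t - f t0)\<bar> \<le> K + 9 * (ln t - ln t0)"
      unfolding f_def by (rule left(3)) (use t t0' in auto)
    have 5: "ln t0 \<ge> 0" using t0' by simp
    have "\<bar>2 * pi * real_of_int (N_D t) - f t\<bar> = \<bar>2 * pi * real_of_int (N_D t0) + ?B + ?R - ?T - (?L + (f t - f t0)) - f t0\<bar>"
      unfolding 1 by (rule arg_cong[of _ _ abs]) simp
    also have "\<dots> \<le> \<bar>2 * pi * real_of_int (N_D t0)\<bar> + \<bar>?B\<bar> + \<bar>?R\<bar> + \<bar>?T\<bar> + \<bar>?L + (f t - f t0)\<bar> + \<bar>f t0\<bar>"
      by (intro order.trans[OF abs_triangle_ineq4] order.trans[OF abs_triangle_ineq] add_mono order.refl)
    also have "\<dots> \<le> \<bar>2 * pi * real_of_int (N_D t0)\<bar> + \<bar>?B\<bar> + 2 * pi + (K1 + K2 * ln t) + (K + 9 * (ln t - ln t0)) + \<bar>f t0\<bar>"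
      by (intro add_mono order.refl 2 3 4)
    also have "\<dots> \<le> P + Q * ln t"
      using 5 by (simp add: P_def B_def Q_def abs_mult algebra_simps)
    finally show ?thesis .
  qed
  text \<open>If \<open>t\<close> is the ordinate of a zero, \<open>N_D\<close> is still constant just to the right of \<open>t\<close>.\<close>
  have final: "\<bar>2 * pi * real_of_int (N_D t) - (t * ln t - t - ln (2 * pi) * t)\<bar> \<le> P + Q * ln t" if t: "t > t0" for t
  proof -
    have tpos: "t > 0" using t t0' by simp
    have "((\<lambda>t'. P + Q * ln t' - \<bar>2 * pi * real_of_int (N_D t) - f t'\<bar>) \<longlongrightarrow> P + Q * ln t - \<bar>2 * pi * real_of_int (N_D t) - f t\<bar>) (at_right t)"
      unfolding f_def by (intro tendsto_intros) (use tpos in auto)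
    moreover have "eventually (\<lambda>t'. P + Q * ln t' - \<bar>2 * pi * real_of_int (N_D t) - f t'\<bar> \<ge> 0) (at_right t)"
      using ev_good[OF tpos]
    proof eventually_elim
      case (elim t')
      thus ?case using bound[of t'] t by simp
    qed
    ultimately have "0 \<le> P + Q * ln t - \<bar>2 * pi * real_of_int (N_D t) - f t\<bar>"
      by (rule tendsto_lowerbound) simp
    thus "\<bar>2 * pi * real_of_int (N_D t) - (t * ln t - t - ln (2 * pi) * t)\<bar> \<le> P + Q * ln t" by (simp add: f_def)
  qed
  show ?thesis
  proof (rule that)
    show "Q \<ge> 0" using top(1) by (simp add: Q_def)
    show "\<forall>t>t0. \<bar>2 * pi * real_of_int (N_D t) - (t * ln t - t - ln (2 * pi) * t)\<bar> \<le> P + Q * ln t"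
      using final by blast
  qed
qed

theorem theorem6p1:
  shows "(\<lambda>T::real. real_of_int (N_D T) - (T / (2 * pi) * ln (T / (2 * pi)) - T / (2 * pi)))
           \<in> O[at_top](\<lambda>T. ln T)"
proof -
  obtain Q t1 P where B: "Q \<ge> 0" "\<forall>t>t1. \<bar>2 * pi * real_of_int (N_D t) - (t * ln t - t - ln (2 * pi) * t)\<bar> \<le> P + Q * ln t"
    by (rule N_D_bound) (rule that)
  show ?thesis
  proof (rule bigoI)
    show "eventually (\<lambda>T. norm (real_of_int (N_D T) - (T / (2 * pi) * ln (T / (2 * pi)) - T / (2 * pi))) \<le> ((\<bar>P\<bar> + Q) / (2 * pi)) * norm (ln T)) at_top"
      using eventually_gt_at_top[of t1] eventually_ge_at_top[of "3::real"]
    proof eventually_elim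
      case (elim T)
      have T: "T > 0" using elim by simp
      \<comment> \<open>The requirement T >= 3 > e gives ln T >= 1, so the constant P is absorbed
        into a multiple of ln T.\<close>
      have lnT: "ln T \<ge> 1"
      proof -
        have "exp 1 \<le> (3::real)" by (rule exp_le)
        hence "exp 1 \<le> T" using elim by linarith
        thus ?thesis using T by (simp add: ln_ge_iff)
      qed
      have "real_of_int (N_D T) - (T / (2 * pi) * ln (T / (2 * pi)) - T / (2 * pi)) = (2 * pi * real_of_int (N_D T) - (T * ln T - T - ln (2 * pi) * T)) / (2 * pi)"
        using T by (simp add: ln_div field_simps)
      hence "norm (real_of_int (N_D T) - (T / (2 * pi) * ln (T / (2 * pi)) - T / (2 * pi))) = \<bar>2 * pi * real_of_int (N_D T) - (T * ln T - T - ln (2 * pi) * T)\<bar> / (2 * pi)"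
        by (simp add: abs_divide)
      also have "\<dots> \<le> (P + Q * ln T) / (2 * pi)"
        using B(2)[rule_format, of T] elim by (intro divide_right_mono) auto
      also have "\<dots> \<le> ((\<bar>P\<bar> + Q) * ln T) / (2 * pi)"
      proof (rule divide_right_mono)
        have "P \<le> \<bar>P\<bar> * 1" by simp
        also have "\<dots> \<le> \<bar>P\<bar> * ln T" using lnT by (intro mult_left_mono) auto
        finally show "P + Q * ln T \<le> (\<bar>P\<bar> + Q) * ln T" by (simp add: distrib_right)
      qed simp
      finally show ?case using lnT by simp
    qed
  qed
qed

end
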